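(* Let the plant $u_t=\varepsilon\Delta u+\lambda u$ on $\Omega$ and a target-domain configuration on $D$ be compatible, and let $C_D$ and $c$ be the constants in the decay estimate $\|v(t)\|_{L^2(D)}\le C_De^{-ct}\|v(0)\|_{L^2(D)}$ of the target closed loop. For every $u_0\in L^2(\Omega)$ and $z_0\in L^2(\Omega_e)$, the physical state $u$ of the (weak solution of the) coupled system with data $(u_0,z_0)$ satisfies, for all $t\ge0$, $$\|u(t,\cdot)\|_{L^2(\Omega)}\le C_D\,e^{-ct}\bigl(\|u_0\|_{L^2(\Omega)}^2+\|z_0\|_{L^2(\Omega_e)}^2\bigr)^{1/2}.$$ In particular, with $z_0=0$, $$\|u(t,\cdot)\|_{L^2(\Omega)}\le C_D\,e^{-ct}\|u_0\|_{L^2(\Omega)}.$$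
   Context: Throughout, $n\ge2$, $\varepsilon>0$, $\lambda>0$ are constants. Plant. $\Omega\subset\mathbb{R}^n$ is a bounded Lipschitz domain (possibly non-convex or multiply connected), and $u_t=\varepsilon\Delta u+\lambda u$ in $\Omega$, $t>0$. Its boundary splits as $\partial\Omega=\Gamma_u\cup\Gamma_c$: an uncontrolled part $\Gamma_u$ (possibly empty) carrying homogeneous Dirichlet or Neumann conditions, and an actuated part $\Gamma_c$ (Dirichlet or Neumann actuation). Target-domain configuration. It consists of (i) a bounded Lipschitz domain $D\supset\Omega$; (ii) a partition $\partial D=\Sigma_u\cup\Sigma_c$ with a Dirichlet or Neumann condition assigned to each boundary portion (homogeneous on $\Sigma_u$, controlled on $\Sigma_c$) and, for output feedback, a measured set $\Sigma_m\subseteq\partial D$; (iii) a feedback law assigning to a state on $D$ boundary data on $\Sigma_c$: $\mathcal F[v]$ (Dirichlet data) or $\mathcal F^N[v]$ (Neumann data). The target closed loop is $v_t=\varepsilon\Delta v+\lambda v$ in $D$, with $v=\mathcal F[v]$ (resp. $\partial_n v=\mathcal F^N[v]$) on $\Sigma_c$ and the homogeneous conditions on $\Sigma_u$. It is assumed that for every $v(0)\in L^2(D)$ it has a unique weak solution, and that there are constants $C_D\ge 1$, $c>0$ with $\|v(t)\|_{L^2(D)}\le C_De^{-ct}\|v(0)\|_{L^2(D)}$ for $t\ge0$. Compatibility. (i) $\overline\Omega\subset\overline D$, $\Omega_e:=D\setminus\overline\Omega$ is a finite union of bounded Lipschitz domains, $\Gamma:=\partial\Omega\cap D$ is a relatively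 open Lipschitz interface, and junctions between $\Gamma$ and $\partial D$ have surface measure zero; (ii) $\Gamma_u=\partial\Omega\cap\partial D\subset\Sigma_u$, with the same Dirichlet or Neumann condition in the plant and in the configuration; (iii) $\Gamma_c=\Gamma$, and the complementary collocated measurement (flux if Dirichlet-actuated, trace if Neumann-actuated) is available there; (iv) for output feedback only: measurements on $\Sigma_m\cap\Gamma_u$ come from physical sensors, and those on $\Sigma_m\setminus\Gamma_u$ are computed from the virtual state. Concatenation. $\mathcal J(u,z)=u$ on $\Omega$ and $=z$ on $\Omega_e$. Coupled system. $u_t=\varepsilon\Delta u+\lambda u$ in $\Omega$; $z_t=\varepsilon\Delta z+\lambda z$ in $\Omega_e$; $u=z$ and $\partial_{n_\Omega}u=\partial_{n_\Omega}z$ on $\Gamma$ ($n_\Omega$ the outward unit normal of $\Omega$); $z=\mathcal F[\mathcal J(u,z)]$ on $\Sigma_c$ (or $\partial_nz=\mathcal F^N[\mathcal J(u,z)]$ for a Neumann-actuated target); the homogeneous conditions on $\Gamma_u$ for $u$ and on $\Sigma_u\setminus\Gamma_u$ for $z$; $u(0)=u_0$, $z(0)=z_0$. Weak solutions. Let $\Sigma_D$ be the union of the portions of $\partial D$ carrying a (controlled or homogeneous) Dirichlet condition and $V_D=\{\varphi\in H^1(D):\varphi|_{\Sigma_D}=0\}$. A pair $u\in C([0,\infty);L^2(\Omega))\cap L^2_{\rm loc}((0,\infty);H^1(\Omega))$, $z\in C([0,\infty);L^2(\Omega_e))\cap L^2_{\rm loc}((0,\infty);H^1(\Omega_e))$ is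 a weak solution of the coupled system with data $(u_0,z_0)$ if $u(0)=u_0$, $z(0)=z_0$, and for a.e. $t>0$: (a) the traces satisfy $u(t)|_\Gamma=z(t)|_\Gamma$; (b) the Dirichlet conditions on $\partial D$ hold in the trace sense, including $z|_{\Sigma_c}=\mathcal F[\mathcal J(u,z)]$ when the target actuation is Dirichlet; (c) for every $\varphi\in V_D$, in the sense of distributions on $(0,\infty)$, $$\frac{d}{dt}\Bigl[\int_\Omega u\varphi+\int_{\Omega_e}z\varphi\Bigr]=-\varepsilon\Bigl[\int_\Omega\nabla u\cdot\nabla\varphi+\int_{\Omega_e}\nabla z\cdot\nabla\varphi\Bigr]+\lambda\Bigl[\int_\Omega u\varphi+\int_{\Omega_e}z\varphi\Bigr].$$ If the target actuation is Neumann, $\Sigma_c$ is excluded from $\Sigma_D$ and the right-hand side contains the additional term $\varepsilon\langle\mathcal F^N[\mathcal J(u,z)],\varphi|_{\Sigma_c}\rangle$ (boundary duality). A weak solution of the target closed loop with data $v_0$ is $v\in C([0,\infty);L^2(D))\cap L^2_{\rm loc}((0,\infty);H^1(D))$ with $v(0)=v_0$, satisfying the Dirichlet conditions on $\partial D$ in the trace sense for a.e. $t>0$ and the same variational identity with single integrals over $D$. *)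

theory Defs
  imports "HOL-Analysis.Analysis"
begin

section \<open>Surface measure\<close>

text \<open>The normalised \<open>s\<close>-dimensional Hausdorff outer measure, for \<open>s > 0\<close> (for \<open>s = 0\<close> the convention
  \<open>0 powr 0 = 0\<close> would give the wrong value on points). Boundedness of the covering sets is
  required because \<^const>\<open>diameter\<close> is unspecified on unbounded sets.\<close>

definition hausdorff_pre :: "real \<Rightarrow> real \<Rightarrow> 'a::metric_space set \<Rightarrow> ennreal" where
  "hausdorff_pre s \<delta> A =
     (INF C\<in>{C :: nat \<Rightarrow> 'a set. A \<subseteq> (\<Union>i. C i) \<and> (\<forall>i. bounded (C i) \<and> diameter (C i) \<le> \<delta>)}.
        \<Sum>i. ennreal (unit_ball_vol s * (diameter (C i) / 2) powr s))"

definition hausdorff_outer :: "real \<Rightarrow> 'a::metric_space set \<Rightarrow> ennreal" where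
  "hausdorff_outer s A = (SUP \<delta>\<in>{0<..}. hausdorff_pre s \<delta> A)"

text \<open>Restriction of the outer measure to its Caratheodory-measurable sets; this measure is
  complete.\<close>

definition hausdorff_measure :: "real \<Rightarrow> 'a::metric_space measure" where
  "hausdorff_measure s =
     measure_of UNIV (lambda_system UNIV (Pow UNIV) (hausdorff_outer s)) (hausdorff_outer s)"

definition surface_measure :: "'a::euclidean_space measure" where
  "surface_measure = hausdorff_measure (real DIM('a) - 1)"


section \<open>Lipschitz domains\<close>

text \<open>The graph, in direction \<open>e\<close>, of \<open>\<gamma>\<close> over the hyperplane orthogonal to \<open>e\<close>; only the values
  of \<open>\<gamma>\<close> on that hyperplane matter.\<close>

definition subgraph :: "'a::euclidean_space \<Rightarrow> ('a \<Rightarrow> real) \<Rightarrow> 'a set" where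
  "subgraph e \<gamma> = {y. y \<bullet> e < \<gamma> (y - (y \<bullet> e) *\<^sub>R e)}"

definition graph_over :: "'a::euclidean_space \<Rightarrow> ('a \<Rightarrow> real) \<Rightarrow> 'a set" where
  "graph_over e \<gamma> = {y. y \<bullet> e = \<gamma> (y - (y \<bullet> e) *\<^sub>R e)}"

definition bounded_lipschitz_domain :: "'a::euclidean_space set \<Rightarrow> bool" where
  "bounded_lipschitz_domain U \<longleftrightarrow>
     open U \<and> connected U \<and> U \<noteq> {} \<and> bounded U \<and>
     (\<forall>x\<in>frontier U. \<exists>e \<gamma> L r. norm e = 1 \<and> L-lipschitz_on UNIV \<gamma> \<and> r > 0 \<and>
        U \<inter> ball x r = subgraph e \<gamma> \<inter> ball x r)"

definition lipschitz_hypersurface :: "'a::euclidean_space set \<Rightarrow> bool" where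
  "lipschitz_hypersurface S \<longleftrightarrow>
     (\<forall>x\<in>S. \<exists>e \<gamma> L r. norm e = 1 \<and> L-lipschitz_on UNIV \<gamma> \<and> r > 0 \<and>
        S \<inter> ball x r = graph_over e \<gamma> \<inter> ball x r)"


section \<open>Square-integrable functions, Sobolev functions and traces\<close>

text \<open>Functions on a set \<open>U\<close> are represented by total functions whose values outside \<open>U\<close> are
  irrelevant; equality almost everywhere plays the role of equality in \<open>L\<^sup>2(U)\<close>.\<close>

definition L2 :: "'a::euclidean_space set \<Rightarrow> ('a \<Rightarrow> real) set" where
  "L2 U = {f. f \<in> borel_measurable (lebesgue_on U) \<and> integrable (lebesgue_on U) (\<lambda>x. (f x)\<^sup>2)}"

definition L2_norm :: "'a::euclidean_space set \<Rightarrow> ('a \<Rightarrow> real) \<Rightarrow> real" where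
  "L2_norm U f = sqrt (LINT x|lebesgue_on U. (f x)\<^sup>2)"

definition dir_deriv :: "('a::euclidean_space \<Rightarrow> real) \<Rightarrow> 'a \<Rightarrow> 'a \<Rightarrow> real" where
  "dir_deriv f b x = frechet_derivative f (at x) b"

primrec C_k :: "nat \<Rightarrow> ('a::euclidean_space \<Rightarrow> real) \<Rightarrow> bool" where
  "C_k 0 f \<longleftrightarrow> continuous_on UNIV f"
| "C_k (Suc k) f \<longleftrightarrow> (\<forall>x. f differentiable at x) \<and> (\<forall>b\<in>Basis. C_k k (dir_deriv f b))"

definition smooth :: "('a::euclidean_space \<Rightarrow> real) \<Rightarrow> bool" where
  "smooth f \<longleftrightarrow> (\<forall>k. C_k k f)"

definition test_function :: "'a::euclidean_space set \<Rightarrow> ('a \<Rightarrow> real) \<Rightarrow> bool" where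
  "test_function U \<phi> \<longleftrightarrow>
     smooth \<phi> \<and> compact (closure {x. \<phi> x \<noteq> 0}) \<and> closure {x. \<phi> x \<noteq> 0} \<subseteq> U"

definition has_weak_gradient ::
  "'a::euclidean_space set \<Rightarrow> ('a \<Rightarrow> real) \<Rightarrow> ('a \<Rightarrow> 'a) \<Rightarrow> bool" where
  "has_weak_gradient U f G \<longleftrightarrow>
     f \<in> L2 U \<and> (\<forall>b\<in>Basis. (\<lambda>x. G x \<bullet> b) \<in> L2 U) \<and>
     (\<forall>\<phi> b. test_function U \<phi> \<longrightarrow> b \<in> Basis \<longrightarrow>
        (LINT x|lebesgue_on U. f x * dir_deriv \<phi> b x) = - (LINT x|lebesgue_on U. (G x \<bullet> b) * \<phi> x))"

definition H1 :: "'a::euclidean_space set \<Rightarrow> ('a \<Rightarrow> real) set" where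
  "H1 U = {f. \<exists>G. has_weak_gradient U f G}"

definition weak_gradient :: "'a::euclidean_space set \<Rightarrow> ('a \<Rightarrow> real) \<Rightarrow> 'a \<Rightarrow> 'a" where
  "weak_gradient U f = (SOME G. has_weak_gradient U f G)"

definition H1_norm :: "'a::euclidean_space set \<Rightarrow> ('a \<Rightarrow> real) \<Rightarrow> real" where
  "H1_norm U f =
     sqrt ((LINT x|lebesgue_on U. (f x)\<^sup>2) + (LINT x|lebesgue_on U. (norm (weak_gradient U f x))\<^sup>2))"

text \<open>\<open>g\<close> is the trace of \<open>f \<in> H\<^sup>1(U)\<close> on \<open>S \<subseteq> \<partial>U\<close>: it is the \<open>L\<^sup>2\<close>-limit of the restrictions of smooth
  functions that approximate \<open>f\<close> in \<open>H\<^sup>1\<close>. The approximation is required near almost every point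
  of \<open>S\<close>. On a bounded Lipschitz domain this is the usual trace (the continuous extension of the
  restriction map); the local form is needed for a finite union of Lipschitz domains, which
  need not be Lipschitz where the boundaries of the pieces meet.\<close>

definition has_trace ::
  "'a::euclidean_space set \<Rightarrow> ('a \<Rightarrow> real) \<Rightarrow> 'a set \<Rightarrow> ('a \<Rightarrow> real) \<Rightarrow> bool" where
  "has_trace U f S g \<longleftrightarrow>
     f \<in> H1 U \<and> g \<in> borel_measurable (restrict_space surface_measure S) \<and>
     (AE x in surface_measure. x \<in> S \<longrightarrow>
        (\<exists>r>0. \<exists>\<phi>. (\<forall>k::nat. smooth (\<phi> k)) \<and>
           (\<lambda>k. H1_norm (U \<inter> ball x r) (\<lambda>y. \<phi> k y - f y)) \<longlonglongrightarrow> 0 \<and>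
           (\<lambda>k. \<integral>\<^sup>+y\<in>S \<inter> ball x r. ennreal ((\<phi> k y - g y)\<^sup>2) \<partial>surface_measure) \<longlonglongrightarrow> 0))"

definition boundary_trace :: "'a::euclidean_space set \<Rightarrow> 'a set \<Rightarrow> ('a \<Rightarrow> real) \<Rightarrow> 'a \<Rightarrow> real" where
  "boundary_trace U S f = (SOME g. has_trace U f S g)"


section \<open>Functions of time\<close>

text \<open>\<open>C([0,\<infinity>); L\<^sup>2(U))\<close>\<close>

definition continuous_L2 :: "'a::euclidean_space set \<Rightarrow> (real \<Rightarrow> 'a \<Rightarrow> real) \<Rightarrow> bool" where
  "continuous_L2 U u \<longleftrightarrow>
     (\<forall>t\<ge>0. u t \<in> L2 U \<and> ((\<lambda>s. L2_norm U (\<lambda>x. u s x - u t x)) \<longlongrightarrow> 0) (at t within {0..}))"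

text \<open>\<open>L\<^sup>2\<^sub>l\<^sub>o\<^sub>c((0,\<infinity>); H\<^sup>1(U))\<close>, with strong (Bochner) measurability. The library's Bochner theory cannot
  be applied directly, as \<open>H\<^sup>1(U)\<close> is not a type.\<close>

definition L2_loc_H1 :: "'a::euclidean_space set \<Rightarrow> (real \<Rightarrow> 'a \<Rightarrow> real) \<Rightarrow> bool" where
  "L2_loc_H1 U u \<longleftrightarrow>
     (AE t in lebesgue_on {0<..}. u t \<in> H1 U) \<and>
     (\<exists>s. (\<forall>k::nat. simple_function (lebesgue_on {0<..}) (s k) \<and> (\<forall>t>0. s k t \<in> H1 U)) \<and>
        (AE t in lebesgue_on {0<..}. (\<lambda>k. H1_norm U (\<lambda>x. s k t x - u t x)) \<longlonglongrightarrow> 0)) \<and>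
     (\<forall>a b. 0 < a \<longrightarrow> a \<le> b \<longrightarrow> set_integrable lebesgue {a..b} (\<lambda>t. (H1_norm U (u t))\<^sup>2))"

text \<open>\<open>A' = B\<close> in the sense of distributions on \<open>(0,\<infinity>)\<close>. Local integrability is part of the
  definition: the Lebesgue integral of a non-integrable function is \<open>0\<close> here.\<close>

definition distributional_deriv :: "(real \<Rightarrow> real) \<Rightarrow> (real \<Rightarrow> real) \<Rightarrow> bool" where
  "distributional_deriv A B \<longleftrightarrow>
     (\<forall>a b. 0 < a \<longrightarrow> a \<le> b \<longrightarrow> set_integrable lebesgue {a..b} A \<and> set_integrable lebesgue {a..b} B) \<and>
     (\<forall>\<eta>. test_function {0<..} \<eta> \<longrightarrow>
        (LINT t|lebesgue_on {0<..}. A t * deriv \<eta> t) = - (LINT t|lebesgue_on {0<..}. B t * \<eta> t))"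


section \<open>Plant and target-domain configuration\<close>

datatype bc = Dirichlet | Neumann

fun complementary :: "bc \<Rightarrow> bc" where
  "complementary Dirichlet = Neumann"
| "complementary Neumann = Dirichlet"

text \<open>\<open>\<Gamma>u_dir\<close> is the part of \<open>\<Gamma>u\<close> with the homogeneous Dirichlet condition; on the rest of \<open>\<Gamma>u\<close> the
  homogeneous Neumann condition is imposed. \<open>collocated\<close> contains the boundary quantities
  measured on \<open>\<Gamma>c\<close>, \<^const>\<open>Dirichlet\<close> standing for the trace and \<^const>\<open>Neumann\<close> for the flux. \<open>sensors\<close> is
  the part of the boundary equipped with physical sensors.\<close>

record 'a plant =
  \<Omega> :: "'a set"
  \<Gamma>u :: "'a set"
  \<Gamma>u_dir :: "'a set"
  \<Gamma>c :: "'a set"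
  actuation :: bc
  collocated :: "bc set"
  sensors :: "'a set"

text \<open>A Dirichlet law sends a state on the target domain to a function on the controlled
  boundary. A Neumann law \<open>N\<close> sends a state \<open>f\<close> to an element of the dual of the traces:
  \<open>N f g\<close> is the duality bracket of the Neumann datum of \<open>f\<close> with the boundary function \<open>g\<close>.\<close>

datatype 'a feedback_law =
    Dirichlet_law "('a \<Rightarrow> real) \<Rightarrow> 'a \<Rightarrow> real"
  | Neumann_law "('a \<Rightarrow> real) \<Rightarrow> ('a \<Rightarrow> real) \<Rightarrow> real"

text \<open>\<open>\<Sigma>u_dir\<close> is to \<open>\<Sigma>u\<close> as \<open>\<Gamma>u_dir\<close> is to \<open>\<Gamma>u\<close>; the kind of condition on \<open>\<Sigma>c\<close> is given by \<open>law\<close>. \<open>\<Sigma>m\<close> is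
  \<^const>\<open>None\<close> for state feedback.\<close>

record 'a target =
  D :: "'a set"
  \<Sigma>u :: "'a set"
  \<Sigma>u_dir :: "'a set"
  \<Sigma>c :: "'a set"
  \<Sigma>m :: "'a set option"
  law :: "'a feedback_law"

definition plant_config :: "'a::euclidean_space plant \<Rightarrow> bool" where
  "plant_config P \<longleftrightarrow>
     bounded_lipschitz_domain (\<Omega> P) \<and>
     frontier (\<Omega> P) = \<Gamma>u P \<union> \<Gamma>c P \<and> \<Gamma>u P \<inter> \<Gamma>c P = {} \<and> \<Gamma>u_dir P \<subseteq> \<Gamma>u P \<and>
     \<Gamma>u P \<in> sets borel \<and> \<Gamma>u_dir P \<in> sets borel \<and> \<Gamma>c P \<in> sets borel \<and>
     sensors P \<subseteq> frontier (\<Omega> P)"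

definition \<Sigma>D :: "'a target \<Rightarrow> 'a set" where
  "\<Sigma>D T = \<Sigma>u_dir T \<union> (case law T of Dirichlet_law _ \<Rightarrow> \<Sigma>c T | Neumann_law _ \<Rightarrow> {})"

definition VD :: "'a::euclidean_space target \<Rightarrow> ('a \<Rightarrow> real) set" where
  "VD T = {\<phi> \<in> H1 (D T). has_trace (D T) \<phi> (\<Sigma>D T) (\<lambda>_. 0)}"

text \<open>A feedback law respects equality almost everywhere, and a Neumann datum is a bounded linear
  functional on the traces on \<open>\<Sigma>c\<close> of functions in \<open>V\<^sub>D\<close> (with the quotient norm).\<close>

definition valid_law :: "'a::euclidean_space target \<Rightarrow> bool" where
  "valid_law T \<longleftrightarrow>
     (case law T of
        Dirichlet_law F \<Rightarrow>
          (\<forall>f f'. (AE x in lebesgue_on (D T). f x = f' x) \<longrightarrow>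
             (AE x in surface_measure. x \<in> \<Sigma>c T \<longrightarrow> F f x = F f' x))
      | Neumann_law N \<Rightarrow>
          (\<forall>f f' g g'. (AE x in lebesgue_on (D T). f x = f' x) \<longrightarrow>
             (AE x in surface_measure. x \<in> \<Sigma>c T \<longrightarrow> g x = g' x) \<longrightarrow> N f g = N f' g') \<and>
          (\<forall>f\<in>H1 (D T).
             (\<forall>\<phi>\<in>VD T. \<forall>\<psi>\<in>VD T. \<forall>a b g h.
                has_trace (D T) \<phi> (\<Sigma>c T) g \<longrightarrow> has_trace (D T) \<psi> (\<Sigma>c T) h \<longrightarrow>
                N f (\<lambda>x. a * g x + b * h x) = a * N f g + b * N f h) \<and>
             (\<exists>K. \<forall>\<phi>\<in>VD T. \<forall>g. has_trace (D T) \<phi> (\<Sigma>c T) g \<longrightarrow>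
                \<bar>N f g\<bar> \<le> K * H1_norm (D T) \<phi>)))"

definition target_config :: "'a::euclidean_space target \<Rightarrow> bool" where
  "target_config T \<longleftrightarrow>
     bounded_lipschitz_domain (D T) \<and>
     frontier (D T) = \<Sigma>u T \<union> \<Sigma>c T \<and> \<Sigma>u T \<inter> \<Sigma>c T = {} \<and> \<Sigma>u_dir T \<subseteq> \<Sigma>u T \<and>
     \<Sigma>u T \<in> sets borel \<and> \<Sigma>u_dir T \<in> sets borel \<and> \<Sigma>c T \<in> sets borel \<and>
     (\<forall>S. \<Sigma>m T = Some S \<longrightarrow> S \<subseteq> frontier (D T)) \<and>
     valid_law T"

definition \<Omega>e :: "'a::euclidean_space plant \<Rightarrow> 'a target \<Rightarrow> 'a set" where
  "\<Omega>e P T = D T - closure (\<Omega> P)"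

definition interface :: "'a::euclidean_space plant \<Rightarrow> 'a target \<Rightarrow> 'a set" where
  "interface P T = frontier (\<Omega> P) \<inter> D T"

text \<open>The last condition records that measurements on \<open>\<Sigma>m \<inter> \<Gamma>u\<close> are physical. Those on \<open>\<Sigma>m - \<Gamma>u\<close> are
  computed from the virtual state, which imposes no condition.\<close>

definition compatible :: "'a::euclidean_space plant \<Rightarrow> 'a target \<Rightarrow> bool" where
  "compatible P T \<longleftrightarrow>
     \<Omega> P \<subseteq> D T \<and> closure (\<Omega> P) \<subseteq> closure (D T) \<and>
     (\<exists>\<C>. finite \<C> \<and> (\<forall>U\<in>\<C>. bounded_lipschitz_domain U) \<and> \<Omega>e P T = \<Union>\<C>) \<and>
     openin (top_of_set (frontier (\<Omega> P))) (interface P T) \<and>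
     lipschitz_hypersurface (interface P T) \<and>
     closure (interface P T) \<inter> frontier (D T) \<in> null_sets surface_measure \<and>
     \<Gamma>u P = frontier (\<Omega> P) \<inter> frontier (D T) \<and> \<Gamma>u P \<subseteq> \<Sigma>u T \<and>
     \<Gamma>u_dir P = \<Gamma>u P \<inter> \<Sigma>u_dir T \<and>
     \<Gamma>c P = interface P T \<and> complementary (actuation P) \<in> collocated P \<and>
     (\<forall>S. \<Sigma>m T = Some S \<longrightarrow> S \<inter> \<Gamma>u P \<subseteq> sensors P)"


section \<open>Weak solutions\<close>

definition concat_state :: "'a plant \<Rightarrow> ('a \<Rightarrow> real) \<Rightarrow> ('a \<Rightarrow> real) \<Rightarrow> 'a \<Rightarrow> real" where
  "concat_state P u z = (\<lambda>x. if x \<in> \<Omega> P then u x else z x)"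

definition neumann_term :: "'a::euclidean_space target \<Rightarrow> ('a \<Rightarrow> real) \<Rightarrow> ('a \<Rightarrow> real) \<Rightarrow> real" where
  "neumann_term T f \<phi> =
     (case law T of Dirichlet_law _ \<Rightarrow> 0 | Neumann_law N \<Rightarrow> N f (boundary_trace (D T) (\<Sigma>c T) \<phi>))"

definition target_solution ::
  "real \<Rightarrow> real \<Rightarrow> 'a::euclidean_space target \<Rightarrow> ('a \<Rightarrow> real) \<Rightarrow> (real \<Rightarrow> 'a \<Rightarrow> real) \<Rightarrow> bool" where
  "target_solution \<epsilon> lam T v0 v \<longleftrightarrow>
     continuous_L2 (D T) v \<and> L2_loc_H1 (D T) v \<and>
     (AE x in lebesgue_on (D T). v 0 x = v0 x) \<and>
     (AE t in lebesgue_on {0<..}.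
        has_trace (D T) (v t) (\<Sigma>u_dir T) (\<lambda>_. 0) \<and>
        (\<forall>F. law T = Dirichlet_law F \<longrightarrow> has_trace (D T) (v t) (\<Sigma>c T) (F (v t)))) \<and>
     (\<forall>\<phi>\<in>VD T. distributional_deriv
        (\<lambda>t. LINT x|lebesgue_on (D T). v t x * \<phi> x)
        (\<lambda>t. - \<epsilon> * (LINT x|lebesgue_on (D T). weak_gradient (D T) (v t) x \<bullet> weak_gradient (D T) \<phi> x)
             + lam * (LINT x|lebesgue_on (D T). v t x * \<phi> x)
             + \<epsilon> * neumann_term T (v t) \<phi>))"

definition coupled_solution ::
  "real \<Rightarrow> real \<Rightarrow> 'a::euclidean_space plant \<Rightarrow> 'a target \<Rightarrow> ('a \<Rightarrow> real) \<Rightarrow> ('a \<Rightarrow> real) \<Rightarrow>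
     (real \<Rightarrow> 'a \<Rightarrow> real) \<Rightarrow> (real \<Rightarrow> 'a \<Rightarrow> real) \<Rightarrow> bool" where
  "coupled_solution \<epsilon> lam P T u0 z0 u z \<longleftrightarrow>
     continuous_L2 (\<Omega> P) u \<and> L2_loc_H1 (\<Omega> P) u \<and>
     continuous_L2 (\<Omega>e P T) z \<and> L2_loc_H1 (\<Omega>e P T) z \<and>
     (AE x in lebesgue_on (\<Omega> P). u 0 x = u0 x) \<and>
     (AE x in lebesgue_on (\<Omega>e P T). z 0 x = z0 x) \<and>
     (AE t in lebesgue_on {0<..}.
        (\<exists>g. has_trace (\<Omega> P) (u t) (interface P T) g \<and>
             has_trace (\<Omega>e P T) (z t) (interface P T) g) \<and>
        has_trace (\<Omega> P) (u t) (\<Gamma>u_dir P) (\<lambda>_. 0) \<and>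
        has_trace (\<Omega>e P T) (z t) (\<Sigma>u_dir T - \<Gamma>u P) (\<lambda>_. 0) \<and>
        (\<forall>F. law T = Dirichlet_law F \<longrightarrow>
             has_trace (\<Omega>e P T) (z t) (\<Sigma>c T) (F (concat_state P (u t) (z t))))) \<and>
     (\<forall>\<phi>\<in>VD T. distributional_deriv
        (\<lambda>t. (LINT x|lebesgue_on (\<Omega> P). u t x * \<phi> x) + (LINT x|lebesgue_on (\<Omega>e P T). z t x * \<phi> x))
        (\<lambda>t. - \<epsilon> * ((LINT x|lebesgue_on (\<Omega> P).
                        weak_gradient (\<Omega> P) (u t) x \<bullet> weak_gradient (D T) \<phi> x)
                   + (LINT x|lebesgue_on (\<Omega>e P T).
                        weak_gradient (\<Omega>e P T) (z t) x \<bullet> weak_gradient (D T) \<phi> x))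
             + lam * ((LINT x|lebesgue_on (\<Omega> P). u t x * \<phi> x)
                    + (LINT x|lebesgue_on (\<Omega>e P T). z t x * \<phi> x))
             + \<epsilon> * neumann_term T (concat_state P (u t) (z t)) \<phi>))"

text \<open>Existence and uniqueness (up to equality almost everywhere in space, for each time) for
  the target closed loop.\<close>

definition target_well_posed :: "real \<Rightarrow> real \<Rightarrow> 'a::euclidean_space target \<Rightarrow> bool" where
  "target_well_posed \<epsilon> lam T \<longleftrightarrow>
     (\<forall>v0\<in>L2 (D T).
        (\<exists>v. target_solution \<epsilon> lam T v0 v) \<and>
        (\<forall>v w. target_solution \<epsilon> lam T v0 v \<longrightarrow> target_solution \<epsilon> lam T v0 w \<longrightarrow>
           (\<forall>t\<ge>0. AE x in lebesgue_on (D T). v t x = w t x)))"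

definition target_decay :: "real \<Rightarrow> real \<Rightarrow> 'a::euclidean_space target \<Rightarrow> real \<Rightarrow> real \<Rightarrow> bool" where
  "target_decay \<epsilon> lam T C c \<longleftrightarrow>
     (\<forall>v0\<in>L2 (D T). \<forall>v. target_solution \<epsilon> lam T v0 v \<longrightarrow>
        (\<forall>t\<ge>0. L2_norm (D T) (v t) \<le> C * exp (- c * t) * L2_norm (D T) (v 0)))"

end

theory Submission
  imports Defs
begin

text \<open>
  The coupled system is the target closed loop in disguise. Let \<open>v = \<J>(u, z)\<close> be the concatenation
  of the two components of a weak solution of the coupled system. The variational identity of the
  coupled system is that of the target system with every integral over \<open>D\<close> cut into an integral over
  \<open>\<Omega>\<close> and one over \<open>\<Omega>\<^sub>e\<close>, and the transmission condition \<open>u = z\<close> on \<open>\<Gamma>\<close> is what makes \<open>v(t)\<close> an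
  \<open>H\<^sup>1(D)\<close> function whose gradient is the concatenation of the two gradients. So \<open>v\<close> is a weak solution
  of the target closed loop (\<open>coupled_solution_imp_target_solution\<close>), the assumed decay applies to it,
  and \<open>\<parallel>u(t)\<parallel> \<le> \<parallel>v(t)\<parallel>\<close> while \<open>\<parallel>v(0)\<parallel>\<^sup>2 = \<parallel>u\<^sub>0\<parallel>\<^sup>2 + \<parallel>z\<^sub>0\<parallel>\<^sup>2\<close>.

  The analytic core is the gluing lemma \<open>glue_has_weak_gradient\<close>: two Sobolev functions with the same
  trace on a Lipschitz interface form one Sobolev function. Traces are given by approximation with
  smooth functions \<open>\<phi>\<^sub>k\<close> and \<open>\<psi>\<^sub>k\<close> on the two sides near almost every point of the interface. Integrating
  by parts, the defect of the weak derivative against a test function \<open>\<eta>\<close> becomes the limit of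
  \<open>\<integral> \<partial>\<^sub>b ((\<phi>\<^sub>k - \<psi>\<^sub>k) \<eta>)\<close> over the region below a Lipschitz graph, which should be a surface integral of a
  quantity that tends to zero. The needed bound (\<open>subgraph_dir_deriv_bound\<close>) comes from writing the
  derivative as a limit of difference quotients. A translation by \<open>s\<close> changes the region below the graph
  only inside a layer of width of order \<open>s\<close>, and covering arguments bound an integral over the layer,
  divided by \<open>s\<close>, by an integral against the Hausdorff measure of the graph.

  This works near almost every interface point only; the exceptional points form a relatively closed
  set of surface measure zero. It is removable for the derivative in a coordinate direction \<open>b\<close>, because
  its shadow along \<open>b\<close> is a Lebesgue null set, so that it can be cut out by functions that are constant
  along \<open>b\<close> (\<open>weak_pairing_cut_out\<close>).

  The trace of \<open>v\<close> on \<open>\<partial>D\<close> is local, and near almost every boundary point \<open>D\<close> coincides with one of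
  the two pieces: near a point outside the closure of \<open>\<Omega>\<close> with \<open>\<Omega>\<^sub>e\<close>, and near a point of \<open>\<Gamma>\<^sub>u\<close> away from
  the closure of \<open>\<Gamma>\<close> with \<open>\<Omega>\<close>, since \<open>D\<close> is locally connected at its Lipschitz boundary.
\<close>

section \<open>Smooth functions\<close>

lemma dir_deriv_eq:
  assumes "(f has_derivative f') (at x)"
  shows "dir_deriv f b x = f' b"
  by (simp add: dir_deriv_def frechet_derivative_at[OF assms, symmetric])

lemma C_k_SucI:
  assumes "\<And>x. (f has_derivative f' x) (at x)"
    and "\<And>b. b \<in> Basis \<Longrightarrow> C_k k (\<lambda>x. f' x b)"
  shows "C_k (Suc k) f"
proof -
  have "dir_deriv f b = (\<lambda>x. f' x b)" for b
    using dir_deriv_eq[OF assms(1)] by auto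
  then show ?thesis using assms by (auto simp: differentiable_def)
qed

lemma C_k_Suc_has_derivative:
  assumes "C_k (Suc k) f"
  shows "(f has_derivative (\<lambda>h. dir_deriv f h x)) (at x)"
  using assms by (simp add: dir_deriv_def frechet_derivative_works[symmetric])

lemma C_k_SucD: "C_k (Suc k) f \<Longrightarrow> C_k k f"
proof (induction k arbitrary: f)
  case 0
  then have "\<And>x. f differentiable (at x)" by simp
  then show ?case
    by (auto intro!: continuous_at_imp_continuous_on differentiable_imp_continuous_within)
next
  case (Suc k)
  then show ?case by (metis C_k.simps(2))
qed

lemma C_k_imp_continuous: "C_k k f \<Longrightarrow> continuous_on UNIV f"
  by (induction k) (use C_k_SucD in auto)

lemma C_k_const: "C_k k (\<lambda>x. c)"
  by (induction k arbitrary: c)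
    (auto intro!: C_k_SucI[where f'="\<lambda>x h. 0"] simp del: C_k.simps(2))

lemma C_k_inner: "C_k k (\<lambda>x. x \<bullet> b)"
  by (cases k) (auto intro!: C_k_SucI[where f'="\<lambda>x h. h \<bullet> b"] C_k_const continuous_intros derivative_eq_intros simp del: C_k.simps(2))

lemma C_k_add: "C_k k f \<Longrightarrow> C_k k g \<Longrightarrow> C_k k (\<lambda>x. f x + g x)"
proof (induction k arbitrary: f g)
  case 0
  then show ?case by (auto intro: continuous_intros)
next
  case (Suc k)
  show ?case
  proof (rule C_k_SucI)
    show "((\<lambda>x. f x + g x) has_derivative (\<lambda>h. dir_deriv f h x + dir_deriv g h x)) (at x)" for x
      using Suc.prems by (intro has_derivative_add C_k_Suc_has_derivative)
  qed (use Suc in auto)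
qed

lemma C_k_mult: "C_k k f \<Longrightarrow> C_k k g \<Longrightarrow> C_k k (\<lambda>x. f x * g x)"
proof (induction k arbitrary: f g)
  case 0
  then show ?case by (auto intro: continuous_intros)
next
  case (Suc k)
  show ?case
  proof (rule C_k_SucI)
    show "((\<lambda>x. f x * g x) has_derivative (\<lambda>h. f x * dir_deriv g h x + dir_deriv f h x * g x)) (at x)" for x
      using Suc.prems by (intro has_derivative_mult C_k_Suc_has_derivative)
    show "C_k k (\<lambda>x. f x * dir_deriv g b x + dir_deriv f b x * g x)" if "b \<in> Basis" for b
      using Suc.prems that by (intro C_k_add Suc.IH C_k_SucD[OF Suc.prems(1)] C_k_SucD[OF Suc.prems(2)]) auto
  qed
qed

lemma C_k_compose: "C_k k (g :: real \<Rightarrow> real) \<Longrightarrow> C_k k f \<Longrightarrow> C_k k (\<lambda>x. g (f x))"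
proof (induction k arbitrary: f g)
  case 0
  then show ?case
    using continuous_on_compose2[of UNIV g UNIV f] by simp
next
  case (Suc k)
  show ?case
  proof (rule C_k_SucI)
    fix x
    have g: "(g has_derivative (\<lambda>h. dir_deriv g h (f x))) (at (f x))"
      by (rule C_k_Suc_has_derivative[OF Suc.prems(1)])
    have lin: "dir_deriv g h (f x) = dir_deriv g 1 (f x) * h" for h
      using linear_cmul[OF has_derivative_linear[OF g], of h 1] by simp
    show "((\<lambda>x. g (f x)) has_derivative (\<lambda>h. dir_deriv g 1 (f x) * dir_deriv f h x)) (at x)"
      by (rule has_derivative_eq_rhs[OF has_derivative_compose[OF C_k_Suc_has_derivative[OF Suc.prems(2)] g]])
        (rule ext, rule lin)
  next
    fix b :: 'a assume "b \<in> Basis"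
    then show "C_k k (\<lambda>x. dir_deriv g 1 (f x) * dir_deriv f b x)"
      using Suc.prems by (intro C_k_mult[OF Suc.IH[OF _ C_k_SucD[OF Suc.prems(2)]]]) auto
  qed
qed

lemma C_k_inverse: "C_k k f \<Longrightarrow> (\<And>x. f x \<noteq> 0) \<Longrightarrow> C_k k (\<lambda>x. inverse (f x))"
proof (induction k arbitrary: f)
  case 0
  then show ?case by (auto intro: continuous_intros)
next
  case (Suc k)
  show ?case
  proof (rule C_k_SucI)
    show "((\<lambda>x. inverse (f x)) has_derivative
        (\<lambda>h. (- 1) * (inverse (f x) * dir_deriv f h x * inverse (f x)))) (at x)" for x
      using Suc.prems Deriv.has_derivative_inverse[OF _ C_k_Suc_has_derivative[OF Suc.prems(1)], of x] by simp
    show "C_k k (\<lambda>x. (- 1) * (inverse (f x) * dir_deriv f b x * inverse (f x)))" if "b \<in> Basis" for b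
      using Suc.prems that by (intro C_k_mult Suc.IH C_k_const C_k_SucD[OF Suc.prems(1)]) auto
  qed
qed

lemma C_k_real_SucI:
  assumes "\<And>x. (g has_real_derivative g' x) (at x)" and "C_k k g'"
  shows "C_k (Suc k) g"
  by (rule C_k_SucI[where f'="\<lambda>x h. g' x * h"])
    (use assms in \<open>auto simp: has_field_derivative_def\<close>)

lemma C_k_exp: "C_k k (exp :: real \<Rightarrow> real)"
  by (induction k) (auto intro!: C_k_real_SucI[where g'=exp] continuous_intros DERIV_exp simp del: C_k.simps(2))

lemma smooth_C_k: "smooth f \<Longrightarrow> C_k k f"
  by (simp add: smooth_def)

lemma smooth_const: "smooth (\<lambda>x. c)"
  and smooth_inner: "smooth (\<lambda>x. x \<bullet> b)"
  by (simp_all add: smooth_def C_k_const C_k_inner)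

lemma smooth_add: "smooth f \<Longrightarrow> smooth g \<Longrightarrow> smooth (\<lambda>x. f x + g x)"
  and smooth_mult: "smooth f \<Longrightarrow> smooth g \<Longrightarrow> smooth (\<lambda>x. f x * g x)"
  by (simp_all add: smooth_def C_k_add C_k_mult)

lemma smooth_diff: "smooth f \<Longrightarrow> smooth g \<Longrightarrow> smooth (\<lambda>x. f x - g x)"
  using smooth_add[of f "\<lambda>x. - 1 * g x"] smooth_mult[OF smooth_const, of g "-1"] by simp

lemma smooth_compose: "smooth (g :: real \<Rightarrow> real) \<Longrightarrow> smooth f \<Longrightarrow> smooth (\<lambda>x. g (f x))"
  by (simp add: smooth_def C_k_compose)

lemma smooth_inverse: "smooth f \<Longrightarrow> (\<And>x. f x \<noteq> 0) \<Longrightarrow> smooth (\<lambda>x. inverse (f x))"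
  by (simp add: smooth_def C_k_inverse)

lemma smooth_exp: "smooth (exp :: real \<Rightarrow> real)"
  by (simp add: smooth_def C_k_exp)

lemma smooth_sum: "(\<And>i. i \<in> I \<Longrightarrow> smooth (f i)) \<Longrightarrow> smooth (\<lambda>x. \<Sum>i\<in>I. f i x)"
  by (induction I rule: infinite_finite_induct) (auto intro: smooth_add smooth_const)

lemma smooth_prod: "(\<And>i. i \<in> I \<Longrightarrow> smooth (f i)) \<Longrightarrow> smooth (\<lambda>x. \<Prod>i\<in>I. f i x)"
  by (induction I rule: infinite_finite_induct) (auto intro: smooth_mult smooth_const)

lemma smooth_has_derivative: "smooth f \<Longrightarrow> (f has_derivative (\<lambda>h. dir_deriv f h x)) (at x)"
  by (rule C_k_Suc_has_derivative[OF smooth_C_k])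

lemma smooth_continuous: "smooth f \<Longrightarrow> continuous_on A f"
  using C_k_imp_continuous continuous_on_subset smooth_C_k by blast

lemma smooth_dir_deriv: "smooth f \<Longrightarrow> b \<in> Basis \<Longrightarrow> smooth (dir_deriv f b)"
  unfolding smooth_def by (metis C_k.simps(2))

lemma smooth_measurable: "smooth f \<Longrightarrow> f \<in> borel_measurable borel"
  by (intro borel_measurable_continuous_onI smooth_continuous)

lemma dir_deriv_mult:
  assumes "smooth f" "smooth g"
  shows "dir_deriv (\<lambda>x. f x * g x) b x = f x * dir_deriv g b x + dir_deriv f b x * g x"
  by (rule dir_deriv_eq) (intro has_derivative_mult smooth_has_derivative assms)

lemma dir_deriv_diff:
  assumes "smooth f" "smooth g"
  shows "dir_deriv (\<lambda>x. f x - g x) b x = dir_deriv f b x - dir_deriv g b x"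
  by (rule dir_deriv_eq) (intro has_derivative_diff smooth_has_derivative assms)

text \<open>All the powers \<open>j\<close> are treated together because the span of this family is closed under
  differentiation; each member is then smooth by induction on the order of the derivative. The
  case \<open>j = 0\<close> is the standard smooth function that is positive exactly on the positive half-line.\<close>

definition flat :: "nat \<Rightarrow> real \<Rightarrow> real" where
  "flat j t = (if t \<le> 0 then 0 else inverse t ^ j * exp (- inverse t))"

lemma power_le_fact_exp:
  fixes x :: real
  assumes "0 \<le> x"
  shows "x ^ n \<le> fact n * exp x"
proof -
  have "(\<lambda>k. x ^ k /\<^sub>R fact k) sums exp x" by (rule exp_converges)
  then have "(\<Sum>k\<in>{n}. x ^ k /\<^sub>R fact k) \<le> (\<Sum>k. x ^ k /\<^sub>R fact k)"
    using assms by (intro sum_le_suminf) (auto simp: sums_iff)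
  then have "x ^ n /\<^sub>R fact n \<le> exp x"
    using sums_unique[OF exp_converges[of x]] by simp
  then show ?thesis by (simp add: field_simps)
qed

text \<open>The quadratic bound gives the derivative \<open>0\<close> at the origin, for all \<open>j\<close> at once.\<close>

lemma flat_le_square: "\<bar>flat j t\<bar> \<le> fact (j + 2) * t\<^sup>2"
proof (cases "t \<le> 0")
  case False
  define x where "x = inverse t"
  have x: "0 < x" "t = inverse x" using False by (auto simp: x_def)
  have "x ^ (j + 2) \<le> fact (j + 2) * exp x" using x by (intro power_le_fact_exp) auto
  then have "x ^ j * exp (- x) \<le> fact (j + 2) * (inverse x)\<^sup>2"
    using x(1) by (simp add: power_add exp_minus field_simps power2_eq_square del: fact_Suc)
  then show ?thesis using False x by (simp add: flat_def del: fact_Suc)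
qed (simp add: flat_def)

lemma flat_has_derivative: "(flat j has_real_derivative (flat (j + 2) t + - real j * flat (j + 1) t)) (at t)"
proof -
  consider "t < 0" | "t > 0" | "t = 0" by linarith
  then show ?thesis
  proof cases
    case 1
    have "((\<lambda>t. 0) has_real_derivative 0) (at t)" by simp
    then have "(flat j has_real_derivative 0) (at t)"
      by (rule has_field_derivative_transform_within_open[where S="{..<0}"]) (use 1 in \<open>auto simp: flat_def\<close>)
    then show ?thesis using 1 by (simp add: flat_def)
  next
    case 2
    have inv: "(inverse has_real_derivative - (inverse t * inverse t)) (at t)"
      using DERIV_inverse[of t UNIV] 2 by (simp add: numeral_2_eq_2)
    have pow: "((\<lambda>t. inverse t ^ j) has_real_derivative - real j * inverse t ^ (j + 1)) (at t)"
      using 2 DERIV_power[OF inv, of j] by (cases j) (auto simp: algebra_simps)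
    have "((\<lambda>t. exp (- inverse t)) has_real_derivative exp (- inverse t) * (inverse t * inverse t)) (at t)"
      using 2 by (auto intro!: derivative_eq_intros simp: power2_eq_square)
    from DERIV_mult[OF pow this]
    have "((\<lambda>t. inverse t ^ j * exp (- inverse t)) has_real_derivative
        (flat (j + 2) t + - real j * flat (j + 1) t)) (at t)"
      using 2 by (simp add: flat_def algebra_simps)
    then show ?thesis
      by (rule has_field_derivative_transform_within_open[where S="{0<..}"]) (use 2 in \<open>auto simp: flat_def\<close>)
  next
    case 3
    have "((\<lambda>h. (flat j (0 + h) - flat j 0) / h) \<longlongrightarrow> 0) (at 0)"
    proof (rule Lim_null_comparison)
      show "\<forall>\<^sub>F h in at 0. norm ((flat j (0 + h) - flat j 0) / h) \<le> fact (j + 2) * \<bar>h\<bar>"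
      proof (rule always_eventually, rule allI)
        fix h :: real
        show "norm ((flat j (0 + h) - flat j 0) / h) \<le> fact (j + 2) * \<bar>h\<bar>"
          using flat_le_square[of j h]
          by (cases "h = 0") (auto simp: flat_def divide_simps power2_eq_square abs_mult simp del: fact_Suc)
      qed
      show "((\<lambda>h. fact (j + 2) * \<bar>h\<bar>) \<longlongrightarrow> (0::real)) (at 0)"
        by (auto intro!: tendsto_eq_intros)
    qed
    then show ?thesis using 3 by (simp add: DERIV_def flat_def)
  qed
qed

lemma smooth_flat: "smooth (flat j)"
proof -
  have "C_k k (flat j)" for k
  proof (induction k arbitrary: j)
    case 0
    show ?case using DERIV_isCont[OF flat_has_derivative]
      by (simp add: continuous_at_imp_continuous_on)
  next
    case (Suc k)
    show ?case
      by (rule C_k_real_SucI[OF flat_has_derivative]) (intro C_k_add C_k_mult C_k_const Suc)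
  qed
  then show ?thesis by (simp add: smooth_def)
qed

lemma flat0: "flat 0 t \<ge> 0" "flat 0 t > 0 \<longleftrightarrow> t > 0" "flat 0 t = 0 \<longleftrightarrow> t \<le> 0"
  by (auto simp: flat_def)

definition box_bump :: "'a::euclidean_space \<Rightarrow> 'a \<Rightarrow> 'a \<Rightarrow> real" where
  "box_bump a c x = (\<Prod>b\<in>Basis. flat 0 (x \<bullet> b - a \<bullet> b) * flat 0 (c \<bullet> b - x \<bullet> b))"

lemma smooth_box_bump: "smooth (box_bump a c)"
  unfolding box_bump_def
  by (intro smooth_prod smooth_mult smooth_compose[OF smooth_flat] smooth_diff smooth_inner smooth_const)

lemma box_bump_nonneg: "box_bump a c x \<ge> 0"
  unfolding box_bump_def by (intro prod_nonneg mult_nonneg_nonneg ballI flat0)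

lemma box_bump_eq_0_iff: "box_bump a c x = 0 \<longleftrightarrow> x \<notin> box a c"
  unfolding box_bump_def by (auto simp: flat0 mem_box not_le not_less)

lemma box_bump_pos_iff: "box_bump a c x > 0 \<longleftrightarrow> x \<in> box a c"
  using box_bump_nonneg[of a c x] box_bump_eq_0_iff[of a c x] by linarith

section \<open>Test functions\<close>

lemma test_functionI:
  assumes "smooth \<eta>" "compact K" "K \<subseteq> U" "\<And>x. x \<notin> K \<Longrightarrow> \<eta> x = 0"
  shows "test_function U \<eta>"
proof -
  have "closure {x. \<eta> x \<noteq> 0} \<subseteq> K"
    using assms by (intro closure_minimal) (auto intro: compact_imp_closed)
  moreover have "compact (closure {x. \<eta> x \<noteq> 0})"
    using calculation assms(2) by (meson closed_closure compact_imp_bounded bounded_subset compact_eq_bounded_closed)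
  ultimately show ?thesis using assms by (auto simp: test_function_def)
qed

lemma test_function_smooth: "test_function U \<eta> \<Longrightarrow> smooth \<eta>"
  by (simp add: test_function_def)

lemma test_functionE:
  assumes "test_function U \<eta>"
  obtains K where "compact K" "K \<subseteq> U" "\<And>x. x \<notin> K \<Longrightarrow> \<eta> x = 0" "K = closure {x. \<eta> x \<noteq> 0}"
proof (rule that[OF _ _ _ refl])
  show "compact (closure {x. \<eta> x \<noteq> 0})" "closure {x. \<eta> x \<noteq> 0} \<subseteq> U"
    using assms by (simp_all add: test_function_def)
  show "\<eta> x = 0" if "x \<notin> closure {x. \<eta> x \<noteq> 0}" for x
    using that closure_subset[of "{x. \<eta> x \<noteq> 0}"] by (metis (mono_tags) mem_Collect_eq subsetD)
qed

lemma test_function_mono: "test_function U \<eta> \<Longrightarrow> U \<subseteq> V \<Longrightarrow> test_function V \<eta>"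
  by (auto simp: test_function_def)

lemma test_function_zero: "test_function U \<eta> \<Longrightarrow> x \<notin> U \<Longrightarrow> \<eta> x = 0"
  by (metis test_functionE subsetD)

lemma test_function_mult:
  assumes "test_function U \<eta>" "smooth q"
  shows "test_function U (\<lambda>x. q x * \<eta> x)"
proof -
  obtain K where "compact K" "K \<subseteq> U" "\<And>x. x \<notin> K \<Longrightarrow> \<eta> x = 0" using test_functionE assms(1) by metis
  then show ?thesis
    using assms by (intro test_functionI[of _ K] smooth_mult) (auto simp: test_function_smooth)
qed

lemma test_function_dir_deriv:
  assumes "test_function U \<eta>" "b \<in> Basis"
  shows "test_function U (dir_deriv \<eta> b)"
proof -
  obtain K where K: "compact K" "K \<subseteq> U" "\<And>x. x \<notin> K \<Longrightarrow> \<eta> x = 0" using test_functionE assms(1) by metis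
  have "dir_deriv \<eta> b x = 0" if "x \<notin> K" for x
  proof -
    have "((\<lambda>x. 0 :: real) has_derivative (\<lambda>h. 0)) (at x)" by simp
    then have "(\<eta> has_derivative (\<lambda>h. 0)) (at x)"
      by (rule has_derivative_transform_within_open[where s="- K"])
        (use that K in \<open>auto simp: compact_imp_closed open_Compl\<close>)
    then show ?thesis by (rule dir_deriv_eq)
  qed
  then show ?thesis using assms K
    by (intro test_functionI[of _ K] smooth_dir_deriv) (auto simp: test_function_smooth)
qed

lemma test_function_bounded:
  assumes "test_function U \<eta>"
  obtains M where "M > 0" "\<And>x. \<bar>\<eta> x\<bar> \<le> M"
proof -
  obtain K where K: "compact K" "\<And>x. x \<notin> K \<Longrightarrow> \<eta> x = 0" using test_functionE assms by metis
  have "bounded (\<eta> ` K)"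
    using K(1) assms by (intro compact_imp_bounded compact_continuous_image smooth_continuous test_function_smooth)
  then obtain B where B: "\<And>x. x \<in> K \<Longrightarrow> \<bar>\<eta> x\<bar> \<le> B" by (auto simp: bounded_iff)
  have "\<bar>\<eta> x\<bar> \<le> max B 1" for x using B[of x] K(2)[of x] by (cases "x \<in> K") auto
  then show ?thesis by (intro that[of "max B 1"]) auto
qed

section \<open>Square-integrable functions\<close>

lemma lint_indicator:
  fixes f :: "'a::euclidean_space \<Rightarrow> real"
  assumes "U \<in> sets lebesgue"
  shows "(LINT x|lebesgue_on U. f x) = (LINT x|lebesgue. indicator U x * f x)"
  using assms by (simp add: integral_restrict_space)

lemma integrable_indicator_iff:
  fixes f :: "'a::euclidean_space \<Rightarrow> real"
  assumes "U \<in> sets lebesgue"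
  shows "integrable (lebesgue_on U) f \<longleftrightarrow> integrable lebesgue (\<lambda>x. indicator U x * f x)"
  using assms by (simp add: integrable_restrict_space)

lemma measurable_indicator_iff:
  fixes f :: "'a::euclidean_space \<Rightarrow> real"
  assumes "U \<in> sets lebesgue"
  shows "f \<in> borel_measurable (lebesgue_on U) \<longleftrightarrow> (\<lambda>x. indicator U x * f x) \<in> borel_measurable lebesgue"
  using assms by (simp add: borel_measurable_restrict_space_iff)

lemma AE_lebesgue_on_iff:
  assumes "U \<in> sets lebesgue"
  shows "(AE x in lebesgue_on U. Q x) \<longleftrightarrow> (AE x in lebesgue. x \<in> U \<longrightarrow> Q x)"
  using assms by (simp add: AE_restrict_space_iff)

lemma lint_supported:
  fixes f :: "'a::euclidean_space \<Rightarrow> real"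
  assumes "U \<in> sets lebesgue" "\<And>x. x \<notin> U \<Longrightarrow> f x = 0"
  shows "(LINT x|lebesgue_on U. f x) = (LINT x|lebesgue. f x)"
proof -
  have "(\<lambda>x. indicator U x * f x) = f" using assms(2) by (intro ext) (auto simp: indicator_def)
  then show ?thesis using lint_indicator[OF assms(1), of f] by simp
qed

lemma lint_subset:
  fixes f :: "'a::euclidean_space \<Rightarrow> real"
  assumes "U \<in> sets lebesgue" "V \<in> sets lebesgue" "V \<subseteq> U" "\<And>x. x \<in> U - V \<Longrightarrow> f x = 0"
  shows "(LINT x|lebesgue_on V. f x) = (LINT x|lebesgue_on U. f x)"
proof -
  have "(\<lambda>x. indicator U x * f x) = (\<lambda>x. indicator V x * f x)" using assms(3,4) by (intro ext) (auto simp: indicator_def)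
  then show ?thesis using assms lint_indicator[of U f] lint_indicator[of V f] by simp
qed

lemma integrable_subset:
  fixes f :: "'a::euclidean_space \<Rightarrow> real"
  assumes "integrable (lebesgue_on U) f" "U \<in> sets lebesgue" "V \<in> sets lebesgue" "V \<subseteq> U"
  shows "integrable (lebesgue_on V) f"
proof -
  have "integrable lebesgue (\<lambda>x. indicator V x *\<^sub>R (indicator U x * f x))"
    using assms by (intro integrable_mult_indicator) (auto simp: integrable_indicator_iff)
  also have "(\<lambda>x. indicator V x *\<^sub>R (indicator U x * f x)) = (\<lambda>x. indicator V x * f x)"
    using assms(4) by (intro ext) (auto simp: indicator_def)
  finally show ?thesis using assms by (simp add: integrable_indicator_iff)
qed

lemma measurable_subset_lebesgue_on:
  assumes "f \<in> borel_measurable (lebesgue_on U)" "V \<subseteq> U"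
  shows "f \<in> borel_measurable (lebesgue_on V)"
  using assms by (rule measurable_restrict_mono)

lemma L2_measurable: "f \<in> L2 U \<Longrightarrow> f \<in> borel_measurable (lebesgue_on U)"
  and L2_integrable: "f \<in> L2 U \<Longrightarrow> integrable (lebesgue_on U) (\<lambda>x. (f x)\<^sup>2)"
  by (simp_all add: L2_def)

lemma L2_subset:
  assumes "f \<in> L2 U" "U \<in> sets lebesgue" "V \<in> sets lebesgue" "V \<subseteq> U"
  shows "f \<in> L2 V"
  unfolding L2_def mem_Collect_eq
proof
  show "f \<in> borel_measurable (lebesgue_on V)"
    by (rule measurable_subset_lebesgue_on[OF L2_measurable[OF assms(1)] assms(4)])
  show "integrable (lebesgue_on V) (\<lambda>x. (f x)\<^sup>2)"
    by (rule integrable_subset[OF L2_integrable[OF assms(1)] assms(2,3,4)])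
qed

lemma L2_cong: "(\<And>x. x \<in> U \<Longrightarrow> f x = g x) \<Longrightarrow> f \<in> L2 U \<longleftrightarrow> g \<in> L2 U"
  unfolding L2_def
  by (auto cong: measurable_cong_simp integrable_cong simp: space_restrict_space
      intro!: arg_cong2[where f="(\<and>)"] measurable_cong Bochner_Integration.integrable_cong)

lemma abs_mult_le_squares: "\<bar>a * b\<bar> \<le> a\<^sup>2 + (b::real)\<^sup>2"
proof -
  have "2 * (\<bar>a\<bar> * \<bar>b\<bar>) \<le> a\<^sup>2 + b\<^sup>2" using sum_squares_bound[of "\<bar>a\<bar>" "\<bar>b\<bar>"] by simp
  moreover have "0 \<le> \<bar>a\<bar> * \<bar>b\<bar>" by simp
  ultimately show ?thesis unfolding abs_mult by linarith
qed

lemma L2_mult_integrable: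
  assumes "f \<in> L2 U" "g \<in> L2 U"
  shows "integrable (lebesgue_on U) (\<lambda>x. f x * g x)"
proof (rule Bochner_Integration.integrable_bound)
  show "integrable (lebesgue_on U) (\<lambda>x. (f x)\<^sup>2 + (g x)\<^sup>2)" using assms by (simp add: L2_integrable)
  show "(\<lambda>x. f x * g x) \<in> borel_measurable (lebesgue_on U)"
    using assms by (intro borel_measurable_times L2_measurable)
  show "AE x in lebesgue_on U. norm (f x * g x) \<le> norm ((f x)\<^sup>2 + (g x)\<^sup>2)"
    using abs_mult_le_squares by (intro always_eventually) (auto intro: order_trans)
qed

lemma L2_cmult: "f \<in> L2 U \<Longrightarrow> (\<lambda>x. c * f x) \<in> L2 U"
  by (auto simp: L2_def power_mult_distrib)

lemma L2_add:
  assumes "f \<in> L2 U" "g \<in> L2 U"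
  shows "(\<lambda>x. f x + g x) \<in> L2 U"
  using assms L2_mult_integrable[OF assms]
  by (auto simp: L2_def power2_sum mult.assoc)

lemma L2_diff: "f \<in> L2 U \<Longrightarrow> g \<in> L2 U \<Longrightarrow> (\<lambda>x. f x - g x) \<in> L2 U"
  using L2_add[OF _ L2_cmult[of g U "-1"]] by simp

lemma L2_mult_bounded:
  assumes "f \<in> L2 U" "g \<in> borel_measurable borel" "\<And>x. \<bar>g x\<bar> \<le> M"
  shows "(\<lambda>x. f x * g x) \<in> L2 U"
proof -
  have g: "g \<in> borel_measurable (lebesgue_on U)"
    using assms(2) by (simp add: measurable_completion measurable_restrict_space1)
  have le: "(f x * g x)\<^sup>2 \<le> M\<^sup>2 * (f x)\<^sup>2" for x
  proof -
    have "(g x)\<^sup>2 \<le> M\<^sup>2" using power_mono[OF assms(3)[of x], of 2] by simp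
    then show ?thesis by (simp add: power_mult_distrib mult.commute[of "M\<^sup>2"] mult_left_mono)
  qed
  have "integrable (lebesgue_on U) (\<lambda>x. (f x * g x)\<^sup>2)"
  proof (rule Bochner_Integration.integrable_bound)
    show "integrable (lebesgue_on U) (\<lambda>x. M\<^sup>2 * (f x)\<^sup>2)" using L2_integrable[OF assms(1)] by simp
    show "(\<lambda>x. (f x * g x)\<^sup>2) \<in> borel_measurable (lebesgue_on U)"
      using g L2_measurable[OF assms(1)] by measurable
  qed (use le in auto)
  then show ?thesis
    using g L2_measurable[OF assms(1)] by (auto simp: L2_def)
qed

text \<open>A substitute for the Cauchy-Schwarz inequality: \<open>\<bar>f\<bar> \<le> \<tau> f\<^sup>2 + 1 / \<tau>\<close> pointwise. It shows that the
  integral of a square-integrable function over a set is small together with the measure of the set.\<close>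

lemma lint_abs_le_square:
  fixes f :: "'a \<Rightarrow> real"
  assumes "integrable M f" "integrable M (\<lambda>x. (f x)\<^sup>2)" "A \<in> sets M" "emeasure M A < \<infinity>" "\<tau> > 0"
  shows "\<bar>LINT x|M. indicator A x * f x\<bar> \<le> \<tau> * (LINT x|M. (f x)\<^sup>2) + measure M A / \<tau>"
proof -
  have "\<bar>LINT x|M. indicator A x * f x\<bar> \<le> (LINT x|M. \<bar>indicator A x * f x\<bar>)"
    by (rule integral_abs_bound)
  also have "\<dots> \<le> (LINT x|M. \<tau> * (f x)\<^sup>2 + indicator A x / \<tau>)"
  proof (rule integral_mono)
    have "integrable M (\<lambda>x. indicator A x *\<^sub>R f x)" using assms by (intro integrable_mult_indicator) auto
    then show "integrable M (\<lambda>x. \<bar>indicator A x * f x\<bar>)" by simp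
    show "integrable M (\<lambda>x. \<tau> * (f x)\<^sup>2 + indicator A x / \<tau>)"
      using assms by (simp add: less_top)
    fix x
    have "0 \<le> (2 * \<tau> * \<bar>f x\<bar> - 1)\<^sup>2" by simp
    then have "4 * \<tau> * \<bar>f x\<bar> \<le> 4 * \<tau>\<^sup>2 * (f x)\<^sup>2 + 1" by (simp add: power2_eq_square algebra_simps)
    then have "4 * (\<tau> * \<bar>f x\<bar>) \<le> 4 * (\<tau> * (\<tau> * (f x)\<^sup>2 + 1 / \<tau>))"
      using assms(5) by (simp add: power2_eq_square algebra_simps)
    then have "\<bar>f x\<bar> \<le> \<tau> * (f x)\<^sup>2 + 1 / \<tau>" using assms(5) by simp
    then show "\<bar>indicator A x * f x\<bar> \<le> \<tau> * (f x)\<^sup>2 + indicator A x / \<tau>"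
      using assms(5) by (auto simp: indicator_def)
  qed
  also have "\<dots> = \<tau> * (LINT x|M. (f x)\<^sup>2) + measure M A / \<tau>"
    using assms by (subst Bochner_Integration.integral_add) (auto simp: less_top)
  finally show ?thesis .
qed

lemma smooth_L2:
  assumes "smooth f" "bounded U" "U \<in> sets lebesgue"
  shows "f \<in> L2 U"
proof -
  obtain a where a: "U \<subseteq> cbox (- a) a" using bounded_subset_cbox_symmetric assms(2) by blast
  have "set_integrable lebesgue (cbox (-a) a) (\<lambda>x. (f x)\<^sup>2)"
    by (intro absolutely_integrable_continuous continuous_intros smooth_continuous assms)
  then have "integrable (lebesgue_on (cbox (-a) a)) (\<lambda>x. (f x)\<^sup>2)"
    by (simp add: set_integrable_def integrable_indicator_iff)
  then have "integrable (lebesgue_on U) (\<lambda>x. (f x)\<^sup>2)"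
    using a assms(3) by (auto intro: integrable_subset)
  moreover have "f \<in> borel_measurable (lebesgue_on U)"
    using smooth_measurable[OF assms(1)] by (simp add: measurable_completion measurable_restrict_space1)
  ultimately show ?thesis by (simp add: L2_def)
qed

lemma test_function_integrable:
  assumes "test_function U \<eta>"
  shows "integrable lebesgue \<eta>"
proof -
  obtain K where K: "compact K" "\<And>x. x \<notin> K \<Longrightarrow> \<eta> x = 0" using test_functionE assms by metis
  obtain a where a: "K \<subseteq> cbox (- a) a" using bounded_subset_cbox_symmetric compact_imp_bounded K(1) by blast
  have "set_integrable lebesgue (cbox (-a) a) \<eta>"
    using test_function_smooth[OF assms] by (intro absolutely_integrable_continuous smooth_continuous)
  moreover have "(\<lambda>x. indicator (cbox (-a) a) x *\<^sub>R \<eta> x) = \<eta>"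
    using a K(2) by (intro ext) (auto simp: indicator_def)
  ultimately show ?thesis by (simp add: set_integrable_def)
qed

lemma test_function_L2:
  assumes "test_function V \<eta>" "U \<in> sets lebesgue"
  shows "\<eta> \<in> L2 U"
proof -
  have "integrable lebesgue (\<lambda>x. \<eta> x * \<eta> x)"
    using test_function_mult[OF assms(1) test_function_smooth[OF assms(1)]] test_function_integrable by blast
  then have "integrable lebesgue (\<lambda>x. indicator U x *\<^sub>R (\<eta> x)\<^sup>2)"
    using assms(2) by (intro integrable_mult_indicator) (auto simp: power2_eq_square)
  moreover have "\<eta> \<in> borel_measurable (lebesgue_on U)"
    using smooth_measurable[OF test_function_smooth[OF assms(1)]]
    by (simp add: measurable_completion measurable_restrict_space1)
  ultimately show ?thesis using assms by (simp add: L2_def integrable_indicator_iff)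
qed

lemma open_lebesgue: "open U \<Longrightarrow> U \<in> sets lebesgue"
  by (simp add: borel_open)

section \<open>The fundamental lemma of the calculus of variations\<close>

text \<open>Boxes form an intersection-stable generator of the Borel sets, so all Borel integrals of \<open>F\<close>
  vanish, among them those over the sets where \<open>F\<close> is positive or negative.\<close>

lemma AE_zero_if_box_integrals_zero:
  fixes F :: "'a::euclidean_space \<Rightarrow> real"
  assumes F: "integrable lebesgue F"
    and univ: "(LINT x|lebesgue. F x) = 0"
    and box: "\<And>a b. (LINT x|lebesgue. indicator (box a b) x * F x) = 0"
  shows "AE x in lebesgue. F x = 0"
proof -
  have Fm: "F \<in> borel_measurable lebesgue" using F by simp
  obtain F' where F': "F' \<in> borel_measurable lborel" "AE x in lborel. F x = F' x"
    using completion_ex_borel_measurable_real[OF Fm] by blast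
  have F'm: "F' \<in> borel_measurable lebesgue" using F'(1) by (simp add: measurable_completion)
  have ae: "AE x in lebesgue. F x = F' x" by (rule AE_completion[OF F'(2)])
  have F'i: "integrable lebesgue F'" using integrable_cong_AE[OF Fm F'm ae] F by simp
  have eq: "(LINT x|lebesgue. indicator A x * F' x) = (LINT x|lebesgue. indicator A x * F x)"
    if "A \<in> sets lebesgue" for A
    by (rule integral_cong_AE) (use Fm F'm that ae in auto)
  have zero: "(LINT x|lebesgue. indicator A x * F' x) = 0" if "A \<in> sets borel" for A
  proof -
    have Int_stable: "Int_stable (range (\<lambda>(a, b). box a b :: 'a set))"
      by (auto simp: Int_stable_def box_Int_box)
    have gen: "range (\<lambda>(a, b). box a b :: 'a set) \<subseteq> Pow UNIV" by simp
    have "A \<in> sigma_sets UNIV (range (\<lambda>(a, b). box a b))"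
      using that by (simp add: borel_eq_box)
    from Int_stable gen this show ?thesis
    proof (induction rule: sigma_sets_induct_disjoint)
      case (basic A)
      then show ?case using box eq by (auto simp: borel_open)
    next
      case empty
      then show ?case by simp
    next
      case (compl A)
      have A: "A \<in> sets borel" using compl(1) by (simp add: borel_eq_box)
      have "(\<lambda>x. indicator (UNIV - A) x * F' x) = (\<lambda>x. F' x - indicator A x *\<^sub>R F' x)"
        by (auto simp: indicator_def)
      moreover have "integrable lebesgue (\<lambda>x. indicator A x *\<^sub>R F' x)"
        using A F'i by (intro integrable_mult_indicator) auto
      ultimately show ?case
        using F'i compl(2) eq[of UNIV] univ by simp
    next
      case (union A)
      have A: "A i \<in> sets borel" for i using union(2) by (auto simp: borel_eq_box)
      have "set_integrable lebesgue (\<Union>i. A i) F'"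
        unfolding set_integrable_def using A F'i by (intro integrable_mult_indicator) auto
      then have "(LINT x:(\<Union>i. A i)|lebesgue. F' x) = (\<Sum>i. LINT x:A i|lebesgue. F' x)"
        using union(1) A by (intro lebesgue_integral_countable_add) (auto simp: disjoint_family_on_def)
      then show ?case using union(3) by (simp add: set_lebesgue_integral_def)
    qed
  qed
  have nonpos: "AE x in lebesgue. G x \<le> 0"
    if G: "G \<in> borel_measurable lborel" "integrable lebesgue G"
      and z: "\<And>A. A \<in> sets borel \<Longrightarrow> (LINT x|lebesgue. indicator A x * G x) = 0" for G :: "'a \<Rightarrow> real"
  proof -
    let ?A = "{x. G x > 0}"
    have A: "?A \<in> sets borel" using G(1) by measurable
    have "integrable lebesgue (\<lambda>x. indicator ?A x *\<^sub>R G x)"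
      using A G(2) by (intro integrable_mult_indicator) auto
    then have "AE x in lebesgue. indicator ?A x * G x = 0"
      using z[OF A] by (intro integral_nonneg_eq_0_iff_AE[THEN iffD1]) (auto simp: indicator_def)
    then show ?thesis by eventually_elim (auto simp: indicator_def split: if_splits)
  qed
  have "AE x in lebesgue. F' x \<le> 0" using F'(1) F'i zero by (rule nonpos)
  moreover have "AE x in lebesgue. - F' x \<le> 0"
    using F'(1) F'i zero by (intro nonpos) auto
  ultimately show ?thesis using ae by eventually_elim simp
qed

text \<open>If \<open>\<theta>\<close> is a smooth function that is positive exactly on the box, then the test functions
  \<open>1 - exp (- k \<theta>)\<close> increase to the indicator of the box.\<close>

lemma box_integral_zero:
  assumes f: "f \<in> L2 U" and U: "open U" and sub: "cbox a c \<subseteq> U"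
    and zero: "\<And>\<phi>. test_function U \<phi> \<Longrightarrow> (LINT x|lebesgue_on U. f x * \<phi> x) = 0"
  shows "(LINT x|lebesgue_on U. f x * indicator (box a c) x) = 0"
proof -
  define \<phi> where "\<phi> k x = 1 - exp (- (real k * box_bump a c x))" for k x
  have "smooth (\<lambda>x. exp ((- real k) * box_bump a c x))" for k
    by (intro smooth_compose[OF smooth_exp] smooth_mult smooth_const smooth_box_bump)
  then have smooth_exp_bump: "smooth (\<lambda>x. exp (- (real k * box_bump a c x)))" for k by simp
  have test: "test_function U (\<phi> k)" for k
    unfolding \<phi>_def
    by (rule test_functionI[of _ "cbox a c"])
      (use sub box_subset_cbox[of a c] in \<open>auto simp: box_bump_eq_0_iff
        intro!: smooth_diff smooth_const smooth_exp_bump\<close>)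
  have lim: "(\<lambda>k. \<phi> k x) \<longlonglongrightarrow> indicator (box a c) x" for x
  proof (cases "x \<in> box a c")
    case True
    then have "box_bump a c x > 0" by (simp add: box_bump_pos_iff)
    then have "exp (- box_bump a c x) < 1" by simp
    then have "(\<lambda>k. 1 - exp (- box_bump a c x) ^ k) \<longlonglongrightarrow> 1 - 0"
      by (intro tendsto_intros LIMSEQ_power_zero) simp
    then show ?thesis using True by (simp add: \<phi>_def exp_of_nat_mult[symmetric])
  next
    case False
    then have "box_bump a c x = 0" by (simp add: box_bump_eq_0_iff)
    then show ?thesis using False by (simp add: \<phi>_def)
  qed
  have bnd: "\<bar>\<phi> k x\<bar> \<le> indicator (box a c) x" for k x
    using box_bump_nonneg[of a c x] box_bump_eq_0_iff[of a c x]
    by (cases "x \<in> box a c") (auto simp: \<phi>_def)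
  have fm: "f \<in> borel_measurable (lebesgue_on U)" by (rule L2_measurable[OF f])
  have boxm: "box a c \<inter> space (lebesgue_on U) \<in> sets (lebesgue_on U)"
    by (auto simp: space_restrict_space sets_restrict_space)
  have indm: "(indicator (box a c) :: _ \<Rightarrow> real) \<in> borel_measurable (lebesgue_on U)"
    by (rule borel_measurable_indicator') (use boxm in \<open>auto simp: vimage_def Int_def conj_commute\<close>)
  have "emeasure lebesgue (box a c \<inter> U) < \<infinity>"
    by (rule order_le_less_trans[OF emeasure_mono[of _ "box a c"]]) (auto simp: emeasure_lborel_box_eq)
  then have int_ind: "integrable lebesgue (\<lambda>x. indicator (box a c \<inter> U) x :: real)"
    using U by (intro integrable_real_indicator) (auto simp: open_lebesgue)
  have "indicator (box a c) \<in> L2 U"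
  proof -
    have "(\<lambda>x. indicator U x * (indicator (box a c) x)\<^sup>2) = (\<lambda>x. indicator (box a c \<inter> U) x :: real)"
      by (auto simp: indicator_def)
    then show ?thesis using int_ind indm U by (simp add: L2_def integrable_indicator_iff open_lebesgue)
  qed
  then have dom: "integrable (lebesgue_on U) (\<lambda>x. f x * indicator (box a c) x)"
    by (rule L2_mult_integrable[OF f])
  have "(\<lambda>k. LINT x|lebesgue_on U. f x * \<phi> k x) \<longlonglongrightarrow> (LINT x|lebesgue_on U. f x * indicator (box a c) x)"
  proof (rule integral_dominated_convergence[where w="\<lambda>x. \<bar>f x * indicator (box a c) x\<bar>"])
    show "(\<lambda>x. f x * indicator (box a c) x) \<in> borel_measurable (lebesgue_on U)"
      using fm indm by measurable
    show "(\<lambda>x. f x * \<phi> k x) \<in> borel_measurable (lebesgue_on U)" for k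
      using L2_measurable[OF test_function_L2[OF test open_lebesgue[OF U]]] fm by measurable
    show "AE x in lebesgue_on U. (\<lambda>k. f x * \<phi> k x) \<longlonglongrightarrow> f x * indicator (box a c) x"
      by (intro always_eventually allI tendsto_intros lim)
    show "AE x in lebesgue_on U. norm (f x * \<phi> k x) \<le> \<bar>f x * indicator (box a c) x\<bar>" for k
      using bnd[of k] by (intro always_eventually allI) (auto simp: abs_mult intro!: mult_left_mono)
  qed (use dom in auto)
  then show ?thesis using zero[OF test] LIMSEQ_unique by (simp add: LIMSEQ_const_iff)
qed

lemma fundamental_lemma:
  assumes f: "f \<in> L2 U" and U: "open U"
    and zero: "\<And>\<phi>. test_function U \<phi> \<Longrightarrow> (LINT x|lebesgue_on U. f x * \<phi> x) = 0"
  shows "AE x in lebesgue_on U. f x = 0"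
proof -
  have local: "AE x in lebesgue. x \<in> cbox p q \<longrightarrow> f x = 0" if sub: "cbox p q \<subseteq> U" for p q
  proof -
    define F where "F x = indicator (box p q) x * f x" for x
    have Um: "U \<in> sets lebesgue" by (rule open_lebesgue[OF U])
    have fbox: "(\<lambda>x. indicator U x * (f x * indicator (box a c) x)) = (\<lambda>x. indicator (box a c) x * f x)"
      if "box a c \<subseteq> U" for a c
      using that by (intro ext) (auto simp: indicator_def)
    have sub': "box p q \<subseteq> U" using sub box_subset_cbox by blast
    have Fi: "integrable lebesgue F"
    proof -
      have "f \<in> L2 (box p q)" using L2_subset[OF f Um _ sub'] by simp
      moreover have "(\<lambda>x. 1) \<in> L2 (box p q)"
        by (intro smooth_L2 smooth_const bounded_box) simp
      ultimately have "integrable (lebesgue_on (box p q)) (\<lambda>x. f x * 1)" by (rule L2_mult_integrable)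
      then show ?thesis unfolding F_def by (simp add: integrable_indicator_iff)
    qed
    have Fz: "(LINT x|lebesgue. indicator (box a c) x * f x) = 0" if "cbox a c \<subseteq> U" for a c
    proof -
      have "box a c \<subseteq> U" using that box_subset_cbox by blast
      from fbox[OF this] show ?thesis
        using box_integral_zero[OF f U that zero] lint_indicator[OF Um, of "\<lambda>x. f x * indicator (box a c) x"]
        by simp
    qed
    have "AE x in lebesgue. F x = 0"
    proof (rule AE_zero_if_box_integrals_zero[OF Fi])
      show "(LINT x|lebesgue. F x) = 0" unfolding F_def by (rule Fz[OF sub])
      fix a b :: 'a
      obtain c d where cd: "box a b \<inter> box p q = box c d" "cbox c d \<subseteq> U"
      proof (cases "box a b \<inter> box p q = {}")
        case True
        show ?thesis
        proof (rule that[of "One" "0"])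
          obtain i :: 'a where i: "i \<in> Basis" using nonempty_Basis by blast
          then have "box One (0::'a) = {}" "cbox One (0::'a) = {}"
            unfolding box_eq_empty by (auto intro!: bexI[OF _ i])
          then show "box a b \<inter> box p q = box One 0" "cbox One 0 \<subseteq> U" using True by auto
        qed
      next
        case False
        obtain c d where cd: "box a b \<inter> box p q = box c d" using box_Int_box by blast
        then have "cbox c d = closure (box c d)" using False closure_box[of c d] by simp
        also have "\<dots> \<subseteq> cbox p q"
          using cd box_subset_cbox[of p q] by (intro closure_minimal) auto
        finally show ?thesis using cd sub that by blast
      qed
      have "(\<lambda>x. indicator (box a b) x * F x) = (\<lambda>x. indicator (box c d) x * f x)"
        using cd(1) by (intro ext) (auto simp: F_def indicator_def set_eq_iff)
      then show "(LINT x|lebesgue. indicator (box a b) x * F x) = 0" using Fz[OF cd(2)] by simp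
    qed
    moreover have "AE x in lebesgue. x \<notin> cbox p q - box p q"
      using negligible_frontier_interval[of p q]
      by (intro AE_not_in) (simp add: negligible_iff_null_sets)
    ultimately show ?thesis by eventually_elim (auto simp: F_def)
  qed
  obtain \<D> where D: "countable \<D>" "\<D> \<subseteq> Pow U" "\<And>X. X \<in> \<D> \<Longrightarrow> \<exists>a b. X = cbox a b" "\<Union>\<D> = U"
    using open_countable_Union_open_cbox[OF U] by metis
  have "AE x in lebesgue. x \<in> X \<longrightarrow> f x = 0" if "X \<in> \<D>" for X
    using D(2) D(3)[OF that] local that by blast
  then have "AE x in lebesgue. \<forall>X\<in>\<D>. x \<in> X \<longrightarrow> f x = 0"
    by (subst AE_ball_countable[OF D(1)]) blast
  then have "AE x in lebesgue. x \<in> U \<longrightarrow> f x = 0"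
    by eventually_elim (use D(4) in auto)
  then show ?thesis by (simp add: AE_lebesgue_on_iff open_lebesgue[OF U])
qed

section \<open>Integration by parts\<close>

lemma smooth_line_derivative:
  assumes "smooth w"
  shows "((\<lambda>t. w (x + t *\<^sub>R b)) has_real_derivative dir_deriv w b (x + t *\<^sub>R b)) (at t)"
proof -
  let ?y = "x + t *\<^sub>R b"
  have w: "(w has_derivative (\<lambda>h. dir_deriv w h ?y)) (at ?y)" by (rule smooth_has_derivative[OF assms])
  have lin: "dir_deriv w (h *\<^sub>R b) ?y = dir_deriv w b ?y * h" for h
    using linear_cmul[OF has_derivative_linear[OF w], of h b] by simp
  have line: "((\<lambda>t. x + t *\<^sub>R b) has_derivative (\<lambda>h. h *\<^sub>R b)) (at t)"
    by (auto intro!: derivative_eq_intros)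
  show ?thesis
    unfolding has_field_derivative_def using has_derivative_compose[OF line w] by (simp only: lin)
qed

text \<open>By the mean value theorem the difference quotients of a test function are bounded by a multiple
  of the indicator of one ball.\<close>

lemma difference_quotient_tendsto:
  assumes w: "test_function UNIV w" and b: "b \<in> Basis" and A: "A \<in> sets borel"
  shows "(\<lambda>k. real (Suc k) * (LINT x|lborel. indicator A x * (w (x + inverse (real (Suc k)) *\<^sub>R b) - w x)))
    \<longlonglongrightarrow> (LINT x|lborel. indicator A x * dir_deriv w b x)"
proof -
  let ?s = "\<lambda>k. inverse (real (Suc k))"
  let ?d = "\<lambda>k x. real (Suc k) * (w (x + ?s k *\<^sub>R b) - w x)"
  have sw: "smooth w" by (rule test_function_smooth[OF w])
  have wm: "w \<in> borel_measurable borel" by (rule smooth_measurable[OF sw])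
  have dm: "dir_deriv w b \<in> borel_measurable borel" by (rule smooth_measurable[OF smooth_dir_deriv[OF sw b]])
  obtain K where K: "compact K" "\<And>x. x \<notin> K \<Longrightarrow> w x = 0" using test_functionE w by metis
  obtain R where R: "\<And>x. x \<in> K \<Longrightarrow> norm x \<le> R" using compact_imp_bounded[OF K(1)] by (auto simp: bounded_iff)
  obtain M where M: "\<And>x. \<bar>dir_deriv w b x\<bar> \<le> M" "M > 0"
    using test_function_bounded[OF test_function_dir_deriv[OF w b]] by metis
  have s0: "?s \<longlonglongrightarrow> 0" by (rule LIMSEQ_inverse_real_of_nat)
  have lim: "(\<lambda>k. ?d k x) \<longlonglongrightarrow> dir_deriv w b x" for x
  proof -
    have "((\<lambda>h. (w (x + (0 + h) *\<^sub>R b) - w (x + 0 *\<^sub>R b)) / h) \<longlongrightarrow> dir_deriv w b (x + 0 *\<^sub>R b)) (at 0)"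
      using smooth_line_derivative[OF sw, of x b 0] by (simp add: DERIV_def)
    moreover have "filterlim ?s (at 0) sequentially"
      using s0 by (auto simp: filterlim_at)
    ultimately have "(\<lambda>k. (w (x + (0 + ?s k) *\<^sub>R b) - w (x + 0 *\<^sub>R b)) / ?s k) \<longlonglongrightarrow> dir_deriv w b (x + 0 *\<^sub>R b)"
      by (rule filterlim_compose)
    then show ?thesis by (simp add: divide_inverse mult.commute)
  qed
  have bnd: "\<bar>?d k x\<bar> \<le> M * indicator (cball 0 (R + 1)) x" for k x
  proof (cases "x \<in> cball 0 (R + 1)")
    case True
    have "0 < ?s k" by simp
    then obtain z where "w (x + ?s k *\<^sub>R b) - w (x + 0 *\<^sub>R b) = (?s k - 0) * dir_deriv w b (x + z *\<^sub>R b)"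
      using MVT2[of 0 "?s k" "\<lambda>t. w (x + t *\<^sub>R b)" "\<lambda>t. dir_deriv w b (x + t *\<^sub>R b)"]
        smooth_line_derivative[OF sw] by blast
    then have "?d k x = dir_deriv w b (x + z *\<^sub>R b)"
      by (simp add: field_simps)
    then show ?thesis using True M(1) by simp
  next
    case False
    have "norm x \<le> norm (x + ?s k *\<^sub>R b) + norm (?s k *\<^sub>R b)"
      using norm_triangle_ineq4[of "x + ?s k *\<^sub>R b" "?s k *\<^sub>R b"] by simp
    moreover have "norm (?s k *\<^sub>R b) \<le> 1" using b by (simp add: inverse_le_1_iff)
    ultimately have "x \<notin> K" "x + ?s k *\<^sub>R b \<notin> K" using False R[of x] R[of "x + ?s k *\<^sub>R b"] by force+
    then show ?thesis using K(2) False by simp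
  qed
  have "(\<lambda>k. LINT x|lborel. indicator A x * ?d k x) \<longlonglongrightarrow> (LINT x|lborel. indicator A x * dir_deriv w b x)"
  proof (rule integral_dominated_convergence[where w="\<lambda>x. M * indicator (cball 0 (R + 1)) x"])
    show "(\<lambda>x. indicator A x * dir_deriv w b x) \<in> borel_measurable lborel" using A dm by measurable
    show "(\<lambda>x. indicator A x * ?d k x) \<in> borel_measurable lborel" for k using A wm by measurable
    show "integrable lborel (\<lambda>x. M * indicator (cball 0 (R + 1)) x)"
      by (intro integrable_mult_right integrable_real_indicator emeasure_bounded_finite bounded_cball) auto
    show "AE x in lborel. (\<lambda>k. indicator A x * ?d k x) \<longlonglongrightarrow> indicator A x * dir_deriv w b x"
      by (intro always_eventually allI tendsto_intros lim)
    show "AE x in lborel. norm (indicator A x * ?d k x) \<le> M * indicator (cball 0 (R + 1)) x" for k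
    proof (intro always_eventually allI)
      fix x
      have "norm (indicator A x * ?d k x) \<le> \<bar>?d k x\<bar>" by (simp add: indicator_def)
      then show "norm (indicator A x * ?d k x) \<le> M * indicator (cball 0 (R + 1)) x"
        using bnd[of k x] by linarith
    qed
  qed
  moreover have "(LINT x|lborel. indicator A x * ?d k x) =
      real (Suc k) * (LINT x|lborel. indicator A x * (w (x + ?s k *\<^sub>R b) - w x))" for k
    by (subst Bochner_Integration.integral_mult_right_zero[symmetric]) (simp only: mult.left_commute)
  ultimately show ?thesis by simp
qed

lemma lint_translate:
  fixes w :: "'a::euclidean_space \<Rightarrow> real"
  assumes "w \<in> borel_measurable borel"
  shows "(LINT x|lborel. w (x + c)) = (LINT x|lborel. w x)"
proof -
  have "(LINT x|lborel. w x) = (LINT x|distr lborel borel ((+) c). w x)" by (simp add: lborel_distr_plus)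
  also have "\<dots> = (LINT x|lborel. w (c + x))" using assms by (subst integral_distr) auto
  finally show ?thesis by (simp add: add.commute)
qed

lemma integrable_translate:
  fixes w :: "'a::euclidean_space \<Rightarrow> real"
  assumes "integrable lborel w"
  shows "integrable lborel (\<lambda>x. w (x + c))"
proof -
  have "integrable (distr lborel borel ((+) c)) w" using assms by (simp add: lborel_distr_plus)
  then have "integrable lborel (\<lambda>x. w (c + x))" by (rule integrable_distr[rotated]) simp
  then show ?thesis by (simp add: add.commute)
qed

lemma test_function_integrable_lborel:
  assumes "test_function U w"
  shows "integrable lborel w"
  using test_function_integrable[OF assms] smooth_measurable[OF test_function_smooth[OF assms]]
  by (simp add: integrable_completion)

text \<open>The integral of every difference quotient vanishes by translation invariance.\<close>

lemma integral_dir_deriv_test_function: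
  assumes w: "test_function U w" and b: "b \<in> Basis"
  shows "(LINT x|lebesgue. dir_deriv w b x) = 0"
proof -
  have w': "test_function UNIV w" by (rule test_function_mono[OF w]) simp
  have sw: "smooth w" by (rule test_function_smooth[OF w])
  have "(LINT x|lborel. w (x + c) - w x) = 0" for c
    using test_function_integrable_lborel[OF w] smooth_measurable[OF sw]
    by (simp add: lint_translate integrable_translate)
  then have "(LINT x|lborel. dir_deriv w b x) = 0"
    using difference_quotient_tendsto[OF w' b, of UNIV] by (simp add: LIMSEQ_const_iff)
  then show ?thesis
    using smooth_measurable[OF smooth_dir_deriv[OF sw b]] by (simp add: integral_completion)
qed

lemma integration_by_parts:
  assumes f: "smooth f" and \<eta>: "test_function U \<eta>" and b: "b \<in> Basis" and U: "open U"
  shows "(LINT x|lebesgue_on U. f x * dir_deriv \<eta> b x) = - (LINT x|lebesgue_on U. dir_deriv f b x * \<eta> x)"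
proof -
  have t1: "test_function U (\<lambda>x. f x * dir_deriv \<eta> b x)"
    by (intro test_function_mult test_function_dir_deriv \<eta> f b)
  have t2: "test_function U (\<lambda>x. dir_deriv f b x * \<eta> x)"
    by (intro test_function_mult smooth_dir_deriv \<eta> f b)
  have "0 = (LINT x|lebesgue. dir_deriv (\<lambda>x. f x * \<eta> x) b x)"
    using integral_dir_deriv_test_function[OF test_function_mult[OF \<eta> f] b] by simp
  also have "\<dots> = (LINT x|lebesgue. f x * dir_deriv \<eta> b x + dir_deriv f b x * \<eta> x)"
    using f test_function_smooth[OF \<eta>] by (simp add: dir_deriv_mult)
  also have "\<dots> = (LINT x|lebesgue. f x * dir_deriv \<eta> b x) + (LINT x|lebesgue. dir_deriv f b x * \<eta> x)"
    by (rule Bochner_Integration.integral_add[OF test_function_integrable[OF t1] test_function_integrable[OF t2]])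
  finally have "(LINT x|lebesgue. f x * dir_deriv \<eta> b x) = - (LINT x|lebesgue. dir_deriv f b x * \<eta> x)"
    by simp
  moreover have "(LINT x|lebesgue_on U. f x * dir_deriv \<eta> b x) = (LINT x|lebesgue. f x * dir_deriv \<eta> b x)"
    using test_function_zero[OF t1] by (intro lint_supported open_lebesgue U) auto
  moreover have "(LINT x|lebesgue_on U. dir_deriv f b x * \<eta> x) = (LINT x|lebesgue. dir_deriv f b x * \<eta> x)"
    using test_function_zero[OF t2] by (intro lint_supported open_lebesgue U) auto
  ultimately show ?thesis by simp
qed

section \<open>Weak gradients and the Sobolev norm\<close>

definition gradient :: "('a::euclidean_space \<Rightarrow> real) \<Rightarrow> 'a \<Rightarrow> 'a" where
  "gradient f x = (\<Sum>b\<in>Basis. dir_deriv f b x *\<^sub>R b)"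

lemma gradient_inner: "b \<in> Basis \<Longrightarrow> gradient f x \<bullet> b = dir_deriv f b x"
  by (simp add: gradient_def)

lemma has_weak_gradient_L2: "has_weak_gradient U f G \<Longrightarrow> f \<in> L2 U"
  and has_weak_gradient_component: "has_weak_gradient U f G \<Longrightarrow> b \<in> Basis \<Longrightarrow> (\<lambda>x. G x \<bullet> b) \<in> L2 U"
  and has_weak_gradient_eq: "has_weak_gradient U f G \<Longrightarrow> test_function U \<phi> \<Longrightarrow> b \<in> Basis \<Longrightarrow>
        (LINT x|lebesgue_on U. f x * dir_deriv \<phi> b x) = - (LINT x|lebesgue_on U. (G x \<bullet> b) * \<phi> x)"
  by (auto simp: has_weak_gradient_def)

lemma smooth_has_weak_gradient:
  assumes "smooth f" "open U" "bounded U"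
  shows "has_weak_gradient U f (gradient f)"
  unfolding has_weak_gradient_def
  using assms smooth_L2[OF smooth_dir_deriv[OF assms(1)] assms(3)]
  by (auto simp: gradient_inner intro: smooth_L2 open_lebesgue integration_by_parts)

lemma has_weak_gradient_diff:
  assumes f: "has_weak_gradient U f F" and g: "has_weak_gradient U g G" and U: "open U"
  shows "has_weak_gradient U (\<lambda>x. f x - g x) (\<lambda>x. F x - G x)"
  unfolding has_weak_gradient_def
proof (intro conjI ballI allI impI)
  show "(\<lambda>x. f x - g x) \<in> L2 U" by (intro L2_diff has_weak_gradient_L2[OF f] has_weak_gradient_L2[OF g])
  show "(\<lambda>x. (F x - G x) \<bullet> b) \<in> L2 U" if "b \<in> Basis" for b
    using L2_diff[OF has_weak_gradient_component[OF f that] has_weak_gradient_component[OF g that]]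
    by (simp add: inner_diff_left)
  fix \<phi> :: "'a \<Rightarrow> real" and b :: 'a
  assume t: "test_function U \<phi>" and b: "b \<in> Basis"
  have L: "\<phi> \<in> L2 U" "dir_deriv \<phi> b \<in> L2 U"
    using U t b by (auto intro: test_function_L2 test_function_dir_deriv open_lebesgue)
  have i: "integrable (lebesgue_on U) (\<lambda>x. f x * dir_deriv \<phi> b x)" "integrable (lebesgue_on U) (\<lambda>x. g x * dir_deriv \<phi> b x)"
    "integrable (lebesgue_on U) (\<lambda>x. (F x \<bullet> b) * \<phi> x)" "integrable (lebesgue_on U) (\<lambda>x. (G x \<bullet> b) * \<phi> x)"
    using L has_weak_gradient_L2[OF f] has_weak_gradient_L2[OF g]
      has_weak_gradient_component[OF f b] has_weak_gradient_component[OF g b]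
    by (auto intro: L2_mult_integrable)
  then show "(LINT x|lebesgue_on U. (f x - g x) * dir_deriv \<phi> b x) =
      - (LINT x|lebesgue_on U. ((F x - G x) \<bullet> b) * \<phi> x)"
    using has_weak_gradient_eq[OF f t b] has_weak_gradient_eq[OF g t b]
    by (simp add: left_diff_distrib inner_diff_left)
qed

lemma has_weak_gradient_subset:
  assumes f: "has_weak_gradient U f G" and "V \<subseteq> U" "open U" "open V"
  shows "has_weak_gradient V f G"
  unfolding has_weak_gradient_def
proof (intro conjI ballI allI impI)
  show "f \<in> L2 V" "\<And>b. b \<in> Basis \<Longrightarrow> (\<lambda>x. G x \<bullet> b) \<in> L2 V"
    using assms has_weak_gradient_L2[OF f] has_weak_gradient_component[OF f]
    by (auto intro: L2_subset open_lebesgue)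
  fix \<phi> :: "'a \<Rightarrow> real" and b :: 'a
  assume t: "test_function V \<phi>" and b: "b \<in> Basis"
  have "(LINT x|lebesgue_on V. f x * dir_deriv \<phi> b x) = (LINT x|lebesgue_on U. f x * dir_deriv \<phi> b x)"
    using assms test_function_zero[OF test_function_dir_deriv[OF t b]]
    by (intro lint_subset open_lebesgue) auto
  moreover have "(LINT x|lebesgue_on V. (G x \<bullet> b) * \<phi> x) = (LINT x|lebesgue_on U. (G x \<bullet> b) * \<phi> x)"
    using assms test_function_zero[OF t] by (intro lint_subset open_lebesgue) auto
  ultimately show "(LINT x|lebesgue_on V. f x * dir_deriv \<phi> b x) = - (LINT x|lebesgue_on V. (G x \<bullet> b) * \<phi> x)"
    using has_weak_gradient_eq[OF f test_function_mono[OF t assms(2)] b] by simp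
qed

lemma has_weak_gradient_cong:
  assumes "\<And>x. x \<in> U \<Longrightarrow> f x = g x"
  shows "has_weak_gradient U f = has_weak_gradient U g"
proof -
  have "f \<in> L2 U \<longleftrightarrow> g \<in> L2 U" using assms by (rule L2_cong)
  moreover have "(LINT x|lebesgue_on U. f x * h x) = (LINT x|lebesgue_on U. g x * h x)" for h
    using assms by (intro Bochner_Integration.integral_cong) (auto simp: space_restrict_space)
  ultimately show ?thesis by (simp add: has_weak_gradient_def fun_eq_iff)
qed

lemma H1_cong: "(\<And>x. x \<in> U \<Longrightarrow> f x = g x) \<Longrightarrow> f \<in> H1 U \<longleftrightarrow> g \<in> H1 U"
  using has_weak_gradient_cong[of U f g] by (simp add: H1_def)

lemma weak_gradient_cong: "(\<And>x. x \<in> U \<Longrightarrow> f x = g x) \<Longrightarrow> weak_gradient U f = weak_gradient U g"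
  using has_weak_gradient_cong[of U f g] by (simp add: weak_gradient_def)

lemma H1_norm_cong:
  assumes "\<And>x. x \<in> U \<Longrightarrow> f x = g x"
  shows "H1_norm U f = H1_norm U g"
proof -
  have "(LINT x|lebesgue_on U. (f x)\<^sup>2) = (LINT x|lebesgue_on U. (g x)\<^sup>2)"
    using assms by (intro Bochner_Integration.integral_cong) (auto simp: space_restrict_space)
  then show ?thesis using weak_gradient_cong[of U f g] assms by (simp add: H1_norm_def)
qed

lemma has_weak_gradient_unique:
  assumes F: "has_weak_gradient U f F" and G: "has_weak_gradient U f G" and U: "open U"
  shows "AE x in lebesgue_on U. F x = G x"
proof -
  have d: "has_weak_gradient U (\<lambda>x. f x - f x) (\<lambda>x. F x - G x)"
    by (rule has_weak_gradient_diff[OF F G U])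
  have "AE x in lebesgue_on U. (F x - G x) \<bullet> b = 0" if b: "b \<in> Basis" for b
  proof (rule fundamental_lemma[OF has_weak_gradient_component[OF d b] U])
    show "(LINT x|lebesgue_on U. (F x - G x) \<bullet> b * \<phi> x) = 0" if "test_function U \<phi>" for \<phi>
      using has_weak_gradient_eq[OF d that b] by simp
  qed
  then have "AE x in lebesgue_on U. \<forall>b\<in>Basis. (F x - G x) \<bullet> b = 0"
    by (intro AE_finite_allI) auto
  then show ?thesis
    by eventually_elim (auto simp: inner_diff_left intro: euclidean_eqI)
qed

lemma H1_has_weak_gradient: "f \<in> H1 U \<Longrightarrow> has_weak_gradient U f (weak_gradient U f)"
  using someI_ex[of "has_weak_gradient U f"] by (simp add: H1_def weak_gradient_def)

lemma has_weak_gradient_H1: "has_weak_gradient U f G \<Longrightarrow> f \<in> H1 U"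
  by (auto simp: H1_def)

lemma H1_L2: "f \<in> H1 U \<Longrightarrow> f \<in> L2 U"
  by (auto simp: H1_def dest: has_weak_gradient_L2)

lemma H1_diff: "f \<in> H1 U \<Longrightarrow> g \<in> H1 U \<Longrightarrow> open U \<Longrightarrow> (\<lambda>x. f x - g x) \<in> H1 U"
  by (rule has_weak_gradient_H1[OF has_weak_gradient_diff[OF H1_has_weak_gradient H1_has_weak_gradient]])

lemma H1_subset: "f \<in> H1 U \<Longrightarrow> V \<subseteq> U \<Longrightarrow> open U \<Longrightarrow> open V \<Longrightarrow> f \<in> H1 V"
  by (rule has_weak_gradient_H1[OF has_weak_gradient_subset[OF H1_has_weak_gradient]])

lemma H1_norm_nonneg: "H1_norm U f \<ge> 0"
  by (simp add: H1_norm_def)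

text \<open>The norm is defined with one chosen weak gradient. By uniqueness almost everywhere it can be
  computed with any other one, in particular with the restriction of a weak gradient on a larger set.\<close>

lemma H1_norm_square:
  fixes f :: "'a::euclidean_space \<Rightarrow> real"
  assumes G: "has_weak_gradient U f G" and U: "open U"
  shows "(H1_norm U f)\<^sup>2 = (LINT x|lebesgue_on U. (f x)\<^sup>2) + (\<Sum>b\<in>Basis. LINT x|lebesgue_on U. (G x \<bullet> b)\<^sup>2)"
proof -
  let ?W = "weak_gradient U f"
  have W: "has_weak_gradient U f ?W" using H1_has_weak_gradient has_weak_gradient_H1[OF G] .
  have norm2: "(norm y)\<^sup>2 = (\<Sum>b\<in>Basis. (y \<bullet> b)\<^sup>2)" for y :: 'a
    unfolding power2_norm_eq_inner by (subst euclidean_inner) (simp add: power2_eq_square)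
  have "(LINT x|lebesgue_on U. (norm (?W x))\<^sup>2) = (LINT x|lebesgue_on U. (\<Sum>b\<in>Basis. (?W x \<bullet> b)\<^sup>2))"
    by (simp only: norm2)
  also have "\<dots> = (\<Sum>b\<in>Basis. LINT x|lebesgue_on U. (?W x \<bullet> b)\<^sup>2)"
    using has_weak_gradient_component[OF W] by (intro Bochner_Integration.integral_sum) (auto intro: L2_integrable)
  also have "\<dots> = (\<Sum>b\<in>Basis. LINT x|lebesgue_on U. (G x \<bullet> b)\<^sup>2)"
  proof (rule sum.cong[OF refl])
    fix b :: 'a assume b: "b \<in> Basis"
    have "AE x in lebesgue_on U. (?W x \<bullet> b)\<^sup>2 = (G x \<bullet> b)\<^sup>2"
      using has_weak_gradient_unique[OF W G U] by eventually_elim simp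
    then show "(LINT x|lebesgue_on U. (?W x \<bullet> b)\<^sup>2) = (LINT x|lebesgue_on U. (G x \<bullet> b)\<^sup>2)"
      using L2_measurable[OF has_weak_gradient_component[OF W b]] L2_measurable[OF has_weak_gradient_component[OF G b]]
      by (intro integral_cong_AE) auto
  qed
  finally show ?thesis
    by (simp add: H1_norm_def sum_nonneg)
qed

lemma lint_square_mono:
  fixes f :: "'a::euclidean_space \<Rightarrow> real"
  assumes "f \<in> L2 U" "U \<in> sets lebesgue" "V \<in> sets lebesgue" "V \<subseteq> U"
  shows "(LINT x|lebesgue_on V. (f x)\<^sup>2) \<le> (LINT x|lebesgue_on U. (f x)\<^sup>2)"
  using assms L2_integrable[OF assms(1)] L2_integrable[OF L2_subset[OF assms]]
  by (auto simp: lint_indicator integrable_indicator_iff indicator_def intro!: integral_mono)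

lemma H1_norm_mono:
  assumes f: "f \<in> H1 U" and "V \<subseteq> U" "open U" "open V"
  shows "H1_norm V f \<le> H1_norm U f"
proof (rule power2_le_imp_le[OF _ H1_norm_nonneg])
  let ?G = "weak_gradient U f"
  have U: "has_weak_gradient U f ?G" by (rule H1_has_weak_gradient[OF f])
  have V: "has_weak_gradient V f ?G" by (rule has_weak_gradient_subset[OF U assms(2,3,4)])
  show "(H1_norm V f)\<^sup>2 \<le> (H1_norm U f)\<^sup>2"
    unfolding H1_norm_square[OF U assms(3)] H1_norm_square[OF V assms(4)]
    using assms has_weak_gradient_L2[OF U] has_weak_gradient_component[OF U]
    by (intro add_mono sum_mono lint_square_mono open_lebesgue) auto
qed

lemma L2_square_diff_le:
  fixes f g h :: "'a \<Rightarrow> real"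
  assumes "integrable M (\<lambda>x. (f x)\<^sup>2)" "integrable M (\<lambda>x. (g x)\<^sup>2)"
    "f \<in> borel_measurable M" "g \<in> borel_measurable M"
  shows "(LINT x|M. (f x + g x)\<^sup>2) \<le> 2 * (LINT x|M. (f x)\<^sup>2) + 2 * (LINT x|M. (g x)\<^sup>2)"
proof -
  have le: "(a + b)\<^sup>2 \<le> 2 * a\<^sup>2 + 2 * b\<^sup>2" for a b :: real
    using zero_le_power2[of "a - b"] by (simp add: power2_eq_square algebra_simps)
  have i: "integrable M (\<lambda>x. 2 * (f x)\<^sup>2 + 2 * (g x)\<^sup>2)" using assms by simp
  have "integrable M (\<lambda>x. (f x + g x)\<^sup>2)"
    by (rule Bochner_Integration.integrable_bound[OF i]) (use assms le in auto)
  then have "(LINT x|M. (f x + g x)\<^sup>2) \<le> (LINT x|M. 2 * (f x)\<^sup>2 + 2 * (g x)\<^sup>2)"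
    using i le by (intro integral_mono) auto
  then show ?thesis using assms by simp
qed

text \<open>The constant \<open>2\<close> comes from \<open>(a + b)\<^sup>2 \<le> 2 a\<^sup>2 + 2 b\<^sup>2\<close>, applied under the integral; only convergence
  to zero is deduced from this estimate.\<close>

lemma H1_norm_quasi_triangle:
  assumes f: "f \<in> H1 U" and g: "g \<in> H1 U" and h: "h \<in> H1 U" and U: "open U"
  shows "H1_norm U (\<lambda>x. f x - h x) \<le> 2 * (H1_norm U (\<lambda>x. f x - g x) + H1_norm U (\<lambda>x. g x - h x))"
proof (rule power2_le_imp_le)
  let ?F = "weak_gradient U f" let ?G = "weak_gradient U g" let ?H = "weak_gradient U h"
  note F = H1_has_weak_gradient[OF f] and G = H1_has_weak_gradient[OF g] and H = H1_has_weak_gradient[OF h]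
  note fg = has_weak_gradient_diff[OF F G U] and gh = has_weak_gradient_diff[OF G H U]
    and fh = has_weak_gradient_diff[OF F H U]
  have 1: "(LINT x|lebesgue_on U. (f x - h x)\<^sup>2) \<le>
      2 * (LINT x|lebesgue_on U. (f x - g x)\<^sup>2) + 2 * (LINT x|lebesgue_on U. (g x - h x)\<^sup>2)"
    using L2_square_diff_le[of "lebesgue_on U" "\<lambda>x. f x - g x" "\<lambda>x. g x - h x"]
      has_weak_gradient_L2[OF fg] has_weak_gradient_L2[OF gh]
    by (simp add: L2_def)
  have 2: "(LINT x|lebesgue_on U. ((?F x - ?H x) \<bullet> b)\<^sup>2) \<le>
      2 * (LINT x|lebesgue_on U. ((?F x - ?G x) \<bullet> b)\<^sup>2) + 2 * (LINT x|lebesgue_on U. ((?G x - ?H x) \<bullet> b)\<^sup>2)"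
    if b: "b \<in> Basis" for b
    using L2_square_diff_le[of "lebesgue_on U" "\<lambda>x. (?F x - ?G x) \<bullet> b" "\<lambda>x. (?G x - ?H x) \<bullet> b"]
      has_weak_gradient_component[OF fg b] has_weak_gradient_component[OF gh b]
    by (simp add: L2_def inner_add_left[symmetric])
  have 3: "(\<Sum>b\<in>Basis. LINT x|lebesgue_on U. ((?F x - ?H x) \<bullet> b)\<^sup>2) \<le>
      (\<Sum>b\<in>Basis. 2 * (LINT x|lebesgue_on U. ((?F x - ?G x) \<bullet> b)\<^sup>2) +
        2 * (LINT x|lebesgue_on U. ((?G x - ?H x) \<bullet> b)\<^sup>2))"
    by (rule sum_mono) (rule 2)
  let ?a = "H1_norm U (\<lambda>x. f x - g x)" let ?b = "H1_norm U (\<lambda>x. g x - h x)"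
  have "(H1_norm U (\<lambda>x. f x - h x))\<^sup>2 \<le> 2 * ?a\<^sup>2 + 2 * ?b\<^sup>2"
    unfolding H1_norm_square[OF fg U] H1_norm_square[OF gh U] H1_norm_square[OF fh U]
    using 1 3 by (simp add: sum.distrib sum_distrib_left[symmetric])
  also have "\<dots> \<le> (2 * (?a + ?b))\<^sup>2"
    using mult_nonneg_nonneg[OF H1_norm_nonneg H1_norm_nonneg, of U "\<lambda>x. f x - g x" U "\<lambda>x. g x - h x"]
    by (simp add: power2_eq_square algebra_simps)
  finally show "(H1_norm U (\<lambda>x. f x - h x))\<^sup>2 \<le> (2 * (?a + ?b))\<^sup>2" .
qed (simp add: H1_norm_nonneg)

section \<open>Hausdorff measure is a Borel measure\<close>

definition hausdorff_weight :: "real \<Rightarrow> 'a::metric_space set \<Rightarrow> ennreal" where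
  "hausdorff_weight s A = ennreal (unit_ball_vol s * (diameter A / 2) powr s)"

definition hausdorff_covers :: "real \<Rightarrow> 'a::metric_space set \<Rightarrow> (nat \<Rightarrow> 'a set) set" where
  "hausdorff_covers \<delta> A = {C. A \<subseteq> (\<Union>i. C i) \<and> (\<forall>i. bounded (C i) \<and> diameter (C i) \<le> \<delta>)}"

lemma hausdorff_pre_eq: "hausdorff_pre s \<delta> A = (INF C\<in>hausdorff_covers \<delta> A. \<Sum>i. hausdorff_weight s (C i))"
  by (simp add: hausdorff_pre_def hausdorff_weight_def hausdorff_covers_def)

lemma hausdorff_weight_empty [simp]: "hausdorff_weight s {} = 0"
  by (simp add: hausdorff_weight_def)

lemma hausdorff_weight_mono:
  assumes "A \<subseteq> B" "bounded B" "0 \<le> s"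
  shows "hausdorff_weight s A \<le> hausdorff_weight s B"
  unfolding hausdorff_weight_def
  using assms diameter_subset[OF assms(1,2)] diameter_ge_0[OF bounded_subset[OF assms(2,1)]]
  by (intro ennreal_leI mult_left_mono powr_mono2) (auto simp: unit_ball_vol_nonneg)

lemma hausdorff_pre_mono: "A \<subseteq> B \<Longrightarrow> hausdorff_pre s \<delta> A \<le> hausdorff_pre s \<delta> B"
  unfolding hausdorff_pre_eq by (intro INF_superset_mono) (auto simp: hausdorff_covers_def)

lemma hausdorff_pre_antimono: "\<delta> \<le> \<delta>' \<Longrightarrow> hausdorff_pre s \<delta>' A \<le> hausdorff_pre s \<delta> A"
  unfolding hausdorff_pre_eq by (intro INF_superset_mono) (auto simp: hausdorff_covers_def intro: order_trans)

lemma hausdorff_pre_le: "C \<in> hausdorff_covers \<delta> A \<Longrightarrow> hausdorff_pre s \<delta> A \<le> (\<Sum>i. hausdorff_weight s (C i))"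
  unfolding hausdorff_pre_eq by (rule INF_lower)

lemma hausdorff_pre_less:
  assumes "hausdorff_pre s \<delta> A < x"
  obtains C where "C \<in> hausdorff_covers \<delta> A" "(\<Sum>i. hausdorff_weight s (C i)) < x"
  using assms unfolding hausdorff_pre_eq INF_less_iff by auto

lemma hausdorff_pre_countably_subadditive:
  "hausdorff_pre s \<delta> (\<Union>i. A i) \<le> (\<Sum>i. hausdorff_pre s \<delta> (A i))"
proof (rule ennreal_le_epsilon)
  fix e :: real assume e: "0 < e" and fin: "(\<Sum>i. hausdorff_pre s \<delta> (A i)) < top"
  have "hausdorff_pre s \<delta> (A n) < hausdorff_pre s \<delta> (A n) + e * (1/2)^Suc n" for n
    using e fin by (auto simp add: less_top dest!: ennreal_suminf_lessD)
  then have "\<exists>B. B \<in> hausdorff_covers \<delta> (A n) \<and>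
      (\<Sum>i. hausdorff_weight s (B i)) \<le> hausdorff_pre s \<delta> (A n) + e * (1/2)^Suc n" for n
    by (metis hausdorff_pre_less less_imp_le)
  then obtain B where B: "\<And>n. B n \<in> hausdorff_covers \<delta> (A n)"
    "\<And>n. (\<Sum>i. hausdorff_weight s (B n i)) \<le> hausdorff_pre s \<delta> (A n) + e * (1/2)^Suc n"
    by metis
  define C where "C i = (case prod_decode i of (n, k) \<Rightarrow> B n k)" for i
  have "(\<Union>i. A i) \<subseteq> (\<Union>i. C i)"
  proof
    fix x assume "x \<in> (\<Union>i. A i)"
    then obtain n where "x \<in> A n" by auto
    then obtain k where "x \<in> B n k" using B(1)[of n] by (auto simp: hausdorff_covers_def)
    then have "x \<in> C (prod_encode (n, k))" by (simp add: C_def)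
    then show "x \<in> (\<Union>i. C i)" by blast
  qed
  then have "C \<in> hausdorff_covers \<delta> (\<Union>i. A i)"
    using B(1) by (auto simp: hausdorff_covers_def C_def split: prod.split)
  then have "hausdorff_pre s \<delta> (\<Union>i. A i) \<le> (\<Sum>i. hausdorff_weight s (C i))"
    by (rule hausdorff_pre_le)
  also have "\<dots> = (\<Sum>i. (\<lambda>(n, k). hausdorff_weight s (B n k)) (prod_decode i))"
    by (simp add: C_def split_def)
  also have "\<dots> = (\<Sum>n. \<Sum>i. hausdorff_weight s (B n i))"
    by (rule suminf_ennreal_2dimen) simp
  also have "\<dots> \<le> (\<Sum>n. hausdorff_pre s \<delta> (A n) + e * (1/2) ^ Suc n)"
    by (intro suminf_le B) auto
  also have "... = (\<Sum>n. hausdorff_pre s \<delta> (A n)) + (\<Sum>n. ennreal e * ennreal ((1/2) ^ Suc n))"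
    using e by (subst suminf_add[symmetric])
      (auto simp del: ennreal_suminf_cmult simp add: ennreal_mult[symmetric])
  also have "\<dots> = (\<Sum>n. hausdorff_pre s \<delta> (A n)) + e"
    unfolding ennreal_suminf_cmult
    by (subst suminf_ennreal_eq[OF zero_le_power power_half_series]) auto
  finally show "hausdorff_pre s \<delta> (\<Union>i. A i) \<le> (\<Sum>n. hausdorff_pre s \<delta> (A n)) + e" .
qed

lemma hausdorff_outer_mono: "A \<subseteq> B \<Longrightarrow> hausdorff_outer s A \<le> hausdorff_outer s B"
  unfolding hausdorff_outer_def by (intro SUP_mono) (auto intro: hausdorff_pre_mono)

lemma hausdorff_pre_le_outer: "0 < \<delta> \<Longrightarrow> hausdorff_pre s \<delta> A \<le> hausdorff_outer s A"
  unfolding hausdorff_outer_def by (intro SUP_upper) simp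

lemma hausdorff_outer_countably_subadditive:
  "hausdorff_outer s (\<Union>i. A i) \<le> (\<Sum>i. hausdorff_outer s (A i))"
  unfolding hausdorff_outer_def[of s "\<Union>i. A i"]
proof (rule SUP_least)
  fix \<delta> :: real assume "\<delta> \<in> {0<..}"
  then show "hausdorff_pre s \<delta> (\<Union>i. A i) \<le> (\<Sum>i. hausdorff_outer s (A i))"
    by (intro order_trans[OF hausdorff_pre_countably_subadditive] suminf_le hausdorff_pre_le_outer) auto
qed

lemma hausdorff_outer_empty [simp]: "hausdorff_outer s {} = 0"
proof -
  have "hausdorff_pre s \<delta> {} = 0" if "\<delta> > 0" for \<delta>
    using hausdorff_pre_le[of "\<lambda>_. {}" \<delta> "{}" s] that by (simp add: hausdorff_covers_def)
  then show ?thesis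
    unfolding hausdorff_outer_def by (intro antisym SUP_least) auto
qed

lemma hausdorff_outer_subadditive: "hausdorff_outer s (A \<union> B) \<le> hausdorff_outer s A + hausdorff_outer s B"
proof -
  define f where "f i = (if i = 0 then A else if i = 1 then B else {})" for i :: nat
  have "A \<union> B = (\<Union>i. f i)" by (auto simp: f_def split: if_splits)
  then have "hausdorff_outer s (A \<union> B) \<le> (\<Sum>i. hausdorff_outer s (f i))"
    using hausdorff_outer_countably_subadditive by simp
  also have "\<dots> = (\<Sum>i\<in>{0,1}. hausdorff_outer s (f i))"
    by (rule suminf_finite) (auto simp: f_def)
  finally show ?thesis by (simp add: f_def)
qed

text \<open>Sets at positive distance are not met by a common covering set of small diameter.\<close>

lemma hausdorff_outer_separated:
  assumes s: "0 \<le> s" and \<rho>: "\<rho> > 0" and sep: "\<And>x y. x \<in> A \<Longrightarrow> y \<in> B \<Longrightarrow> \<rho> \<le> dist x y"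
  shows "hausdorff_outer s A + hausdorff_outer s B \<le> hausdorff_outer s (A \<union> B)"
proof -
  have pre: "hausdorff_pre s \<delta> A + hausdorff_pre s \<delta> B \<le> hausdorff_pre s \<delta> (A \<union> B)" if \<delta>: "0 < \<delta>" "\<delta> < \<rho>" for \<delta>
    unfolding hausdorff_pre_eq[of s \<delta> "A \<union> B"]
  proof (rule INF_greatest)
    fix C assume C: "C \<in> hausdorff_covers \<delta> (A \<union> B)"
    then have bC: "\<And>i. bounded (C i)" "\<And>i. diameter (C i) \<le> \<delta>" "A \<union> B \<subseteq> (\<Union>i. C i)"
      by (auto simp: hausdorff_covers_def)
    have cov: "(\<lambda>i. C i \<inter> X) \<in> hausdorff_covers \<delta> X" if "X \<subseteq> A \<union> B" for X
      unfolding hausdorff_covers_def mem_Collect_eq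
    proof (intro conjI allI)
      show "X \<subseteq> (\<Union>i. C i \<inter> X)" using bC(3) that by blast
      show "bounded (C i \<inter> X)" for i using bC(1) by (auto intro: bounded_subset)
      show "diameter (C i \<inter> X) \<le> \<delta>" for i
        using bC by (intro order_trans[OF diameter_subset[of "C i \<inter> X" "C i"]]) auto
    qed
    have w: "hausdorff_weight s (C i \<inter> A) + hausdorff_weight s (C i \<inter> B) \<le> hausdorff_weight s (C i)" for i
    proof -
      have "C i \<inter> A = {} \<or> C i \<inter> B = {}"
      proof (rule ccontr)
        assume "\<not> ?thesis"
        then obtain x y where "x \<in> C i \<inter> A" "y \<in> C i \<inter> B" by blast
        then have "\<rho> \<le> dist x y" "dist x y \<le> diameter (C i)"
          using sep diameter_bounded_bound[OF bC(1)] by auto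
        then show False using bC(2)[of i] \<delta> by linarith
      qed
      then show ?thesis using hausdorff_weight_mono[OF _ bC(1) s] by auto
    qed
    have "hausdorff_pre s \<delta> A + hausdorff_pre s \<delta> B \<le>
        (\<Sum>i. hausdorff_weight s (C i \<inter> A)) + (\<Sum>i. hausdorff_weight s (C i \<inter> B))"
      by (intro add_mono hausdorff_pre_le cov) auto
    also have "\<dots> = (\<Sum>i. hausdorff_weight s (C i \<inter> A) + hausdorff_weight s (C i \<inter> B))"
      by (rule suminf_add) auto
    also have "\<dots> \<le> (\<Sum>i. hausdorff_weight s (C i))"
      by (intro suminf_le w) auto
    finally show "hausdorff_pre s \<delta> A + hausdorff_pre s \<delta> B \<le> (\<Sum>i. hausdorff_weight s (C i))" .
  qed
  have two: "hausdorff_pre s \<delta> A + hausdorff_pre s \<delta>' B \<le> hausdorff_outer s (A \<union> B)"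
    if "0 < \<delta>" "0 < \<delta>'" for \<delta> \<delta>'
  proof -
    let ?m = "min (min \<delta> \<delta>') (\<rho> / 2)"
    have "hausdorff_pre s \<delta> A + hausdorff_pre s \<delta>' B \<le> hausdorff_pre s ?m A + hausdorff_pre s ?m B"
      by (intro add_mono hausdorff_pre_antimono) auto
    also have "\<dots> \<le> hausdorff_pre s ?m (A \<union> B)" using that \<rho> by (intro pre) auto
    also have "\<dots> \<le> hausdorff_outer s (A \<union> B)" using that \<rho> by (intro hausdorff_pre_le_outer) auto
    finally show ?thesis .
  qed
  have "hausdorff_pre s \<delta> A + hausdorff_outer s B \<le> hausdorff_outer s (A \<union> B)" if "0 < \<delta>" for \<delta>
    unfolding hausdorff_outer_def[of s B]
    by (subst ennreal_SUP_add_right) (use two that in \<open>auto intro!: SUP_least\<close>)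
  then have "(SUP \<delta>\<in>{0<..}. hausdorff_pre s \<delta> A + hausdorff_outer s B) \<le> hausdorff_outer s (A \<union> B)"
    by (intro SUP_least) auto
  then show ?thesis
    by (simp add: hausdorff_outer_def[of s A] ennreal_SUP_add_left)
qed

text \<open>Caratheodory's argument for metric outer measures: the part of \<open>A\<close> outside a closed set \<open>F\<close>
  is exhausted by the sets at distance at least \<open>1 / (k + 1)\<close> from \<open>F\<close>, and the layers between
  consecutive ones have summable outer measure, because every second layer is separated.\<close>

lemma closed_caratheodory_hausdorff:
  fixes F :: "'a::metric_space set"
  assumes s: "0 \<le> s" and F: "closed F" "F \<noteq> {}" and fin: "hausdorff_outer s A < top"
  shows "hausdorff_outer s (A \<inter> F) + hausdorff_outer s (A - F) \<le> hausdorff_outer s A"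
proof -
  let ?h = "hausdorff_outer s :: 'a set \<Rightarrow> ennreal"
  define r where "r k = inverse (real (Suc k))" for k
  define B where "B k = {x \<in> A. r k \<le> infdist x F}" for k
  define R where "R k = B (Suc k) - B k" for k
  have r: "r k > 0" "r (Suc k) < r k" for k by (auto simp: r_def)
  have r_mono: "r k \<le> r j" if "j \<le> k" for j k using that by (simp add: r_def)
  have B_mono: "B j \<subseteq> B k" if "j \<le> k" for j k using r_mono[OF that] by (auto simp: B_def)
  have BA: "B k \<subseteq> A" for k by (auto simp: B_def)
  have step: "?h (B n) + ?h (R (Suc n)) \<le> ?h (B (n + 2))" for n
  proof -
    have "?h (B n) + ?h (R (Suc n)) \<le> ?h (B n \<union> R (Suc n))"
    proof (rule hausdorff_outer_separated[OF s])
      show "0 < r n - r (Suc n)" using r(2)[of n] by simp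
      fix x y assume "x \<in> B n" "y \<in> R (Suc n)"
      then have "r n \<le> infdist x F" "infdist y F < r (Suc n)" by (auto simp: B_def R_def)
      then show "r n - r (Suc n) \<le> dist x y" using infdist_triangle[of x F y] by linarith
    qed
    also have "\<dots> \<le> ?h (B (n + 2))"
      using B_mono[of n "n + 2"] by (intro hausdorff_outer_mono) (auto simp: R_def)
    finally show ?thesis .
  qed
  \<comment> \<open>\<open>B n\<close> is separated from \<open>R (n + 1)\<close>, but not from \<open>R n\<close>: hence the two sums, over the odd and over
    the even indices.\<close>
  have alt: "(\<Sum>j<m. ?h (R (2 * j + i + 1))) \<le> ?h (B (2 * m + i))" for m i
  proof (induction m)
    case (Suc m)
    then have "(\<Sum>j<Suc m. ?h (R (2 * j + i + 1))) \<le> ?h (B (2 * m + i)) + ?h (R (Suc (2 * m + i)))"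
      by (simp add: add_right_mono)
    also have "\<dots> \<le> ?h (B (2 * m + i + 2))" by (rule step)
    finally show ?case by simp
  qed simp
  have part: "(\<Sum>k<2*m. ?h (R (k + 1))) = (\<Sum>j<m. ?h (R (2 * j + 0 + 1))) + (\<Sum>j<m. ?h (R (2 * j + 1 + 1)))" for m
    by (induction m) (auto simp: algebra_simps numeral_2_eq_2)
  have "(\<Sum>k<n. ?h (R (k + 1))) \<le> ?h A + ?h A" for n
  proof -
    have "(\<Sum>k<n. ?h (R (k + 1))) \<le> (\<Sum>k<2*n. ?h (R (k + 1)))" by (rule sum_mono2) auto
    also have "\<dots> \<le> ?h A + ?h A"
      unfolding part by (intro add_mono order_trans[OF alt] hausdorff_outer_mono BA)
    finally show ?thesis .
  qed
  then have "(\<Sum>k. ?h (R (k + 1))) \<le> ?h A + ?h A" by (intro suminf_le_const) auto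
  then have sum_fin: "(\<Sum>k. ?h (R (k + 1))) \<noteq> top" using fin by (auto simp: top_unique)
  define a where "a k = enn2real (?h (R (k + 1)))" for k
  have a: "?h (R (k + 1)) = ennreal (a k)" for k
  proof -
    have "?h (R (k + 1)) < top" using fin BA[of "k + 2"]
      by (intro order_le_less_trans[OF hausdorff_outer_mono[of "R (k+1)" A]]) (auto simp: R_def)
    then show ?thesis by (simp add: a_def)
  qed
  have a0: "a k \<ge> 0" for k by (simp add: a_def)
  have sa: "summable a" using sum_fin unfolding a by (intro summable_suminf_not_top a0)
  show ?thesis
  proof (rule ennreal_le_epsilon)
    fix e :: real assume e: "0 < e"
    obtain N where N: "\<And>n. n \<ge> N \<Longrightarrow> norm (\<Sum>i. a (i + n)) < e"
      using suminf_exist_split[OF e sa] by blast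
    have tail: "(\<Sum>i. ?h (R (i + N + 1))) \<le> ennreal e"
    proof -
      have "(\<Sum>i. ?h (R (i + N + 1))) = ennreal (\<Sum>i. a (i + N))"
        unfolding a using sa a0 by (intro suminf_ennreal2) (auto simp: summable_iff_shift)
      also have "\<dots> \<le> ennreal e" using N[of N] by (intro ennreal_leI) auto
      finally show ?thesis .
    qed
    have "A - F \<subseteq> B (N + 1) \<union> (\<Union>i. R (i + N + 1))"
    proof
      fix x assume x: "x \<in> A - F"
      then have "infdist x F > 0"
        using in_closed_iff_infdist_zero[OF F] infdist_nonneg[of x F] by (auto simp: less_le)
      then obtain n where "r n < infdist x F"
        using reals_Archimedean[of "infdist x F"] by (auto simp: r_def)
      then have ex: "x \<in> B n" using x by (auto simp: B_def)
      define m where "m = (LEAST n. x \<in> B n)"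
      have m: "x \<in> B m" "\<And>k. k < m \<Longrightarrow> x \<notin> B k"
        unfolding m_def by (rule LeastI[of "\<lambda>n. x \<in> B n", OF ex]) (rule not_less_Least)
      show "x \<in> B (N + 1) \<union> (\<Union>i. R (i + N + 1))"
      proof (cases "m \<le> N + 1")
        case True
        then show ?thesis using B_mono m(1) by blast
      next
        case False
        then have "m = Suc ((m - N - 2) + N + 1)" by simp
        then have "x \<in> R ((m - N - 2) + N + 1)"
          unfolding R_def using m by (metis DiffI lessI)
        then show ?thesis by blast
      qed
    qed
    then have "?h (A - F) \<le> ?h (B (N + 1)) + ?h (\<Union>i. R (i + N + 1))"
      by (meson hausdorff_outer_mono hausdorff_outer_subadditive order_trans)
    also have "\<dots> \<le> ?h (B (N + 1)) + ennreal e"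
      using hausdorff_outer_countably_subadditive[of s "\<lambda>i. R (i + N + 1)"] tail
      by (intro add_left_mono) (rule order_trans)
    finally have 1: "?h (A - F) \<le> ?h (B (N + 1)) + ennreal e" .
    have "?h (A \<inter> F) + ?h (B (N + 1)) \<le> ?h (A \<inter> F \<union> B (N + 1))"
    proof (rule hausdorff_outer_separated[OF s r(1)[of "N + 1"]])
      fix x y assume "x \<in> A \<inter> F" "y \<in> B (N + 1)"
      then show "r (N + 1) \<le> dist x y" using infdist_le[of x F y] by (auto simp: B_def dist_commute)
    qed
    also have "\<dots> \<le> ?h A" using BA by (intro hausdorff_outer_mono) auto
    finally have "?h (A \<inter> F) + ?h (B (N + 1)) \<le> ?h A" .
    then have "(?h (A \<inter> F) + ?h (B (N + 1))) + ennreal e \<le> ?h A + ennreal e"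
      by (rule add_right_mono)
    then show "?h (A \<inter> F) + ?h (A - F) \<le> ?h A + ennreal e"
      using order_trans[OF add_left_mono[OF 1, of "?h (A \<inter> F)"]] unfolding add.assoc by blast
  qed
qed

lemma
  fixes s :: real
  assumes s: "0 \<le> s"
  shows sets_hausdorff_measure:
      "sets (hausdorff_measure s :: 'a::metric_space measure) = lambda_system UNIV (Pow UNIV) (hausdorff_outer s)"
    and emeasure_hausdorff_measure:
      "A \<in> sets (hausdorff_measure s) \<Longrightarrow> emeasure (hausdorff_measure s) A = hausdorff_outer s (A :: 'a set)"
    and borel_hausdorff_measure: "sets borel \<subseteq> sets (hausdorff_measure s :: 'a measure)"
proof -
  let ?h = "hausdorff_outer s :: 'a set \<Rightarrow> ennreal"
  let ?L = "lambda_system UNIV (Pow UNIV) ?h"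
  have "outer_measure_space (Pow UNIV) ?h"
    by (auto simp: outer_measure_space_def positive_def increasing_def countably_subadditive_def
        hausdorff_outer_mono hausdorff_outer_countably_subadditive)
  then have ms: "measure_space UNIV ?L ?h"
    by (rule sigma_algebra.caratheodory_lemma[OF sigma_algebra_Pow])
  then have sa: "sigma_algebra UNIV ?L" by (simp add: measure_space_def)
  have ss: "sigma_sets UNIV ?L = ?L" by (rule sigma_algebra.sigma_sets_eq[OF sa])
  show sets: "sets (hausdorff_measure s :: 'a measure) = ?L"
    using ss by (simp add: hausdorff_measure_def sets_measure_of_conv)
  show "emeasure (hausdorff_measure s) A = ?h A" if "A \<in> sets (hausdorff_measure s)"
    using that ms ss sets by (simp add: hausdorff_measure_def emeasure_measure_of_conv)
  have "F \<in> ?L" if F: "closed F" for F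
    unfolding lambda_system_def mem_Collect_eq
  proof (intro conjI ballI)
    fix A :: "'a set"
    have eq: "F \<inter> A = A \<inter> F" "(UNIV - F) \<inter> A = A - F" by auto
    show "?h (F \<inter> A) + ?h ((UNIV - F) \<inter> A) = ?h A"
      unfolding eq
    proof (rule antisym)
      show "?h A \<le> ?h (A \<inter> F) + ?h (A - F)"
        using hausdorff_outer_subadditive[of s "A \<inter> F" "A - F"] by (simp add: Un_Diff_Int Un_commute)
      show "?h (A \<inter> F) + ?h (A - F) \<le> ?h A"
      proof (cases "F = {} \<or> ?h A = top")
        case False
        then show ?thesis using closed_caratheodory_hausdorff[OF s F] by (auto simp: less_top)
      qed auto
    qed
  qed auto
  then have "{F. closed F} \<subseteq> ?L" by auto
  then have "sigma_sets UNIV {F. closed F} \<subseteq> ?L"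
    by (rule sigma_algebra.sigma_sets_subset[OF sa])
  then show "sets borel \<subseteq> sets (hausdorff_measure s :: 'a measure)"
    unfolding sets by (simp add: borel_eq_closed)
qed

lemma borel_surface_measure: "A \<in> sets borel \<Longrightarrow> A \<in> sets surface_measure"
  unfolding surface_measure_def by (rule subsetD[OF borel_hausdorff_measure]) (auto simp: DIM_positive Suc_leI)

lemma emeasure_surface_measure:
  "A \<in> sets (surface_measure :: 'a::euclidean_space measure) \<Longrightarrow>
    emeasure surface_measure A = hausdorff_outer (real DIM('a) - 1) A"
  unfolding surface_measure_def by (rule emeasure_hausdorff_measure) (auto simp: DIM_positive Suc_leI)

lemma measurable_surface_measure: "f \<in> borel_measurable borel \<Longrightarrow> f \<in> borel_measurable surface_measure"
  using borel_surface_measure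
  by (auto simp: measurable_def surface_measure_def hausdorff_measure_def space_measure_of_conv)

lemma space_surface_measure [simp]: "space surface_measure = UNIV"
  by (simp add: surface_measure_def hausdorff_measure_def space_measure_of_conv)

section \<open>Covers by balls and the volume of cylinders\<close>

text \<open>Covering sets of diameter zero have weight zero, but the cylinders built on the cover below need a
  positive radius. So the diameters are enlarged, at a total cost of \<open>\<epsilon>\<close>.\<close>

lemma ball_cover:
  fixes A :: "'a::euclidean_space set"
  defines "N \<equiv> DIM('a) - 1"
  assumes dim: "2 \<le> DIM('a)" and fin: "hausdorff_outer (real DIM('a) - 1) A < top"
    and \<delta>: "0 < \<delta>" and \<epsilon>: "0 < \<epsilon>"
  obtains p r where "A \<subseteq> (\<Union>i. ball (p i) (r i))" "\<And>i::nat. 0 < r i" "\<And>i. r i \<le> \<delta>"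
    "(\<Sum>i. ennreal (r i ^ N)) \<le>
      ennreal (2 ^ N / unit_ball_vol (real N)) * hausdorff_outer (real DIM('a) - 1) A + ennreal \<epsilon>"
proof -
  let ?s = "real DIM('a) - 1"
  have N: "?s = real N" "N \<ge> 1" using dim by (auto simp: N_def)
  define ub where "ub = unit_ball_vol (real N)"
  have ub: "ub > 0" by (simp add: ub_def)
  define \<kappa> where "\<kappa> = 2 ^ N / ub"
  have \<kappa>: "\<kappa> > 0" using ub by (simp add: \<kappa>_def)
  let ?H = "hausdorff_outer ?s A"
  have "hausdorff_pre ?s (\<delta> / 2) A \<le> ?H" using \<delta> by (intro hausdorff_pre_le_outer) simp
  also have "?H < ?H + ennreal (\<epsilon> / (2 * \<kappa>))" using fin \<epsilon> \<kappa> by (simp add: less_top)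
  finally obtain C where C: "C \<in> hausdorff_covers (\<delta> / 2) A"
    and sumC: "(\<Sum>i. hausdorff_weight ?s (C i)) < ?H + ennreal (\<epsilon> / (2 * \<kappa>))"
    by (rule hausdorff_pre_less)
  have bC: "\<And>i. bounded (C i)" "\<And>i. diameter (C i) \<le> \<delta> / 2" "A \<subseteq> (\<Union>i. C i)"
    using C by (auto simp: hausdorff_covers_def)
  define d where "d i = diameter (C i)" for i
  have d: "0 \<le> d i" "d i \<le> \<delta> / 2" for i using bC by (auto simp: d_def diameter_ge_0)
  have weight: "ennreal (d i ^ N) = ennreal \<kappa> * hausdorff_weight ?s (C i)" for i
  proof -
    have "(d i / 2) powr real N = (d i / 2) ^ N"
      using d(1)[of i] N(2) by (cases "d i = 0") (auto simp: powr_realpow)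
    then have "\<kappa> * (ub * (d i / 2) powr ?s) = d i ^ N"
      using ub N by (simp add: \<kappa>_def power_divide)
    then show ?thesis
      using \<kappa> ub N by (simp add: hausdorff_weight_def d_def[symmetric] ub_def[symmetric] ennreal_mult[symmetric])
  qed
  have "\<exists>\<rho>>0. \<rho> \<le> \<delta> / 2 \<and> (d i + \<rho>) ^ N \<le> d i ^ N + \<epsilon> / 2 * (1/2) ^ Suc i" for i
  proof -
    have "((\<lambda>\<rho>. (d i + \<rho>) ^ N) \<longlongrightarrow> (d i + 0) ^ N) (at_right 0)" by (intro tendsto_intros)
    then have "\<forall>\<^sub>F \<rho> in at_right 0. (d i + \<rho>) ^ N < d i ^ N + \<epsilon> / 2 * (1/2) ^ Suc i"
      using \<epsilon> by (intro order_tendstoD(2)) auto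
    moreover have "\<forall>\<^sub>F \<rho> in at_right 0. \<rho> < \<delta> / 2" "\<forall>\<^sub>F \<rho> in at_right (0::real). \<rho> > 0"
      using \<delta> by (auto simp: eventually_at_right_less eventually_at_right_field intro: exI[of _ "\<delta>/2"])
    ultimately have "\<forall>\<^sub>F \<rho> in at_right 0. (d i + \<rho>) ^ N < d i ^ N + \<epsilon> / 2 * (1/2) ^ Suc i \<and> \<rho> < \<delta> / 2 \<and> \<rho> > 0"
      by (intro eventually_conj)
    then show ?thesis
      using eventually_happens[of _ "at_right (0::real)"] by (auto intro: less_imp_le)
  qed
  then obtain \<rho> where \<rho>: "\<And>i. \<rho> i > 0" "\<And>i. \<rho> i \<le> \<delta> / 2"
    "\<And>i. (d i + \<rho> i) ^ N \<le> d i ^ N + \<epsilon> / 2 * (1/2) ^ Suc i" by metis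
  define p where "p i = (SOME x. x \<in> C i)" for i
  show thesis
  proof (rule that[of p "\<lambda>i. d i + \<rho> i"])
    show "A \<subseteq> (\<Union>i. ball (p i) (d i + \<rho> i))"
    proof
      fix x assume "x \<in> A"
      then obtain i where i: "x \<in> C i" using bC(3) by auto
      then have "p i \<in> C i" unfolding p_def by (rule someI)
      then have "dist (p i) x \<le> d i" using i diameter_bounded_bound[OF bC(1)] by (simp add: d_def)
      then show "x \<in> (\<Union>i. ball (p i) (d i + \<rho> i))" using \<rho>(1)[of i] by (intro UN_I[of i]) auto
    qed
    show "0 < d i + \<rho> i" "d i + \<rho> i \<le> \<delta>" for i using d[of i] \<rho>(1,2)[of i] by auto
    have "(\<Sum>i. ennreal ((d i + \<rho> i) ^ N)) \<le> (\<Sum>i. ennreal (d i ^ N) + ennreal (\<epsilon> / 2) * ennreal ((1/2) ^ Suc i))"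
      using \<rho>(3) d \<epsilon> by (intro suminf_le) (auto simp: ennreal_plus[symmetric] ennreal_mult[symmetric] intro!: ennreal_leI simp del: ennreal_plus)
    also have "\<dots> = (\<Sum>i. ennreal (d i ^ N)) + (\<Sum>i. ennreal (\<epsilon> / 2) * ennreal ((1/2) ^ Suc i))"
      by (rule suminf_add[symmetric]) auto
    also have "(\<Sum>i. ennreal (\<epsilon> / 2) * ennreal ((1/2) ^ Suc i)) = ennreal (\<epsilon> / 2)"
      unfolding ennreal_suminf_cmult
      by (subst suminf_ennreal_eq[OF zero_le_power power_half_series]) auto
    also have "(\<Sum>i. ennreal (d i ^ N)) = ennreal \<kappa> * (\<Sum>i. hausdorff_weight ?s (C i))"
      unfolding weight by simp
    also have "\<dots> \<le> ennreal \<kappa> * (?H + ennreal (\<epsilon> / (2 * \<kappa>)))"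
      using sumC by (intro mult_left_mono) auto
    also have "\<dots> = ennreal \<kappa> * ?H + ennreal (\<epsilon> / 2)"
      using \<kappa> \<epsilon> by (simp add: distrib_left ennreal_mult[symmetric])
    finally show "(\<Sum>i. ennreal ((d i + \<rho> i) ^ N)) \<le>
        ennreal (2 ^ N / unit_ball_vol (real N)) * ?H + ennreal \<epsilon>"
      using \<epsilon> by (simp add: add.assoc \<kappa>_def ub_def ennreal_plus[symmetric] del: ennreal_plus)
  qed
qed

lemma emeasure_cball_le:
  fixes c :: "'a::euclidean_space"
  assumes "0 \<le> r"
  shows "emeasure lborel (cball c r) \<le> ennreal ((2 * r) ^ DIM('a))"
proof -
  have "cball c r \<subseteq> cbox (c - r *\<^sub>R One) (c + r *\<^sub>R One)"
  proof
    fix x assume "x \<in> cball c r"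
    then have "\<bar>(x - c) \<bullet> b\<bar> \<le> r" if "b \<in> Basis" for b
      using Basis_le_norm[OF that, of "x - c"] by (simp add: dist_norm norm_minus_commute)
    then show "x \<in> cbox (c - r *\<^sub>R One) (c + r *\<^sub>R One)"
      by (force simp: mem_box inner_diff_left inner_add_left abs_le_iff)
  qed
  then have "emeasure lborel (cball c r) \<le> emeasure lborel (cbox (c - r *\<^sub>R One) (c + r *\<^sub>R One))"
    by (intro emeasure_mono) auto
  also have "\<dots> = ennreal ((2 * r) ^ DIM('a))"
    using assms by (subst emeasure_lborel_cbox) (auto simp: inner_diff_left inner_add_left)
  finally show ?thesis .
qed

definition perp :: "'a::real_inner \<Rightarrow> 'a \<Rightarrow> 'a" where
  "perp e y = y - (y \<bullet> e) *\<^sub>R e"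

lemma norm_perp_le:
  assumes "norm e = 1"
  shows "norm (perp e y) \<le> norm y"
proof (rule power2_le_imp_le)
  have "e \<bullet> e = 1" using assms by (simp add: norm_eq_1)
  then have "(norm (perp e y))\<^sup>2 = (norm y)\<^sup>2 - (y \<bullet> e)\<^sup>2"
    unfolding perp_def power2_norm_eq_inner
    by (simp add: inner_diff_left inner_diff_right inner_commute power2_eq_square)
  then show "(norm (perp e y))\<^sup>2 \<le> (norm y)\<^sup>2" by simp
qed simp

lemma perp_diff: "perp e (x - y) = perp e x - perp e y"
  by (simp add: perp_def inner_diff_left algebra_simps)

lemma perp_add_direction:
  assumes "norm e = 1"
  shows "perp e (y + t *\<^sub>R e) = perp e y"
  using assms by (simp add: perp_def inner_add_left algebra_simps norm_eq_1)

lemma abs_inner_unit_le: "norm e = 1 \<Longrightarrow> \<bar>y \<bullet> e\<bar> \<le> norm y"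
  using Cauchy_Schwarz_ineq2[of y e] by simp

definition cylinder :: "'a::euclidean_space \<Rightarrow> 'a \<Rightarrow> real \<Rightarrow> real \<Rightarrow> 'a set" where
  "cylinder e p d m = {y. norm (perp e (y - p)) \<le> d \<and> \<bar>(y - p) \<bullet> e\<bar> \<le> m}"

lemma closed_cylinder: "closed (cylinder e p d m)"
  unfolding cylinder_def perp_def
  by (intro closed_Collect_conj closed_Collect_le continuous_intros)

text \<open>A cylinder is covered by a stack of balls of radius \<open>2 d\<close> whose centres are \<open>d\<close> apart on the axis.\<close>

lemma emeasure_cylinder_le:
  fixes e :: "'a::euclidean_space"
  assumes e: "norm e = 1" and d: "0 < d" and m: "0 \<le> m"
  shows "emeasure lborel (cylinder e p d m) \<le> ennreal (4 ^ DIM('a) * d ^ (DIM('a) - 1) * (2 * m + 3 * d))"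
proof -
  let ?k = "\<lceil>m / d\<rceil>"
  have k: "0 \<le> ?k" using d m by (simp add: less_le_trans[OF _ divide_nonneg_pos])
  have "cylinder e p d m \<subseteq> (\<Union>j\<in>{-?k..?k}. cball (p + (of_int j * d) *\<^sub>R e) (2 * d))"
  proof
    fix y assume y: "y \<in> cylinder e p d m"
    define t where "t = (y - p) \<bullet> e"
    have t: "\<bar>t\<bar> \<le> m" "norm (perp e (y - p)) \<le> d" using y by (auto simp: cylinder_def t_def)
    define j where "j = (if 0 \<le> t then \<lfloor>t / d\<rfloor> else \<lceil>t / d\<rceil>)"
    have "\<bar>t / d\<bar> \<le> m / d" using t(1) d by (simp add: divide_right_mono)
    then have tk: "\<bar>t / d\<bar> \<le> of_int ?k" by (meson le_of_int_ceiling order_trans)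
    have j: "j \<in> {-?k..?k}"
    proof (cases "0 \<le> t")
      case True
      then have "0 \<le> t / d" using d by simp
      then have "0 \<le> \<lfloor>t / d\<rfloor>" by simp
      moreover have "real_of_int \<lfloor>t / d\<rfloor> \<le> of_int ?k"
        using tk of_int_floor_le[of "t / d"] by linarith
      ultimately show ?thesis using True k unfolding j_def of_int_le_iff
        by (simp only: if_True atLeastAtMost_iff) (intro conjI TrueI, linarith)
    next
      case False
      then have "t / d \<le> 0" using d by (simp add: divide_nonpos_pos)
      then have "\<lceil>t / d\<rceil> \<le> 0" by simp
      moreover have "real_of_int (- ?k) \<le> of_int \<lceil>t / d\<rceil>"
        using tk le_of_int_ceiling[of "t / d"] by linarith
      ultimately show ?thesis using False k unfolding j_def of_int_le_iff
        by (simp only: if_False atLeastAtMost_iff) (intro conjI TrueI, linarith)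
    qed
    have "\<bar>t / d - of_int j\<bar> \<le> 1"
      unfolding j_def by (auto; linarith)
    then have "\<bar>t / d - of_int j\<bar> * d \<le> 1 * d" using d by (intro mult_right_mono) auto
    moreover have "t - of_int j * d = (t / d - of_int j) * d" using d by (simp add: field_simps)
    then have "\<bar>t - of_int j * d\<bar> = \<bar>t / d - of_int j\<bar> * d" using d by (simp only: abs_mult abs_of_pos)
    ultimately have tj: "\<bar>t - of_int j * d\<bar> \<le> d" by simp
    have "y - (p + (of_int j * d) *\<^sub>R e) = perp e (y - p) + (t - of_int j * d) *\<^sub>R e"
      by (simp add: perp_def t_def algebra_simps)
    then have "norm (y - (p + (of_int j * d) *\<^sub>R e)) \<le> norm (perp e (y - p)) + \<bar>t - of_int j * d\<bar>"
      using norm_triangle_ineq[of "perp e (y - p)" "(t - of_int j * d) *\<^sub>R e"] e by simp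
    then have "y \<in> cball (p + (of_int j * d) *\<^sub>R e) (2 * d)"
      using t(2) tj by (simp add: dist_norm norm_minus_commute)
    then show "y \<in> (\<Union>j\<in>{-?k..?k}. cball (p + (of_int j * d) *\<^sub>R e) (2 * d))" using j by blast
  qed
  then have "emeasure lborel (cylinder e p d m) \<le>
      emeasure lborel (\<Union>j\<in>{-?k..?k}. cball (p + (of_int j * d) *\<^sub>R e) (2 * d))"
    by (intro emeasure_mono) auto
  also have "\<dots> \<le> (\<Sum>j\<in>{-?k..?k}. emeasure lborel (cball (p + (of_int j * d) *\<^sub>R e) (2 * d)))"
    by (rule emeasure_subadditive_finite) auto
  also have "\<dots> \<le> (\<Sum>j\<in>{-?k..?k}. ennreal ((2 * (2 * d)) ^ DIM('a)))"
    using d by (intro sum_mono emeasure_cball_le) simp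
  also have "\<dots> = ennreal (of_int (2 * ?k + 1) * (4 * d) ^ DIM('a))"
    using k d by (simp add: ennreal_mult ennreal_of_nat_eq_real_of_nat nat_add_distrib of_nat_nat add.commute)
  also have "\<dots> \<le> ennreal (4 ^ DIM('a) * d ^ (DIM('a) - 1) * (2 * m + 3 * d))"
  proof (rule ennreal_leI)
    have "of_int ?k \<le> m / d + 1" by linarith
    then have "real_of_int (2 * ?k + 1) \<le> 2 * (m / d) + 3"
      unfolding of_int_add of_int_mult of_int_numeral of_int_1 by linarith
    then have "real_of_int (2 * ?k + 1) * (4 * d) ^ DIM('a) \<le> (2 * (m / d) + 3) * (4 * d) ^ DIM('a)"
      using d by (intro mult_right_mono) auto
    also have "\<dots> = 4 ^ DIM('a) * d ^ (DIM('a) - 1) * (2 * m + 3 * d)"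
    proof -
      have "(4 * d) ^ DIM('a) = 4 ^ DIM('a) * d ^ (DIM('a) - 1) * d"
        using power_Suc[of d "DIM('a) - 1"] by (simp add: power_mult_distrib DIM_positive)
      then show ?thesis using d by (simp add: field_simps)
    qed
    finally show "real_of_int (2 * ?k + 1) * (4 * d) ^ DIM('a) \<le> 4 ^ DIM('a) * d ^ (DIM('a) - 1) * (2 * m + 3 * d)" .
  qed
  finally show ?thesis .
qed

section \<open>Layers around a Lipschitz graph\<close>

text \<open>The graph of \<open>\<gamma>\<close> over the hyperplane orthogonal to the unit vector \<open>e\<close>. The function \<open>height\<close> is the
  distance to the graph measured along \<open>e\<close>, positive below the graph, and \<open>foot\<close> is the projection onto
  the graph along \<open>e\<close>.\<close>

locale lipschitz_graph =
  fixes e :: "'a::euclidean_space" and \<gamma> :: "'a \<Rightarrow> real" and L :: real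
  assumes unit: "norm e = 1" and lip: "L-lipschitz_on UNIV \<gamma>"
begin

definition height :: "'a \<Rightarrow> real" where
  "height y = \<gamma> (perp e y) - y \<bullet> e"

definition foot :: "'a \<Rightarrow> 'a" where
  "foot y = y + height y *\<^sub>R e"

lemma ee: "e \<bullet> e = 1"
  using unit by (simp add: norm_eq_1)

lemma L_nonneg: "0 \<le> L"
  using lip by (rule lipschitz_on_nonneg)

lemma subgraph_eq: "subgraph e \<gamma> = {y. 0 < height y}"
  and graph_eq: "graph_over e \<gamma> = {y. height y = 0}"
  by (auto simp: subgraph_def graph_over_def height_def perp_def)

lemma height_add: "height (y + t *\<^sub>R e) = height y - t"
  by (simp add: height_def perp_add_direction[OF unit] inner_add_left ee)

lemma height_foot: "height (foot y) = 0"
  by (simp add: foot_def height_add)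

lemma height_lipschitz: "\<bar>height x - height y\<bar> \<le> (1 + L) * dist x y"
proof -
  have "\<bar>\<gamma> (perp e x) - \<gamma> (perp e y)\<bar> \<le> L * dist (perp e x) (perp e y)"
    using lipschitz_onD[OF lip, of "perp e x" "perp e y"] by (simp add: dist_real_def)
  also have "\<dots> \<le> L * dist x y"
    using L_nonneg norm_perp_le[OF unit, of "x - y"] by (intro mult_left_mono) (auto simp: dist_norm perp_diff)
  finally have "\<bar>\<gamma> (perp e x) - \<gamma> (perp e y)\<bar> \<le> L * dist x y" .
  moreover have "\<bar>(x - y) \<bullet> e\<bar> \<le> dist x y" using abs_inner_unit_le[OF unit] by (simp add: dist_norm)
  ultimately show ?thesis by (simp add: height_def inner_diff_left algebra_simps)
qed

lemma continuous_height: "continuous_on A height"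
proof -
  have "(1 + L)-lipschitz_on A height"
    using height_lipschitz L_nonneg by (intro lipschitz_onI) (auto simp: dist_real_def)
  then show ?thesis by (rule lipschitz_on_continuous_on)
qed

lemma height_measurable [measurable]: "height \<in> borel_measurable borel"
  by (intro borel_measurable_continuous_onI continuous_height)

lemma foot_measurable [measurable]: "foot \<in> borel_measurable borel"
  unfolding foot_def by measurable

lemma closed_graph: "closed (graph_over e \<gamma>)"
  unfolding graph_eq by (intro closed_Collect_eq continuous_height continuous_intros)

lemma open_subgraph: "open (subgraph e \<gamma>)"
  unfolding subgraph_eq by (intro open_Collect_less continuous_height continuous_intros)

definition layer :: "real \<Rightarrow> 'a set" where
  "layer m = {y. \<bar>height y\<bar> \<le> m}"

lemma layer_measurable [measurable]: "layer m \<in> sets borel"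
  unfolding layer_def by measurable

definition layer_const :: "real \<Rightarrow> real" where
  "layer_const M = 4 ^ DIM('a) * (5 + 2 * M) * (2 ^ (DIM('a) - 1) / unit_ball_vol (real (DIM('a) - 1)))"

lemma layer_const_pos: "0 \<le> M \<Longrightarrow> 0 < layer_const M"
  by (simp add: layer_const_def)

text \<open>The part of the layer over a piece of the graph inside a ball of radius \<open>r\<close> lies in a cylinder of
  radius \<open>r\<close> and half-height \<open>r + M s\<close>. For \<open>r \<le> s\<close> its volume is of order \<open>s r\<^sup>n\<^sup>-\<^sup>1\<close>, and summing over a cover
  by such balls gives \<open>s\<close> times the Hausdorff measure.\<close>

lemma emeasure_layer_le_hausdorff:
  assumes dim: "2 \<le> DIM('a)" and s: "0 < s" and M: "0 \<le> M" and A: "A \<subseteq> graph_over e \<gamma>"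
    and Am: "A \<in> sets borel"
  shows "emeasure lborel {y \<in> layer (M * s). foot y \<in> A} \<le>
    ennreal (layer_const M * s) * hausdorff_outer (real DIM('a) - 1) A"
proof (cases "hausdorff_outer (real DIM('a) - 1) A = top")
  case True
  then show ?thesis using layer_const_pos[OF M] s by (simp add: ennreal_mult_top)
next
  case False
  let ?N = "DIM('a) - 1" let ?H = "hausdorff_outer (real DIM('a) - 1) A"
  let ?c = "4 ^ DIM('a) * (5 + 2 * M) * s"
  let ?\<kappa> = "2 ^ ?N / unit_ball_vol (real ?N)"
  have c: "?c > 0" using M s by (simp add: add_pos_nonneg)
  have \<kappa>: "?\<kappa> > 0" by simp
  have fin: "?H < top" using False by (simp add: less_top)
  show ?thesis
  proof (rule ennreal_le_epsilon)
    fix \<epsilon> :: real assume \<epsilon>: "0 < \<epsilon>"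
    obtain p r where cov: "A \<subseteq> (\<Union>i. ball (p i) (r i))" and r: "\<And>i::nat. 0 < r i" "\<And>i. r i \<le> s"
      and sum: "(\<Sum>i. ennreal (r i ^ ?N)) \<le> ennreal ?\<kappa> * ?H + ennreal (\<epsilon> / ?c)"
      by (rule ball_cover[OF dim fin s divide_pos_pos[OF \<epsilon> c]]) blast
    have "{y \<in> layer (M * s). foot y \<in> A} \<subseteq> (\<Union>i. cylinder e (p i) (r i) (r i + M * s))"
    proof
      fix y assume y: "y \<in> {y \<in> layer (M * s). foot y \<in> A}"
      then obtain i where i: "foot y \<in> ball (p i) (r i)" using cov by auto
      then have w: "norm (foot y - p i) < r i" by (simp add: dist_norm norm_minus_commute)
      have yy: "y - p i = (foot y - p i) + (- height y) *\<^sub>R e" by (simp add: foot_def)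
      have np: "norm (perp e (y - p i)) \<le> r i"
        unfolding yy perp_add_direction[OF unit] using norm_perp_le[OF unit, of "foot y - p i"] w by linarith
      have "(y - p i) \<bullet> e = (foot y - p i) \<bullet> e - height y"
        by (simp add: foot_def inner_add_left inner_diff_left ee)
      moreover have "\<bar>height y\<bar> \<le> M * s" using y by (simp add: layer_def)
      ultimately have "\<bar>(y - p i) \<bullet> e\<bar> \<le> r i + M * s"
        using abs_inner_unit_le[OF unit, of "foot y - p i"] w by linarith
      then show "y \<in> (\<Union>i. cylinder e (p i) (r i) (r i + M * s))"
        using np by (auto simp: cylinder_def)
    qed
    then have "emeasure lborel {y \<in> layer (M * s). foot y \<in> A} \<le>
        emeasure lborel (\<Union>i. cylinder e (p i) (r i) (r i + M * s))"
      by (intro emeasure_mono) (auto intro!: borel_closed closed_cylinder sets.countable_UN)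
    also have "\<dots> \<le> (\<Sum>i. emeasure lborel (cylinder e (p i) (r i) (r i + M * s)))"
      by (intro emeasure_subadditive_countably) (auto intro!: borel_closed closed_cylinder)
    also have "\<dots> \<le> (\<Sum>i. ennreal ?c * ennreal (r i ^ ?N))"
    proof (intro suminf_le)
      fix i
      have "emeasure lborel (cylinder e (p i) (r i) (r i + M * s)) \<le>
          ennreal (4 ^ DIM('a) * r i ^ ?N * (2 * (r i + M * s) + 3 * r i))"
        using r[of i] M s by (intro emeasure_cylinder_le unit) auto
      also have "\<dots> \<le> ennreal (4 ^ DIM('a) * r i ^ ?N * ((5 + 2 * M) * s))"
        using r[of i] by (intro ennreal_leI mult_left_mono) (auto simp: algebra_simps)
      also have "\<dots> = ennreal (?c * r i ^ ?N)" by (simp add: mult_ac)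
      also have "\<dots> = ennreal ?c * ennreal (r i ^ ?N)"
        using c r[of i] by (intro ennreal_mult) auto
      finally show "emeasure lborel (cylinder e (p i) (r i) (r i + M * s)) \<le> ennreal ?c * ennreal (r i ^ ?N)" .
    qed auto
    also have "\<dots> \<le> ennreal ?c * (ennreal ?\<kappa> * ?H + ennreal (\<epsilon> / ?c))"
      unfolding ennreal_suminf_cmult by (rule mult_left_mono[OF sum]) simp
    also have "\<dots> = ennreal (?c * ?\<kappa>) * ?H + ennreal (?c * (\<epsilon> / ?c))"
      using c \<kappa> \<epsilon> unfolding distrib_left
      by (subst ennreal_mult, simp, simp) (subst ennreal_mult, simp, simp, simp add: mult.assoc)
    also have "?c * (\<epsilon> / ?c) = \<epsilon>" using c by (metis less_irrefl nonzero_mult_div_cancel_left times_divide_eq_right)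
    also have "?c * ?\<kappa> = layer_const M * s" by (simp add: layer_const_def)
    finally show "emeasure lborel {y \<in> layer (M * s). foot y \<in> A} \<le>
        ennreal (layer_const M * s) * ?H + ennreal \<epsilon>" .
  qed
qed

text \<open>The estimate for sets says that the image of Lebesgue measure on the layer under the projection
  \<open>foot\<close> is bounded by a multiple of surface measure on the graph; so the integrals are comparable.\<close>

lemma nn_integral_layer_le_hausdorff:
  fixes f :: "'a \<Rightarrow> ennreal"
  assumes dim: "2 \<le> DIM('a)" and s: "0 < s" and M: "0 \<le> M" and f [measurable]: "f \<in> borel_measurable borel"
  shows "(\<integral>\<^sup>+y. indicator (layer (M * s)) y * f (foot y) \<partial>lborel) \<le>
    ennreal (layer_const M * s) * (\<integral>\<^sup>+y\<in>graph_over e \<gamma>. f y \<partial>surface_measure)"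
proof -
  let ?G = "graph_over e \<gamma>"
  have G [measurable]: "?G \<in> sets borel" using closed_graph by (rule borel_closed)
  have id: "(\<lambda>x. x) \<in> measurable surface_measure borel"
    by (rule measurable_surface_measure) measurable
  define N where "N = distr (density lborel (indicator (layer (M * s)))) borel foot"
  define S where "S = density (distr surface_measure borel (\<lambda>x. x)) (\<lambda>x. ennreal (layer_const M * s) * indicator ?G x)"
  have "N \<le> S"
  proof (subst le_measure)
    show "sets N = sets S" by (simp add: N_def S_def)
    show "\<forall>A\<in>sets N. emeasure N A \<le> emeasure S A"
    proof
      fix A assume "A \<in> sets N"
      then have A [measurable]: "A \<in> sets borel" by (simp add: N_def)
      have "emeasure N A = emeasure (density lborel (indicator (layer (M * s)))) (foot -` A)"
        unfolding N_def by (subst emeasure_distr) (auto simp: measurable_cong_sets[OF sets_density refl])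
      also have "\<dots> = (\<integral>\<^sup>+y. indicator (layer (M * s)) y * indicator (foot -` A) y \<partial>lborel)"
      proof (subst emeasure_density)
        show "foot -` A \<in> sets lborel"
          using measurable_sets[OF foot_measurable A] by simp
      qed auto
      also have "\<dots> = (\<integral>\<^sup>+y. indicator {y \<in> layer (M * s). foot y \<in> A \<inter> ?G} y \<partial>lborel)"
        by (intro nn_integral_cong) (auto simp: indicator_def graph_eq height_foot)
      also have "\<dots> = emeasure lborel {y \<in> layer (M * s). foot y \<in> A \<inter> ?G}"
        by (subst nn_integral_indicator) measurable
      also have "\<dots> \<le> ennreal (layer_const M * s) * hausdorff_outer (real DIM('a) - 1) (A \<inter> ?G)"
        by (rule emeasure_layer_le_hausdorff[OF dim s M]) auto
      also have "hausdorff_outer (real DIM('a) - 1) (A \<inter> ?G) = emeasure surface_measure (A \<inter> ?G)"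
        by (subst emeasure_surface_measure) (auto intro: borel_surface_measure)
      also have "ennreal (layer_const M * s) * emeasure surface_measure (A \<inter> ?G) = emeasure S A"
      proof -
        have "emeasure S A = (\<integral>\<^sup>+x. ennreal (layer_const M * s) * indicator (A \<inter> ?G) x \<partial>distr surface_measure borel (\<lambda>x. x))"
          unfolding S_def by (subst emeasure_density) (auto intro!: nn_integral_cong simp: indicator_def)
        also have "\<dots> = ennreal (layer_const M * s) * emeasure (distr surface_measure borel (\<lambda>x. x)) (A \<inter> ?G)"
          by (subst nn_integral_cmult_indicator) auto
        also have "emeasure (distr surface_measure borel (\<lambda>x. x)) (A \<inter> ?G) = emeasure surface_measure (A \<inter> ?G)"
          by (subst emeasure_distr[OF id]) auto
        finally show ?thesis by simp
      qed
      finally show "emeasure N A \<le> emeasure S A" .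
    qed
  qed
  then have le: "nn_integral N f \<le> nn_integral S f"
    by (rule nn_integral_mono_measure[rotated]) (simp add: N_def S_def)
  have "nn_integral N f = (\<integral>\<^sup>+y. indicator (layer (M * s)) y * f (foot y) \<partial>lborel)"
    unfolding N_def by (subst nn_integral_distr) (auto simp: nn_integral_density measurable_cong_sets[OF sets_density refl])
  moreover have "nn_integral S f = (\<integral>\<^sup>+x. ennreal (layer_const M * s) * (f x * indicator ?G x) \<partial>distr surface_measure borel (\<lambda>x. x))"
    unfolding S_def by (subst nn_integral_density) (auto simp: mult_ac intro!: nn_integral_cong)
  then have "nn_integral S f = ennreal (layer_const M * s) * (\<integral>\<^sup>+y\<in>?G. f y \<partial>surface_measure)"
    by (simp add: nn_integral_cmult nn_integral_distr[OF id])
  ultimately show ?thesis using le by simp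
qed


text \<open>The translates of the layer of width \<open>2 M s\<close> by the multiples of \<open>(2 M + 1) s\<close> in the direction
  of \<open>e\<close> are disjoint, and of order \<open>1 / s\<close> of them fit into a bounded set.\<close>

lemma measure_layer_le:
  assumes M: "0 \<le> M"
  shows "measure lborel (layer (M * inverse (real (Suc k))) \<inter> ball 0 R) \<le>
    inverse (real (Suc k)) * measure lborel (ball (0::'a) (R + 2 * M + 1))"
proof -
  define s where "s = inverse (real (Suc k))"
  have s: "0 < s" "real (Suc k) * s = 1" by (auto simp: s_def)
  let ?A = "layer (M * s) \<inter> ball 0 R"
  define c where "c j = - (real j * ((2 * M + 1) * s)) *\<^sub>R e" for j :: nat
  define T where "T j = {y. c j + y \<in> ?A}" for j
  have A: "?A \<in> sets borel" by auto
  have T: "T j = (+) (c j) -` ?A" for j by (auto simp: T_def)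
  have Tm: "T j \<in> sets borel" for j
    unfolding T using measurable_sets[OF _ A, of "(+) (c j)" borel] by simp
  have eT: "emeasure lborel (T j) = emeasure lborel ?A" for j
  proof -
    have "emeasure lborel ?A = emeasure (distr lborel borel ((+) (c j))) ?A"
      by (simp add: lborel_distr_plus)
    also have "\<dots> = emeasure lborel (T j)" unfolding T using A by (subst emeasure_distr) auto
    finally show ?thesis by simp
  qed
  have hT: "\<bar>height y + real j * ((2 * M + 1) * s)\<bar> \<le> M * s" if "y \<in> T j" for j y
  proof -
    have "height (c j + y) = height y + real j * ((2 * M + 1) * s)"
      using height_add[of y "- (real j * ((2 * M + 1) * s))"] by (simp add: c_def add.commute)
    then show ?thesis using that by (simp add: T_def layer_def)
  qed
  have disj: "disjoint_family_on T {..<Suc k}"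
    unfolding disjoint_family_on_def
  proof (intro ballI impI)
    fix i j :: nat assume ij: "i \<noteq> j"
    show "T i \<inter> T j = {}"
    proof (rule ccontr)
      assume "T i \<inter> T j \<noteq> {}"
      then obtain y where "y \<in> T i" "y \<in> T j" by blast
      from hT[OF this(1)] hT[OF this(2)]
      have "\<bar>real i * ((2 * M + 1) * s) - real j * ((2 * M + 1) * s)\<bar> \<le> 2 * (M * s)" by linarith
      then have "\<bar>(real i - real j) * ((2 * M + 1) * s)\<bar> \<le> 2 * (M * s)" by (simp only: left_diff_distrib)
      then have "\<bar>real i - real j\<bar> * ((2 * M + 1) * s) \<le> 2 * (M * s)"
        using s M by (simp add: abs_mult)
      moreover have "1 \<le> \<bar>real i - real j\<bar>" using ij by linarith
      then have "1 * ((2 * M + 1) * s) \<le> \<bar>real i - real j\<bar> * ((2 * M + 1) * s)"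
        using s M by (intro mult_right_mono) auto
      ultimately show False using s by (simp add: algebra_simps)
    qed
  qed
  have sub: "(\<Union>j\<in>{..<Suc k}. T j) \<subseteq> ball 0 (R + 2 * M + 1)"
  proof
    fix y assume "y \<in> (\<Union>j\<in>{..<Suc k}. T j)"
    then obtain j where j: "j < Suc k" "c j + y \<in> ?A" by (auto simp: T_def)
    have "norm (c j) = (real j * s) * (2 * M + 1)" using s M unit by (simp add: c_def)
    also have "\<dots> \<le> 1 * (2 * M + 1)"
    proof (intro mult_right_mono)
      have "real j * s \<le> real (Suc k) * s" using j s by (intro mult_right_mono) auto
      then show "real j * s \<le> 1" using s(2) by linarith
    qed (use M in auto)
    finally have "norm (c j) \<le> 2 * M + 1" by simp
    moreover have "norm y \<le> norm (c j + y) + norm (c j)"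
      using norm_triangle_ineq4[of "c j + y" "c j"] by simp
    ultimately show "y \<in> ball 0 (R + 2 * M + 1)" using j(2) by simp
  qed
  have "of_nat (Suc k) * emeasure lborel ?A = (\<Sum>j<Suc k. emeasure lborel (T j))" by (simp add: eT)
  also have "\<dots> = emeasure lborel (\<Union>j\<in>{..<Suc k}. T j)"
    using Tm disj by (intro sum_emeasure) auto
  also have "\<dots> \<le> emeasure lborel (ball (0::'a) (R + 2 * M + 1))" using sub by (intro emeasure_mono) auto
  finally have le: "of_nat (Suc k) * emeasure lborel ?A \<le> emeasure lborel (ball (0::'a) (R + 2 * M + 1))" .
  have f1: "emeasure lborel ?A < \<infinity>" by (intro emeasure_bounded_finite bounded_Int) auto
  have f2: "emeasure lborel (ball (0::'a) (R + 2 * M + 1)) < \<infinity>" by (intro emeasure_bounded_finite) auto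
  have e1: "emeasure lborel ?A = ennreal (measure lborel ?A)" using f1 by (intro emeasure_eq_ennreal_measure) auto
  have e2: "emeasure lborel (ball (0::'a) (R + 2 * M + 1)) = ennreal (measure lborel (ball (0::'a) (R + 2 * M + 1)))"
    using f2 by (intro emeasure_eq_ennreal_measure) auto
  have "ennreal (real (Suc k) * measure lborel ?A) \<le> ennreal (measure lborel (ball (0::'a) (R + 2 * M + 1)))"
    using le unfolding e1 e2 by (simp add: ennreal_mult ennreal_of_nat_eq_real_of_nat del: of_nat_Suc)
  then have "real (Suc k) * measure lborel ?A \<le> measure lborel (ball (0::'a) (R + 2 * M + 1))"
    by (simp add: ennreal_le_iff del: of_nat_Suc)
  then have "s * (real (Suc k) * measure lborel ?A) \<le> s * measure lborel (ball (0::'a) (R + 2 * M + 1))"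
    using s by (intro mult_left_mono) auto
  then show ?thesis using s by (simp add: s_def mult.assoc[symmetric])
qed

text \<open>The graph lies in layers of arbitrarily small volume.\<close>

lemma graph_null: "graph_over e \<gamma> \<in> null_sets lborel"
proof -
  have G: "graph_over e \<gamma> \<in> sets borel" using closed_graph by (rule borel_closed)
  have "graph_over e \<gamma> \<inter> ball 0 (real R) \<in> null_sets lborel" for R :: nat
  proof -
    let ?V = "measure lborel (ball (0::'a) (real R + 2 * 0 + 1))"
    let ?A = "graph_over e \<gamma> \<inter> ball 0 (real R)"
    have "measure lborel ?A \<le> inverse (real (Suc k)) * ?V" for k
    proof -
      have "measure lborel ?A \<le> measure lborel (layer (0 * inverse (real (Suc k))) \<inter> ball 0 (real R))"
      proof (rule measure_mono_fmeasurable)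
        show "?A \<subseteq> layer (0 * inverse (real (Suc k))) \<inter> ball 0 (real R)" by (auto simp: graph_eq layer_def)
        show "layer (0 * inverse (real (Suc k))) \<inter> ball 0 (real R) \<in> fmeasurable lborel"
          by (intro fmeasurableI emeasure_bounded_finite bounded_Int) auto
      qed (use G in auto)
      also have "\<dots> \<le> inverse (real (Suc k)) * ?V" by (rule measure_layer_le) simp
      finally show ?thesis .
    qed
    moreover have lim: "(\<lambda>k. inverse (real (Suc k)) * ?V) \<longlonglongrightarrow> 0"
      by (intro tendsto_mult_left_zero LIMSEQ_inverse_real_of_nat)
    ultimately have "measure lborel ?A \<le> 0" by (intro LIMSEQ_le_const[OF lim]) blast
    then have "measure lborel ?A = 0" by (simp add: measure_le_0_iff)
    moreover have "emeasure lborel ?A < \<infinity>" by (intro emeasure_bounded_finite bounded_Int) auto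
    ultimately show ?thesis using G by (intro null_setsI) (auto simp: emeasure_eq_ennreal_measure less_top)
  qed
  then have "(\<Union>R::nat. graph_over e \<gamma> \<inter> ball 0 (real R)) \<in> null_sets lborel" by (intro null_sets_UN) auto
  moreover have "(\<Union>R::nat. graph_over e \<gamma> \<inter> ball 0 (real R)) = graph_over e \<gamma>"
    using reals_Archimedean2 by auto
  ultimately show ?thesis by simp
qed

end

lemma dir_deriv_expand:
  assumes "smooth f"
  shows "dir_deriv f h x = (\<Sum>b\<in>Basis. (h \<bullet> b) * dir_deriv f b x)"
proof -
  have lin: "linear (\<lambda>h. dir_deriv f h x)"
    by (rule has_derivative_linear[OF smooth_has_derivative[OF assms]])
  have "dir_deriv f h x = dir_deriv f (\<Sum>b\<in>Basis. (h \<bullet> b) *\<^sub>R b) x" by (simp add: euclidean_representation)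
  also have "\<dots> = (\<Sum>b\<in>Basis. (h \<bullet> b) * dir_deriv f b x)"
    using linear_sum[OF lin, of "\<lambda>b. (h \<bullet> b) *\<^sub>R b" Basis] linear_cmul[OF lin] by simp
  finally show ?thesis .
qed

lemma test_function_line_lipschitz:
  assumes "test_function U u"
  obtains B where "B \<ge> 0" "\<And>y t. \<bar>u (y + t *\<^sub>R e) - u y\<bar> \<le> B * \<bar>t\<bar>"
proof -
  have sm: "smooth u" by (rule test_function_smooth[OF assms])
  have "\<exists>M\<ge>0. \<forall>x. \<bar>dir_deriv u b x\<bar> \<le> M" if "b \<in> Basis" for b
    using test_function_bounded[OF test_function_dir_deriv[OF assms that]] by (metis less_imp_le)
  then obtain M where M: "\<And>b x. b \<in> Basis \<Longrightarrow> \<bar>dir_deriv u b x\<bar> \<le> M b" "\<And>b. b \<in> Basis \<Longrightarrow> 0 \<le> M b" by metis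
  define B where "B = (\<Sum>b\<in>Basis. \<bar>e \<bullet> b\<bar> * M b)"
  have bnd: "\<bar>dir_deriv u e x\<bar> \<le> B" for x
    unfolding dir_deriv_expand[OF sm, of e x] B_def
    by (rule order_trans[OF sum_abs sum_mono]) (auto simp: abs_mult intro!: mult_left_mono M)
  have "\<bar>u (y + t *\<^sub>R e) - u y\<bar> \<le> B * \<bar>t\<bar>" for y t
    using field_differentiable_bound[of UNIV "\<lambda>t. u (y + t *\<^sub>R e)" "\<lambda>t. dir_deriv u e (y + t *\<^sub>R e)" B t 0]
      smooth_line_derivative[OF sm] bnd by simp
  moreover have "B \<ge> 0" using M by (auto simp: B_def intro!: sum_nonneg)
  ultimately show ?thesis using that by blast
qed

text \<open>This replaces the divergence theorem. The integral of a derivative over the subgraph is the limit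
  of difference quotients, shifting the subgraph by \<open>s\<close> only changes it inside a layer of width of order
  \<open>s\<close> around the graph, and on the layer \<open>w\<close> is compared with its values on the graph. The right-hand
  side is small if \<open>\<tau>\<close> is small and \<open>x\<close> is small compared with \<open>\<tau>\<close>.\<close>

context lipschitz_graph
begin

lemma subgraph_dir_deriv_bound:
  assumes dim: "2 \<le> DIM('a)" and w: "test_function (ball 0 R) w" and b: "b \<in> Basis"
    and \<tau>: "0 < \<tau>" and x: "0 \<le> x"
    and nn: "(\<integral>\<^sup>+y\<in>graph_over e \<gamma>. ennreal ((w y)\<^sup>2) \<partial>surface_measure) \<le> ennreal x"
  shows "\<bar>LINT y|lborel. indicator (subgraph e \<gamma>) y * dir_deriv w b y\<bar> \<le>
    \<tau> * measure lborel (ball (0::'a) (R + 2 * (1 + L) + 1)) + layer_const (1 + L) * x / \<tau>"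
proof -
  let ?S = "subgraph e \<gamma>" let ?M = "1 + L" let ?K = "layer_const (1 + L)"
  let ?V = "measure lborel (ball (0::'a) (R + 2 * ?M + 1))"
  have M: "0 \<le> ?M" using L_nonneg by simp
  have Sm [measurable]: "?S \<in> sets borel" using open_subgraph by (rule borel_open)
  have wU: "test_function UNIV w" by (rule test_function_mono[OF w]) simp
  have wm [measurable]: "w \<in> borel_measurable borel" by (rule smooth_measurable[OF test_function_smooth[OF w]])
  have wi: "integrable lborel w" by (rule test_function_integrable_lborel[OF w])
  have w2: "test_function (ball 0 R) (\<lambda>y. w y * w y)"
    by (rule test_function_mult[OF w test_function_smooth[OF w]])
  have w2i: "integrable lborel (\<lambda>y. (w y)\<^sup>2)"
    using test_function_integrable_lborel[OF w2] by (simp add: power2_eq_square)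
  obtain B where B: "0 \<le> B" "\<And>y t. \<bar>w (y + t *\<^sub>R e) * w (y + t *\<^sub>R e) - w y * w y\<bar> \<le> B * \<bar>t\<bar>"
    using test_function_line_lipschitz[OF w2] by metis
  let ?a = "\<lambda>k. real (Suc k) * (LINT y|lborel. indicator ?S y * (w (y + inverse (real (Suc k)) *\<^sub>R b) - w y))"
  have lim: "?a \<longlonglongrightarrow> (LINT y|lborel. indicator ?S y * dir_deriv w b y)"
    by (rule difference_quotient_tendsto[OF wU b Sm])
  have bound: "\<bar>?a k\<bar> \<le> \<tau> * ?V + (?K * x + inverse (real (Suc k)) * (B * ?M * ?V)) / \<tau>" for k
  proof -
    define s where "s = inverse (real (Suc k))"
    have s: "0 < s" "real (Suc k) * s = 1" by (auto simp: s_def)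
    let ?l = "layer (?M * s)"
    have lm [measurable]: "?l \<in> sets borel" by (rule layer_measurable)
    have lb: "integrable lborel (\<lambda>y. indicator (?l \<inter> ball 0 R) y :: real)"
      by (intro integrable_real_indicator emeasure_bounded_finite bounded_Int) auto
    have vol: "(LINT y|lborel. indicator (?l \<inter> ball 0 R) y) \<le> s * ?V"
      using measure_layer_le[OF M, of k R] by (simp add: s_def)
    have shift: "(LINT y|lborel. indicator ?S y * (w (y + s *\<^sub>R b) - w y)) =
        (LINT y|lborel. (indicator ?S (y - s *\<^sub>R b) - indicator ?S y) * w y)"
    proof -
      let ?g = "\<lambda>y. indicator ?S (y - s *\<^sub>R b) * w y"
      have gm: "?g \<in> borel_measurable borel" by measurable
      have gi: "integrable lborel ?g"
        by (rule Bochner_Integration.integrable_bound[OF wi]) (auto simp: indicator_def)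
      have hi: "integrable lborel (\<lambda>y. indicator ?S y * w y)"
        by (rule Bochner_Integration.integrable_bound[OF wi]) (auto simp: indicator_def)
      have gi': "integrable lborel (\<lambda>y. indicator ?S y * w (y + s *\<^sub>R b))"
        using integrable_translate[OF gi, of "s *\<^sub>R b"] by simp
      have "(LINT y|lborel. indicator ?S y * (w (y + s *\<^sub>R b) - w y)) =
          (LINT y|lborel. indicator ?S y * w (y + s *\<^sub>R b)) - (LINT y|lborel. indicator ?S y * w y)"
        using gi' hi by (simp add: right_diff_distrib)
      also have "(LINT y|lborel. indicator ?S y * w (y + s *\<^sub>R b)) = (LINT y|lborel. ?g y)"
        using lint_translate[OF gm, of "s *\<^sub>R b"] by simp
      finally show ?thesis using gi hi by (simp add: left_diff_distrib)
    qed
    have foot_i: "integrable lborel (\<lambda>y. indicator ?l y * (w (foot y))\<^sup>2)"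
      and foot_le: "(LINT y|lborel. indicator ?l y * (w (foot y))\<^sup>2) \<le> ?K * s * x"
    proof -
      have "(\<integral>\<^sup>+y. ennreal (indicator ?l y * (w (foot y))\<^sup>2) \<partial>lborel) =
          (\<integral>\<^sup>+y. indicator ?l y * ennreal ((w (foot y))\<^sup>2) \<partial>lborel)"
        by (intro nn_integral_cong) (auto simp: indicator_def)
      also have "\<dots> \<le> ennreal (?K * s) * (\<integral>\<^sup>+y\<in>graph_over e \<gamma>. ennreal ((w y)\<^sup>2) \<partial>surface_measure)"
        by (rule nn_integral_layer_le_hausdorff[OF dim s(1) M]) measurable
      also have "\<dots> \<le> ennreal (?K * s) * ennreal x" by (rule mult_left_mono[OF nn]) simp
      also have "\<dots> = ennreal (?K * s * x)"
        using layer_const_pos[OF M] s x by (simp add: ennreal_mult)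
      finally have le: "(\<integral>\<^sup>+y. ennreal (indicator ?l y * (w (foot y))\<^sup>2) \<partial>lborel) \<le> ennreal (?K * s * x)" .
      show "integrable lborel (\<lambda>y. indicator ?l y * (w (foot y))\<^sup>2)"
        by (rule integrableI_bounded) (use le in \<open>auto simp: abs_mult intro: order_le_less_trans\<close>)
      show "(LINT y|lborel. indicator ?l y * (w (foot y))\<^sup>2) \<le> ?K * s * x"
        using layer_const_pos[OF M] s x le by (intro integral_real_bounded) auto
    qed
    \<comment> \<open>The three terms come from \<open>\<bar>w\<bar> \<le> \<tau> + w\<^sup>2 / \<tau>\<close> and from replacing \<open>w\<^sup>2\<close> by its value at the foot point;
      the last one carries an additional factor \<open>s\<close> and disappears in the limit.\<close>
    let ?h = "\<lambda>y. \<tau> * indicator (?l \<inter> ball 0 R) y + (1 / \<tau>) * (indicator ?l y * (w (foot y))\<^sup>2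
        + B * (?M * s) * indicator (?l \<inter> ball 0 R) y) :: real"
    have hi: "integrable lborel ?h"
      by (intro Bochner_Integration.integrable_add integrable_mult_right lb foot_i)
    have pointwise: "\<bar>(indicator ?S (y - s *\<^sub>R b) - indicator ?S y) * w y\<bar> \<le> ?h y" for y
    proof (cases "y \<in> ball 0 R \<and> y \<in> ?l")
      case False
      have "\<bar>(indicator ?S (y - s *\<^sub>R b) - indicator ?S y) * w y\<bar> = (0::real)"
      proof (cases "y \<in> ball 0 R")
        case True
        then have "\<not> \<bar>height y\<bar> \<le> ?M * s" using False by (simp add: layer_def)
        moreover have "\<bar>height y - height (y - s *\<^sub>R b)\<bar> \<le> ?M * s"
          using height_lipschitz[of y "y - s *\<^sub>R b"] s(1) b by (simp add: dist_norm)
        ultimately have "height y > 0 \<longleftrightarrow> height (y - s *\<^sub>R b) > 0" by linarith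
        then show ?thesis by (simp add: subgraph_eq indicator_def)
      qed (use test_function_zero[OF w] in auto)
      moreover have "0 \<le> ?h y"
        using \<tau> B(1) M L_nonneg s(1) by (intro add_nonneg_nonneg mult_nonneg_nonneg) auto
      ultimately show ?thesis by (simp only:)
    next
      case True
      have "\<bar>(indicator ?S (y - s *\<^sub>R b) - indicator ?S y) * w y\<bar> \<le> \<bar>w y\<bar>"
        by (auto simp: indicator_def)
      also have "\<dots> \<le> \<tau> + (w y)\<^sup>2 / \<tau>"
      proof -
        have "0 \<le> (\<tau> - \<bar>w y\<bar>)\<^sup>2 + \<tau> * \<bar>w y\<bar>" using \<tau> by (intro add_nonneg_nonneg) auto
        then have "\<tau> * \<bar>w y\<bar> \<le> \<tau>\<^sup>2 + (w y)\<^sup>2" by (simp add: power2_diff)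
        then show ?thesis using \<tau> by (simp add: field_simps power2_eq_square)
      qed
      also have "(w y)\<^sup>2 \<le> (w (foot y))\<^sup>2 + B * (?M * s)"
      proof -
        have "\<bar>w (foot y) * w (foot y) - w y * w y\<bar> \<le> B * \<bar>height y\<bar>"
          unfolding foot_def by (rule B(2))
        also have "\<dots> \<le> B * (?M * s)" using True B(1) by (intro mult_left_mono) (auto simp: layer_def)
        finally show ?thesis by (simp add: power2_eq_square)
      qed
      finally show ?thesis using True \<tau> by (simp add: divide_right_mono)
    qed
    have "\<bar>LINT y|lborel. (indicator ?S (y - s *\<^sub>R b) - indicator ?S y) * w y\<bar> \<le>
        (LINT y|lborel. \<bar>(indicator ?S (y - s *\<^sub>R b) - indicator ?S y) * w y\<bar>)"
      by (rule integral_abs_bound)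
    also have "\<dots> \<le> (LINT y|lborel. ?h y)"
    proof (rule integral_mono[OF _ hi pointwise])
      show "integrable lborel (\<lambda>y. \<bar>(indicator ?S (y - s *\<^sub>R b) - indicator ?S y) * w y\<bar>)"
        by (rule Bochner_Integration.integrable_bound[OF wi]) (auto simp: indicator_def)
    qed
    also have "\<dots> = \<tau> * (LINT y|lborel. indicator (?l \<inter> ball 0 R) y) + (1 / \<tau>) *
        ((LINT y|lborel. indicator ?l y * (w (foot y))\<^sup>2) + B * (?M * s) * (LINT y|lborel. indicator (?l \<inter> ball 0 R) y))"
      using lb foot_i by (simp del: integral_indicator)
    also have "\<dots> \<le> \<tau> * (s * ?V) + (1 / \<tau>) * (?K * s * x + B * (?M * s) * (s * ?V))"
      using \<tau> B(1) M s(1) vol foot_le by (intro add_mono mult_left_mono) auto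
    finally have le: "\<bar>LINT y|lborel. (indicator ?S (y - s *\<^sub>R b) - indicator ?S y) * w y\<bar> \<le>
        \<tau> * (s * ?V) + (1 / \<tau>) * (?K * s * x + B * (?M * s) * (s * ?V))" .
    have "\<bar>?a k\<bar> = real (Suc k) * \<bar>LINT y|lborel. (indicator ?S (y - s *\<^sub>R b) - indicator ?S y) * w y\<bar>"
      unfolding s_def[symmetric] shift by (simp only: abs_mult abs_of_nat)
    also have "\<dots> \<le> real (Suc k) * (\<tau> * (s * ?V) + (1 / \<tau>) * (?K * s * x + B * (?M * s) * (s * ?V)))"
      by (rule mult_left_mono[OF le]) simp
    also have "\<dots> = (real (Suc k) * s) * (\<tau> * ?V + (?K * x + s * (B * ?M * ?V)) / \<tau>)"
      using \<tau> by (simp add: field_simps)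
    finally show ?thesis using s by (simp add: s_def)
  qed
  have lim2: "(\<lambda>k. \<tau> * ?V + (?K * x + inverse (real (Suc k)) * (B * ?M * ?V)) / \<tau>) \<longlonglongrightarrow>
      \<tau> * ?V + (?K * x + 0 * (B * ?M * ?V)) / \<tau>"
    using \<tau> by (intro tendsto_intros LIMSEQ_inverse_real_of_nat) auto
  show ?thesis
    using LIMSEQ_le[OF tendsto_rabs[OF lim] lim2] bound by auto
qed

end

section \<open>Weak derivatives across a closed set of surface measure zero\<close>

text \<open>That this pairing vanishes for every test function \<open>\<eta>\<close> means that \<open>g\<close> is the weak derivative of \<open>f\<close> in
  the direction \<open>b\<close>.\<close>

definition weak_pairing :: "'a::euclidean_space set \<Rightarrow> ('a \<Rightarrow> real) \<Rightarrow> ('a \<Rightarrow> real) \<Rightarrow> 'a \<Rightarrow> ('a \<Rightarrow> real) \<Rightarrow> real" where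
  "weak_pairing U f g b \<eta> = (LINT x|lebesgue_on U. f x * dir_deriv \<eta> b x + g x * \<eta> x)"

definition weak_deriv_near :: "'a::euclidean_space set \<Rightarrow> ('a \<Rightarrow> real) \<Rightarrow> ('a \<Rightarrow> real) \<Rightarrow> 'a \<Rightarrow> 'a \<Rightarrow> bool" where
  "weak_deriv_near U f g b x \<longleftrightarrow>
     (\<exists>r>0. \<forall>\<eta>. test_function (ball x r) \<eta> \<longrightarrow> test_function U \<eta> \<longrightarrow> weak_pairing U f g b \<eta> = 0)"

lemma open_weak_deriv_near: "open {x. weak_deriv_near U f g b x}"
proof (rule openI)
  fix x assume "x \<in> {x. weak_deriv_near U f g b x}"
  then obtain r where r: "r > 0"
    "\<And>\<eta>. test_function (ball x r) \<eta> \<Longrightarrow> test_function U \<eta> \<Longrightarrow> weak_pairing U f g b \<eta> = 0"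
    by (auto simp: weak_deriv_near_def)
  have "weak_deriv_near U f g b y" if y: "y \<in> ball x r" for y
  proof -
    have "ball y (r - dist x y) \<subseteq> ball x r" 
    proof
      fix z assume "z \<in> ball y (r - dist x y)"
      then show "z \<in> ball x r" using dist_triangle[of x z y] by simp
    qed
    then show ?thesis
      unfolding weak_deriv_near_def using y r(2)[OF test_function_mono]
      by (intro exI[of _ "r - dist x y"]) auto
  qed
  then show "\<exists>e>0. ball x e \<subseteq> {x. weak_deriv_near U f g b x}" using r(1) by auto
qed

context
  fixes U :: "'a::euclidean_space set" and f g :: "'a \<Rightarrow> real" and b :: 'a
  assumes U: "open U" and f: "f \<in> L2 U" and g: "g \<in> L2 U" and b: "b \<in> Basis"
begin

lemma weak_pairing_L2:
  assumes "test_function U \<eta>"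
  shows "(\<lambda>x. f x * dir_deriv \<eta> b x + g x * \<eta> x) \<in> L2 U"
proof -
  obtain M where M: "\<And>x. \<bar>\<eta> x\<bar> \<le> M" using test_function_bounded assms by metis
  obtain M' where M': "\<And>x. \<bar>dir_deriv \<eta> b x\<bar> \<le> M'"
    using test_function_bounded[OF test_function_dir_deriv[OF assms b]] by metis
  show ?thesis
    using test_function_smooth[OF assms] b
    by (intro L2_add L2_mult_bounded[OF f _ M'] L2_mult_bounded[OF g _ M] smooth_measurable smooth_dir_deriv)
qed

lemma weak_pairing_integrable:
  assumes "test_function U \<eta>"
  shows "integrable (lebesgue_on U) (\<lambda>x. f x * dir_deriv \<eta> b x + g x * \<eta> x)"
  using f g b U test_function_L2[OF assms] test_function_L2[OF test_function_dir_deriv[OF assms]]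
  by (intro Bochner_Integration.integrable_add L2_mult_integrable) (auto simp: open_lebesgue)

lemma weak_pairing_sum:
  assumes "finite I" "\<And>i. i \<in> I \<Longrightarrow> test_function U (\<eta> i)"
  shows "test_function U (\<lambda>x. \<Sum>i\<in>I. \<eta> i x) \<and>
    weak_pairing U f g b (\<lambda>x. \<Sum>i\<in>I. \<eta> i x) = (\<Sum>i\<in>I. weak_pairing U f g b (\<eta> i))"
  using assms
proof (induction I rule: finite_induct)
  case empty
  have "dir_deriv (\<lambda>x::'a. 0::real) b x = 0" for x by (rule dir_deriv_eq) simp
  then show ?case
    by (auto simp: weak_pairing_def intro!: test_functionI[of _ "{}"] smooth_const)
next
  case (insert i I)
  let ?s = "\<lambda>x. \<Sum>i\<in>I. \<eta> i x"
  have t: "test_function U (\<eta> i)" "test_function U ?s"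
    and eq: "weak_pairing U f g b ?s = (\<Sum>i\<in>I. weak_pairing U f g b (\<eta> i))"
    using insert by auto
  obtain K where K: "compact K" "K \<subseteq> U" "\<And>x. x \<notin> K \<Longrightarrow> \<eta> i x = 0"
    by (rule test_functionE[OF t(1)]) (rule that)
  obtain K' where K': "compact K'" "K' \<subseteq> U" "\<And>x. x \<notin> K' \<Longrightarrow> ?s x = 0"
    by (rule test_functionE[OF t(2)]) (rule that)
  have sm: "smooth (\<eta> i)" "smooth ?s" using t by (auto intro: test_function_smooth)
  have "test_function U (\<lambda>x. \<eta> i x + ?s x)"
    by (rule test_functionI[of _ "K \<union> K'"]) (use K K' sm in \<open>auto intro: smooth_add\<close>)
  moreover have "dir_deriv (\<lambda>x. \<eta> i x + ?s x) b x = dir_deriv (\<eta> i) b x + dir_deriv ?s b x" for x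
    by (rule dir_deriv_eq) (intro has_derivative_add smooth_has_derivative sm)
  then have "weak_pairing U f g b (\<lambda>x. \<eta> i x + ?s x) = weak_pairing U f g b (\<eta> i) + weak_pairing U f g b ?s"
    unfolding weak_pairing_def using weak_pairing_integrable[OF t(1)] weak_pairing_integrable[OF t(2)]
    by (subst Bochner_Integration.integral_add[symmetric]) (auto simp: algebra_simps intro!: Bochner_Integration.integral_cong)
  ultimately show ?case using insert.hyps eq by simp
qed

text \<open>Partition of unity: the box bumps \<open>\<theta>\<^sub>i\<close> of a finite cover have a sum \<open>S \<ge> \<delta>\<close> on the support
  of \<open>\<eta>\<close>, and \<open>S + h (\<delta> - S)\<close>, for the flat function \<open>h\<close>, is positive everywhere and equal to \<open>S\<close>
  there.\<close>

lemma weak_pairing_zero_if_near_support: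
  assumes \<eta>: "test_function U \<eta>" and K: "K = closure {x. \<eta> x \<noteq> 0}"
    and near: "\<And>x. x \<in> K \<Longrightarrow> weak_deriv_near U f g b x"
  shows "weak_pairing U f g b \<eta> = 0"
proof (cases "K = {}")
  case True
  then have "\<eta> = (\<lambda>x. 0)" using K closure_subset[of "{x. \<eta> x \<noteq> 0}"] by auto
  then show ?thesis using weak_pairing_sum[of "{}"] by simp
next
  case False
  have cK: "compact K" "\<And>x. x \<notin> K \<Longrightarrow> \<eta> x = 0"
    using \<eta> K closure_subset[of "{x. \<eta> x \<noteq> 0}"] by (auto simp: test_function_def)
  have "\<exists>a c r. x \<in> box a c \<and> cbox a c \<subseteq> ball x r \<and>
      (\<forall>\<eta>. test_function (ball x r) \<eta> \<longrightarrow> test_function U \<eta> \<longrightarrow> weak_pairing U f g b \<eta> = 0)"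
    if "x \<in> K" for x
  proof -
    obtain r where r: "r > 0" "\<forall>\<eta>. test_function (ball x r) \<eta> \<longrightarrow> test_function U \<eta> \<longrightarrow> weak_pairing U f g b \<eta> = 0"
      using near[OF \<open>x \<in> K\<close>] by (auto simp: weak_deriv_near_def)
    obtain a c where "cbox a c \<subseteq> ball x r" "x \<in> box a c"
      using open_contains_cbox[of "ball x r"] r(1) by (metis centre_in_ball open_ball)
    then show ?thesis using r by blast
  qed
  then obtain a c r where acr: "\<And>x. x \<in> K \<Longrightarrow> x \<in> box (a x) (c x)" "\<And>x. x \<in> K \<Longrightarrow> cbox (a x) (c x) \<subseteq> ball x (r x)"
      "\<And>x \<eta>. x \<in> K \<Longrightarrow> test_function (ball x (r x)) \<eta> \<Longrightarrow> test_function U \<eta> \<Longrightarrow> weak_pairing U f g b \<eta> = 0"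
    by metis
  obtain X where X: "finite X" "X \<subseteq> K" "K \<subseteq> (\<Union>x\<in>X. box (a x) (c x))"
  proof -
    have "K \<subseteq> (\<Union>x\<in>K. box (a x) (c x))" using acr(1) by blast
    then obtain X where "X \<subseteq> K" "finite X" "K \<subseteq> (\<Union>x\<in>X. box (a x) (c x))"
      by (rule compactE_image[OF cK(1) open_box])
    then show thesis by (intro that)
  qed
  define S where "S y = (\<Sum>x\<in>X. box_bump (a x) (c x) y)" for y
  have S: "smooth S" unfolding S_def by (intro smooth_sum smooth_box_bump)
  have S0: "S y \<ge> 0" for y unfolding S_def by (intro sum_nonneg box_bump_nonneg)
  have Spos: "S y > 0" if "y \<in> K" for y
  proof -
    obtain x where "x \<in> X" "y \<in> box (a x) (c x)" using subsetD[OF X(3) \<open>y \<in> K\<close>] by blast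
    then show ?thesis unfolding S_def using X(1)
      by (intro sum_pos2[of _ x]) (auto simp: box_bump_nonneg box_bump_pos_iff)
  qed
  obtain y0 where y0: "y0 \<in> K" "\<And>y. y \<in> K \<Longrightarrow> S y0 \<le> S y"
    using continuous_attains_inf[OF cK(1) False smooth_continuous[OF S]] by auto
  define q where "q y = inverse (S y + flat 0 (S y0 - S y))" for y
  have den: "S y + flat 0 (S y0 - S y) \<noteq> 0" for y
  proof (cases "S y = 0")
    case True
    then show ?thesis using Spos[OF y0(1)] by (simp add: flat0)
  next
    case False
    then have "S y > 0" using S0[of y] by simp
    then show ?thesis using flat0(1)[of "S y0 - S y"] by linarith
  qed
  have q: "smooth q"
    unfolding q_def by (intro smooth_inverse smooth_add S smooth_compose[OF smooth_flat] smooth_diff smooth_const den)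
  let ?\<eta> = "\<lambda>x y. (q y * box_bump (a x) (c x) y) * \<eta> y"
  have t: "test_function U (?\<eta> x)" for x
    by (intro test_function_mult \<eta> smooth_mult q smooth_box_bump)
  have z: "weak_pairing U f g b (?\<eta> x) = 0" if x: "x \<in> X" for x
  proof (rule acr(3)[OF _ _ t])
    show "x \<in> K" using x X by auto
    show "test_function (ball x (r x)) (?\<eta> x)"
    proof (rule test_functionI[of _ "cbox (a x) (c x)"])
      show "cbox (a x) (c x) \<subseteq> ball x (r x)" using acr(2) x X by auto
      show "smooth (?\<eta> x)" by (rule test_function_smooth[OF t])
      show "?\<eta> x y = 0" if "y \<notin> cbox (a x) (c x)" for y
        using that box_subset_cbox[of "a x" "c x"] box_bump_eq_0_iff[of "a x" "c x" y] by auto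
    qed simp
  qed
  have "\<eta> = (\<lambda>y. \<Sum>x\<in>X. ?\<eta> x y)"
  proof
    fix y
    have "(\<Sum>x\<in>X. ?\<eta> x y) = q y * S y * \<eta> y"
      by (simp add: S_def sum_distrib_left sum_distrib_right mult.assoc)
    also have "\<dots> = \<eta> y"
    proof (cases "y \<in> K")
      case True
      then have "flat 0 (S y0 - S y) = 0" using y0(2)[OF True] by (simp add: flat0)
      then show ?thesis using Spos[OF True] by (simp add: q_def)
    qed (simp add: cK)
    finally show "\<eta> y = (\<Sum>x\<in>X. ?\<eta> x y)" by simp
  qed
  then have "weak_pairing U f g b \<eta> = weak_pairing U f g b (\<lambda>y. \<Sum>x\<in>X. ?\<eta> x y)" by simp
  also have "\<dots> = (\<Sum>x\<in>X. weak_pairing U f g b (?\<eta> x))"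
    using weak_pairing_sum[of X ?\<eta>, OF X(1) t] by blast
  also have "\<dots> = 0" using z by simp
  finally show ?thesis .
qed

text \<open>A compact set of vanishing surface measure is covered by cylinders parallel to \<open>b\<close> of small
  total volume. A cutoff that is constant along \<open>b\<close> has no derivative in the direction of \<open>b\<close>, so
  that cutting these cylinders out of a test function produces no error term with the product of \<open>f\<close>
  and a derivative of the cutoff. For a merely square-integrable \<open>f\<close> such a term would not be small.\<close>

lemma weak_pairing_cut_out:
  assumes \<eta>: "test_function U \<eta>" and K: "K = closure {x. \<eta> x \<noteq> 0}"
    and I: "finite I" and cov: "K - {x. weak_deriv_near U f g b x} \<subseteq> (\<Union>i\<in>I. ball (p i) (r i))"
    and r: "\<And>i. i \<in> I \<Longrightarrow> 0 < r i"
  shows "(LINT x|lebesgue_on U. indicator (- (\<Union>i\<in>I. {y. norm (perp b (y - p i)) \<le> r i})) x *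
      (f x * dir_deriv \<eta> b x + g x * \<eta> x)) = 0"
proof -
  let ?W = "\<lambda>x. f x * dir_deriv \<eta> b x + g x * \<eta> x"
  let ?Z = "\<Union>i\<in>I. {y. norm (perp b (y - p i)) \<le> r i}"
  have b1: "norm b = 1" using b by simp
  \<comment> \<open>A smooth function that vanishes exactly on the closed cylinders and is invariant along \<open>b\<close>.\<close>
  define \<theta> where "\<theta> y = (\<Prod>i\<in>I. flat 0 ((norm (perp b (y - p i)))\<^sup>2 - (r i)\<^sup>2))" for y
  have norm_perp: "(norm (perp b y))\<^sup>2 = (\<Sum>b'\<in>Basis. (y \<bullet> b') * (y \<bullet> b')) - (y \<bullet> b) * (y \<bullet> b)" for y
  proof -
    have "b \<bullet> b = 1" using b1 by (simp add: norm_eq_1)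
    then have "(norm (perp b y))\<^sup>2 = y \<bullet> y - (y \<bullet> b) * (y \<bullet> b)"
      unfolding perp_def power2_norm_eq_inner
      by (simp add: inner_diff_left inner_diff_right inner_commute)
    then show ?thesis by (simp only: euclidean_inner[of y y])
  qed
  have sm_inner: "smooth (\<lambda>y. (y - p i) \<bullet> b')" for i b'
    unfolding inner_diff_left by (intro smooth_diff smooth_inner smooth_const)
  have \<theta>s: "smooth \<theta>"
    unfolding \<theta>_def norm_perp
    by (intro smooth_prod smooth_compose[OF smooth_flat] smooth_diff smooth_sum smooth_mult sm_inner smooth_const)
  have \<theta>0: "\<theta> y \<ge> 0" for y unfolding \<theta>_def by (intro prod_nonneg ballI flat0)
  have \<theta>_zero: "\<theta> y = 0 \<longleftrightarrow> y \<in> ?Z" for y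
  proof -
    have "(norm (perp b (y - p i)))\<^sup>2 - (r i)\<^sup>2 \<le> 0 \<longleftrightarrow> norm (perp b (y - p i)) \<le> r i" if "i \<in> I" for i
      using r[OF that] abs_le_square_iff[of "norm (perp b (y - p i))" "r i"] by simp
    then show ?thesis unfolding \<theta>_def using I by (auto simp: flat0)
  qed
  have \<theta>_inv: "\<theta> (y + t *\<^sub>R b) = \<theta> y" for y t
  proof -
    have "perp b (y + t *\<^sub>R b - p i) = perp b (y - p i)" for i
      using perp_add_direction[OF b1, of "y - p i" t] by (simp add: algebra_simps)
    then show ?thesis by (simp add: \<theta>_def)
  qed
  define q where "q m y = 1 - exp (- (real m * \<theta> y))" for m y
  have qs: "smooth (q m)" for m
  proof -
    have "smooth (\<lambda>y. 1 - exp ((- real m) * \<theta> y))"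
      by (intro smooth_diff smooth_const smooth_compose[OF smooth_exp] smooth_mult \<theta>s)
    then show ?thesis by (simp add: q_def[abs_def])
  qed
  have q_deriv: "dir_deriv (q m) b y = 0" for m y
  proof -
    have "((\<lambda>t. q m (y + t *\<^sub>R b)) has_real_derivative dir_deriv (q m) b (y + 0 *\<^sub>R b)) (at 0)"
      by (rule smooth_line_derivative[OF qs])
    moreover have "((\<lambda>t. q m (y + t *\<^sub>R b)) has_real_derivative 0) (at 0)"
      by (simp add: q_def \<theta>_inv)
    ultimately show ?thesis using DERIV_unique by fastforce
  qed
  have zero: "(LINT x|lebesgue_on U. q m x * ?W x) = 0" for m
  proof -
    let ?\<eta> = "\<lambda>x. q m x * \<eta> x"
    have t: "test_function U ?\<eta>" by (rule test_function_mult[OF \<eta> qs])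
    have "closure {x. ?\<eta> x \<noteq> 0} \<subseteq> K - (\<Union>i\<in>I. ball (p i) (r i))"
    proof (rule closure_minimal)
      show "{x. ?\<eta> x \<noteq> 0} \<subseteq> K - (\<Union>i\<in>I. ball (p i) (r i))"
      proof
        fix x assume x: "x \<in> {x. ?\<eta> x \<noteq> 0}"
        then have "x \<in> K" using closure_subset[of "{x. \<eta> x \<noteq> 0}"] by (auto simp: K)
        moreover have "x \<notin> ball (p i) (r i)" if i: "i \<in> I" for i
        proof
          assume "x \<in> ball (p i) (r i)"
          then have "norm (perp b (x - p i)) \<le> r i"
            using norm_perp_le[OF b1, of "x - p i"] by (simp add: dist_norm norm_minus_commute)
          then have "\<theta> x = 0" unfolding \<theta>_zero using i by blast
          then show False using x by (simp add: q_def)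
        qed
        ultimately show "x \<in> K - (\<Union>i\<in>I. ball (p i) (r i))" by blast
      qed
      show "closed (K - (\<Union>i\<in>I. ball (p i) (r i)))"
        unfolding K by (intro closed_Diff closed_closure open_UN ballI open_ball)
    qed
    then have "weak_pairing U f g b ?\<eta> = 0"
      using cov by (intro weak_pairing_zero_if_near_support[OF t refl]) blast
    moreover have "dir_deriv ?\<eta> b x = q m x * dir_deriv \<eta> b x" for x
      by (simp add: dir_deriv_mult[OF qs test_function_smooth[OF \<eta>]] q_deriv)
    ultimately show ?thesis by (simp add: weak_pairing_def algebra_simps)
  qed
  have lim: "(\<lambda>m. q m x) \<longlonglongrightarrow> indicator (- ?Z) x" for x
  proof (cases "x \<in> ?Z")
    case True
    then have "\<theta> x = 0" by (simp only: \<theta>_zero)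
    then show ?thesis using True by (simp add: q_def)
  next
    case False
    then have "\<theta> x > 0" using \<theta>0[of x] \<theta>_zero[of x] by linarith
    then have "exp (- \<theta> x) < 1" by simp
    then have "(\<lambda>m. 1 - exp (- \<theta> x) ^ m) \<longlonglongrightarrow> 1 - 0"
      by (intro tendsto_intros LIMSEQ_power_zero) simp
    then show ?thesis using False by (simp add: q_def exp_of_nat_mult[symmetric])
  qed
  have bnd: "\<bar>q m x\<bar> \<le> 1" for m x using \<theta>0[of x] by (simp add: q_def)
  have Wi: "integrable (lebesgue_on U) ?W" by (rule weak_pairing_integrable[OF \<eta>])
  have qm: "q m \<in> borel_measurable (lebesgue_on U)" for m
    using smooth_measurable[OF qs] by (simp add: measurable_completion measurable_restrict_space1)
  have Wm: "?W \<in> borel_measurable (lebesgue_on U)" using Wi by simp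
  have "(\<lambda>m. LINT x|lebesgue_on U. q m x * ?W x) \<longlonglongrightarrow> (LINT x|lebesgue_on U. indicator (- ?Z) x * ?W x)"
  proof (rule integral_dominated_convergence[where w="\<lambda>x. \<bar>?W x\<bar>"])
    show "(\<lambda>x. q m x * ?W x) \<in> borel_measurable (lebesgue_on U)" for m using qm Wm by (rule borel_measurable_times)
    show lim': "AE x in lebesgue_on U. (\<lambda>m. q m x * ?W x) \<longlonglongrightarrow> indicator (- ?Z) x * ?W x"
      by (intro always_eventually allI tendsto_mult lim tendsto_const)
    have "(\<lambda>x. indicator (- ?Z) x * ?W x) \<in> borel_measurable (lebesgue_on U)"
      by (rule borel_measurable_LIMSEQ_real[of _ "\<lambda>m x. q m x * ?W x"])
        (intro tendsto_mult lim tendsto_const borel_measurable_times qm Wm)+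
    then show "(\<lambda>x. indicator (- ?Z) x * ?W x) \<in> borel_measurable (lebesgue_on U)" .
    show "AE x in lebesgue_on U. norm (q m x * ?W x) \<le> \<bar>?W x\<bar>" for m
      using bnd by (intro always_eventually allI) (simp add: abs_mult mult_left_le_one_le)
  qed (use Wi in auto)
  then show ?thesis using zero by (simp add: LIMSEQ_const_iff)
qed

text \<open>By the previous lemma the pairing equals an integral over the cylinders, whose volume is at most a
  multiple of \<open>\<epsilon>\<close>.\<close>

lemma weak_pairing_zero_if_near_surface_ae:
  assumes dim: "2 \<le> DIM('a)" and \<eta>: "test_function U \<eta>"
    and null: "hausdorff_outer (real DIM('a) - 1) (U - {x. weak_deriv_near U f g b x}) = 0"
  shows "weak_pairing U f g b \<eta> = 0"
proof -
  let ?W = "\<lambda>x. f x * dir_deriv \<eta> b x + g x * \<eta> x"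
  let ?N = "DIM('a) - 1"
  define K where "K = closure {x. \<eta> x \<noteq> 0}"
  have K: "compact K" "K \<subseteq> U" "\<And>x. x \<notin> K \<Longrightarrow> \<eta> x = 0"
    using \<eta> closure_subset[of "{x. \<eta> x \<noteq> 0}"] by (auto simp: test_function_def K_def)
  obtain R where R: "0 < R" "\<And>x. x \<in> K \<Longrightarrow> norm x \<le> R"
    using compact_imp_bounded[OF K(1)] bounded_pos by blast
  let ?K' = "K - {x. weak_deriv_near U f g b x}"
  have K': "compact ?K'" using K(1) open_weak_deriv_near by (rule compact_diff)
  have "hausdorff_outer (real DIM('a) - 1) ?K' \<le> 0"
    using hausdorff_outer_mono[of ?K' "U - {x. weak_deriv_near U f g b x}"] null K(2) by (metis Diff_mono order_refl)
  then have H0: "hausdorff_outer (real DIM('a) - 1) ?K' = 0" by simp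
  define C where "C = 4 ^ DIM('a) * (2 * R + 3)"
  have C: "C > 0" using R by (simp add: C_def)
  have Wi: "integrable (lebesgue_on U) ?W" by (rule weak_pairing_integrable[OF \<eta>])
  have W2: "integrable (lebesgue_on U) (\<lambda>x. (?W x)\<^sup>2)" by (rule L2_integrable[OF weak_pairing_L2[OF \<eta>]])
  have "test_function K \<eta>" using \<eta> by (simp add: test_function_def K_def)
  then have W0: "?W x = 0" if "x \<notin> K" for x
    using that by (simp add: test_function_zero test_function_zero[OF test_function_dir_deriv[OF _ b]])
  have main: "\<bar>weak_pairing U f g b \<eta>\<bar> \<le> \<tau> * (LINT x|lebesgue_on U. (?W x)\<^sup>2) + C * \<epsilon> / \<tau>"
    if \<tau>: "0 < \<tau>" and \<epsilon>: "0 < \<epsilon>" for \<tau> \<epsilon>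
  proof -
    obtain p r where cov: "?K' \<subseteq> (\<Union>i. ball (p i) (r i))" and r: "\<And>i::nat. 0 < r i" "\<And>i. r i \<le> 1"
      and sum: "(\<Sum>i. ennreal (r i ^ ?N)) \<le> ennreal \<epsilon>"
      using ball_cover[OF dim, of ?K' 1 \<epsilon>] H0 \<epsilon> by auto
    obtain I where I: "finite I" "?K' \<subseteq> (\<Union>i\<in>I. ball (p i) (r i))"
      using compactE_image[OF K', of UNIV "\<lambda>i. ball (p i) (r i)"] cov by (metis open_ball)
    let ?Z = "\<Union>i\<in>I. {y. norm (perp b (y - p i)) \<le> r i}"
    \<comment> \<open>Centring the cylinders on the hyperplane \<open>x \<bullet> b = 0\<close> makes the half-height \<open>R\<close> sufficient for the
      support of \<open>\<eta>\<close>, wherever the \<open>p i\<close> lie.\<close>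
    let ?A = "\<Union>i\<in>I. cylinder b (perp b (p i)) (r i) R"
    have cut: "(LINT x|lebesgue_on U. indicator (- ?Z) x * ?W x) = 0"
      using weak_pairing_cut_out[OF \<eta> K_def I] r by blast
    have perp2: "perp b (y - perp b (p i)) = perp b (y - p i)" "(y - perp b (p i)) \<bullet> b = y \<bullet> b" for y i
      using b by (simp_all add: perp_def inner_diff_left algebra_simps)
    have AZ: "indicator ?A x * ?W x = indicator ?Z x * ?W x" for x
    proof (cases "x \<in> K")
      case True
      then have "\<bar>x \<bullet> b\<bar> \<le> R" using R(2) Basis_le_norm[OF b, of x] by (meson order_trans)
      then have "x \<in> ?A \<longleftrightarrow> x \<in> ?Z" by (simp add: cylinder_def perp2)
      then show ?thesis by (simp add: indicator_def)
    qed (simp add: W0)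
    have Am: "?A \<in> sets borel"
      using I(1) by (intro sets.finite_UN borel_closed closed_cylinder)
    have AU: "?A \<inter> U \<in> sets (lebesgue_on U)"
      using Am open_lebesgue[OF U] by (subst sets_restrict_space_iff) auto
    have split: "?W x = indicator (- ?Z) x * ?W x + indicator (?A \<inter> U) x * ?W x" if "x \<in> U" for x
    proof -
      have "indicator (?A \<inter> U) x * ?W x = indicator ?Z x * ?W x"
        using that AZ[of x] by (simp only: indicator_inter_arith indicator_simps mult_1_right)
      then show ?thesis by (simp only: indicator_compl left_diff_distrib) simp
    qed
    have "weak_pairing U f g b \<eta> = (LINT x|lebesgue_on U. indicator (- ?Z) x * ?W x + indicator (?A \<inter> U) x * ?W x)"
      unfolding weak_pairing_def
      by (intro Bochner_Integration.integral_cong refl split) (simp add: space_restrict_space)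
    also have "\<dots> = (LINT x|lebesgue_on U. indicator (- ?Z) x * ?W x) + (LINT x|lebesgue_on U. indicator (?A \<inter> U) x * ?W x)"
    proof (rule Bochner_Integration.integral_add)
      have i: "integrable (lebesgue_on U) (\<lambda>x. indicator (?A \<inter> U) x *\<^sub>R ?W x)"
        by (rule integrable_mult_indicator[OF AU Wi])
      then show "integrable (lebesgue_on U) (\<lambda>x. indicator (?A \<inter> U) x * ?W x)" by simp
      have "integrable (lebesgue_on U) (\<lambda>x. ?W x - indicator (?A \<inter> U) x *\<^sub>R ?W x)"
        using Wi i by (rule Bochner_Integration.integrable_diff)
      moreover have "integrable (lebesgue_on U) (\<lambda>x. ?W x - indicator (?A \<inter> U) x *\<^sub>R ?W x) \<longleftrightarrow>
          integrable (lebesgue_on U) (\<lambda>x. indicator (- ?Z) x * ?W x)"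
      proof (rule Bochner_Integration.integrable_cong[OF refl])
        fix x assume "x \<in> space (lebesgue_on U)"
        then have "x \<in> U" by (simp add: space_restrict_space)
        from split[OF this] show "?W x - indicator (?A \<inter> U) x *\<^sub>R ?W x = indicator (- ?Z) x * ?W x"
          unfolding real_scaleR_def by linarith
      qed
      ultimately show "integrable (lebesgue_on U) (\<lambda>x. indicator (- ?Z) x * ?W x)" by simp
    qed
    finally have eq: "weak_pairing U f g b \<eta> = (LINT x|lebesgue_on U. indicator (?A \<inter> U) x * ?W x)"
      using cut by simp
    have "emeasure lborel ?A \<le> (\<Sum>i\<in>I. emeasure lborel (cylinder b (perp b (p i)) (r i) R))"
      using I(1) by (intro emeasure_subadditive_finite) (auto intro!: borel_closed closed_cylinder)
    also have "\<dots> \<le> (\<Sum>i\<in>I. ennreal C * ennreal (r i ^ ?N))"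
    proof (rule sum_mono)
      fix i
      have "emeasure lborel (cylinder b (perp b (p i)) (r i) R) \<le> ennreal (4 ^ DIM('a) * r i ^ ?N * (2 * R + 3 * r i))"
        using r[of i] R b by (intro emeasure_cylinder_le) auto
      also have "\<dots> \<le> ennreal (4 ^ DIM('a) * r i ^ ?N * (2 * R + 3))"
        using r[of i] by (intro ennreal_leI mult_left_mono) auto
      also have "\<dots> = ennreal (C * r i ^ ?N)" by (simp add: C_def mult_ac)
      also have "\<dots> = ennreal C * ennreal (r i ^ ?N)" using C r[of i] by (intro ennreal_mult) auto
      finally show "emeasure lborel (cylinder b (perp b (p i)) (r i) R) \<le> ennreal C * ennreal (r i ^ ?N)" .
    qed
    also have "\<dots> = ennreal C * (\<Sum>i\<in>I. ennreal (r i ^ ?N))" by (simp add: sum_distrib_left)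
    also have "\<dots> \<le> ennreal C * (\<Sum>i. ennreal (r i ^ ?N))"
      using I(1) by (intro mult_left_mono sum_le_suminf) auto
    also have "\<dots> \<le> ennreal C * ennreal \<epsilon>" by (rule mult_left_mono[OF sum]) simp
    also have "\<dots> = ennreal (C * \<epsilon>)" using C \<epsilon> by (simp add: ennreal_mult)
    finally have vol: "emeasure lborel ?A \<le> ennreal (C * \<epsilon>)" .
    have "emeasure (lebesgue_on U) (?A \<inter> U) = emeasure lebesgue (?A \<inter> U)"
      using U by (intro emeasure_restrict_space) (auto simp: open_lebesgue)
    also have "\<dots> \<le> emeasure lebesgue ?A" using Am by (intro emeasure_mono) auto
    also have "\<dots> \<le> ennreal (C * \<epsilon>)" using vol Am by simp
    finally have volU: "emeasure (lebesgue_on U) (?A \<inter> U) \<le> ennreal (C * \<epsilon>)" .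
    then have "measure (lebesgue_on U) (?A \<inter> U) \<le> C * \<epsilon>"
      using C \<epsilon> by (simp add: measure_def enn2real_leI)
    moreover have "emeasure (lebesgue_on U) (?A \<inter> U) < \<infinity>" using volU by (auto intro: order_le_less_trans)
    ultimately show ?thesis
      using lint_abs_le_square[OF Wi W2 AU _ \<tau>] \<tau> unfolding eq
      by (smt (verit) divide_right_mono infinity_ennreal_def)
  qed
  define J where "J = (LINT x|lebesgue_on U. (?W x)\<^sup>2)"
  have le: "\<bar>weak_pairing U f g b \<eta>\<bar> \<le> \<tau> * J + \<tau>" if "0 < \<tau>" for \<tau>
    using main[OF that, of "\<tau> * \<tau> / C"] C that by (simp add: J_def)
  have "((\<lambda>\<tau>. \<tau> * J + \<tau>) \<longlongrightarrow> 0 * J + 0) (at_right 0)" by (intro tendsto_intros)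
  moreover have "\<forall>\<^sub>F \<tau> in at_right 0. \<bar>weak_pairing U f g b \<eta>\<bar> \<le> \<tau> * J + \<tau>"
    using le by (auto simp: eventually_at_right_field intro: exI[of _ 1])
  ultimately have "\<bar>weak_pairing U f g b \<eta>\<bar> \<le> 0 * J + 0"
    by (rule tendsto_lowerbound) simp
  then show ?thesis by simp
qed

end

section \<open>Gluing two Sobolev functions along a Lipschitz interface\<close>

lemma L2_product_tendsto_zero:
  fixes F :: "nat \<Rightarrow> 'a::euclidean_space \<Rightarrow> real"
  assumes F: "\<And>k. F k \<in> L2 U" and g: "g \<in> L2 U"
    and lim: "(\<lambda>k. LINT x|lebesgue_on U. (F k x)\<^sup>2) \<longlonglongrightarrow> 0"
  shows "(\<lambda>k. LINT x|lebesgue_on U. F k x * g x) \<longlonglongrightarrow> 0"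
proof (rule LIMSEQ_I)
  fix e :: real assume e: "0 < e"
  let ?G = "LINT x|lebesgue_on U. (g x)\<^sup>2"
  have G: "?G \<ge> 0" by simp
  define \<tau> where "\<tau> = e / (2 * (?G + 1))"
  have "0 < 2 * (?G + 1)" by (intro mult_pos_pos add_nonneg_pos G) auto
  then have \<tau>: "0 < \<tau>" unfolding \<tau>_def by (rule divide_pos_pos[OF e])
  have "\<tau> * (2 * (?G + 1)) = e" using \<open>0 < 2 * (?G + 1)\<close> unfolding \<tau>_def by simp
  then have "2 * (\<tau> * ?G) + 2 * \<tau> = e" by (simp add: algebra_simps)
  then have \<tau>G: "\<tau> * ?G < e / 2" using \<tau> by linarith
  have bound: "\<bar>LINT x|lebesgue_on U. F k x * g x\<bar> \<le> \<tau> * ?G + (LINT x|lebesgue_on U. (F k x)\<^sup>2) / \<tau>" for k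
  proof -
    have "\<bar>LINT x|lebesgue_on U. F k x * g x\<bar> \<le> (LINT x|lebesgue_on U. \<bar>F k x * g x\<bar>)"
      by (rule integral_abs_bound)
    also have "\<dots> \<le> (LINT x|lebesgue_on U. \<tau> * (g x)\<^sup>2 + (F k x)\<^sup>2 / \<tau>)"
    proof (rule integral_mono)
      show "integrable (lebesgue_on U) (\<lambda>x. \<bar>F k x * g x\<bar>)" using L2_mult_integrable[OF F g] by simp
      show "integrable (lebesgue_on U) (\<lambda>x. \<tau> * (g x)\<^sup>2 + (F k x)\<^sup>2 / \<tau>)"
        using L2_integrable[OF F] L2_integrable[OF g] by simp
      fix x
      have "0 \<le> (\<tau> * \<bar>g x\<bar> - \<bar>F k x\<bar>)\<^sup>2 + \<tau> * (\<bar>g x\<bar> * \<bar>F k x\<bar>)"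
        using \<tau> by (intro add_nonneg_nonneg mult_nonneg_nonneg) auto
      then have "\<tau> * (\<bar>g x\<bar> * \<bar>F k x\<bar>) \<le> \<tau> * (\<tau> * (g x)\<^sup>2) + (F k x)\<^sup>2"
        by (simp add: power2_diff power_mult_distrib power2_eq_square algebra_simps)
      then show "\<bar>F k x * g x\<bar> \<le> \<tau> * (g x)\<^sup>2 + (F k x)\<^sup>2 / \<tau>"
        using \<tau> by (simp add: abs_mult field_simps)
    qed
    also have "\<dots> = \<tau> * ?G + (LINT x|lebesgue_on U. (F k x)\<^sup>2) / \<tau>"
      using L2_integrable[OF F] L2_integrable[OF g] by simp
    finally show ?thesis .
  qed
  have "\<forall>\<^sub>F k in sequentially. (LINT x|lebesgue_on U. (F k x)\<^sup>2) < \<tau> * (e / 2)"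
    using lim e \<tau> by (intro order_tendstoD(2)) auto
  then obtain N where N: "\<And>k. k \<ge> N \<Longrightarrow> (LINT x|lebesgue_on U. (F k x)\<^sup>2) < \<tau> * (e / 2)"
    by (auto simp: eventually_sequentially)
  have "norm ((LINT x|lebesgue_on U. F k x * g x) - 0) < e" if "k \<ge> N" for k
  proof -
    have "(LINT x|lebesgue_on U. (F k x)\<^sup>2) / \<tau> < e / 2" using N[OF that] \<tau> by (simp add: field_simps)
    then have "\<bar>LINT x|lebesgue_on U. F k x * g x\<bar> < e" using bound[of k] \<tau>G by linarith
    then show ?thesis by simp
  qed
  then show "\<exists>no. \<forall>n\<ge>no. norm ((LINT x|lebesgue_on U. F n x * g x) - 0) < e" by blast
qed

text \<open>Integration by parts holds for the smooth approximants, and the convergence in \<open>H\<^sup>1\<close> near \<open>x\<close> suffices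
  because \<open>\<eta>\<close> is supported there.\<close>

lemma trace_approximation_pairing:
  assumes U: "open U" and f: "f \<in> H1 U" and sm: "\<And>k. smooth (\<phi> k)" and \<eta>: "test_function (ball x r) \<eta>"
    and b: "b \<in> Basis" and lim: "(\<lambda>k::nat. H1_norm (U \<inter> ball x r) (\<lambda>y. \<phi> k y - f y)) \<longlonglongrightarrow> 0"
  shows "(\<lambda>k. LINT y|lebesgue_on U. dir_deriv (\<lambda>y. \<phi> k y * \<eta> y) b y) \<longlonglongrightarrow>
    (LINT y|lebesgue_on U. f y * dir_deriv \<eta> b y + (weak_gradient U f y \<bullet> b) * \<eta> y)"
proof -
  let ?V = "U \<inter> ball x r" let ?G = "weak_gradient U f"
  have V: "open ?V" "bounded ?V" using U by (simp_all add: open_Int bounded_Int)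
  have sets: "U \<in> sets lebesgue" "?V \<in> sets lebesgue" using U V by (auto intro: open_lebesgue)
  have GV: "has_weak_gradient ?V f ?G"
    by (rule has_weak_gradient_subset[OF H1_has_weak_gradient[OF f] Int_lower1 U V(1)])
  have dV: "has_weak_gradient ?V (\<lambda>y. \<phi> k y - f y) (\<lambda>y. gradient (\<phi> k) y - ?G y)" for k
    by (intro has_weak_gradient_diff smooth_has_weak_gradient sm V GV)
  have sq: "(\<lambda>k. (H1_norm ?V (\<lambda>y. \<phi> k y - f y))\<^sup>2) \<longlonglongrightarrow> 0"
    using tendsto_power[OF lim, of 2] by simp
  have le: "(LINT y|lebesgue_on ?V. (\<phi> k y - f y)\<^sup>2) \<le> (H1_norm ?V (\<lambda>y. \<phi> k y - f y))\<^sup>2"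
    "(LINT y|lebesgue_on ?V. ((gradient (\<phi> k) y - ?G y) \<bullet> b)\<^sup>2) \<le> (H1_norm ?V (\<lambda>y. \<phi> k y - f y))\<^sup>2" for k
  proof -
    show "(LINT y|lebesgue_on ?V. (\<phi> k y - f y)\<^sup>2) \<le> (H1_norm ?V (\<lambda>y. \<phi> k y - f y))\<^sup>2"
      unfolding H1_norm_square[OF dV V(1)] by (simp add: sum_nonneg)
    have "(LINT y|lebesgue_on ?V. ((gradient (\<phi> k) y - ?G y) \<bullet> b)\<^sup>2) \<le>
        (\<Sum>b\<in>Basis. LINT y|lebesgue_on ?V. ((gradient (\<phi> k) y - ?G y) \<bullet> b)\<^sup>2)"
      using b by (intro member_le_sum) auto
    also have "\<dots> \<le> (H1_norm ?V (\<lambda>y. \<phi> k y - f y))\<^sup>2"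
      unfolding H1_norm_square[OF dV V(1)] by simp
    finally show "(LINT y|lebesgue_on ?V. ((gradient (\<phi> k) y - ?G y) \<bullet> b)\<^sup>2) \<le> (H1_norm ?V (\<lambda>y. \<phi> k y - f y))\<^sup>2" .
  qed
  have z1: "(\<lambda>k. LINT y|lebesgue_on ?V. (\<phi> k y - f y)\<^sup>2) \<longlonglongrightarrow> 0"
    by (rule tendsto_sandwich[OF _ _ tendsto_const sq]) (auto intro!: always_eventually le)
  have z2: "(\<lambda>k. LINT y|lebesgue_on ?V. ((gradient (\<phi> k) y - ?G y) \<bullet> b)\<^sup>2) \<longlonglongrightarrow> 0"
    by (rule tendsto_sandwich[OF _ _ tendsto_const sq]) (auto intro!: always_eventually le)
  have tL: "\<eta> \<in> L2 ?V" "dir_deriv \<eta> b \<in> L2 ?V"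
    by (auto intro!: test_function_L2 test_function_dir_deriv \<eta> b sets)
  have p1: "(\<lambda>k. LINT y|lebesgue_on ?V. (\<phi> k y - f y) * dir_deriv \<eta> b y) \<longlonglongrightarrow> 0"
    by (rule L2_product_tendsto_zero[OF has_weak_gradient_L2[OF dV] tL(2) z1])
  have p2: "(\<lambda>k. LINT y|lebesgue_on ?V. ((gradient (\<phi> k) y - ?G y) \<bullet> b) * \<eta> y) \<longlonglongrightarrow> 0"
    by (rule L2_product_tendsto_zero[OF has_weak_gradient_component[OF dV b] tL(1) z2])
  let ?I = "LINT y|lebesgue_on ?V. f y * dir_deriv \<eta> b y + (?G y \<bullet> b) * \<eta> y"
  have eq: "(LINT y|lebesgue_on ?V. dir_deriv (\<lambda>y. \<phi> k y * \<eta> y) b y) =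
      ?I + ((LINT y|lebesgue_on ?V. (\<phi> k y - f y) * dir_deriv \<eta> b y)
        + (LINT y|lebesgue_on ?V. ((gradient (\<phi> k) y - ?G y) \<bullet> b) * \<eta> y))" for k
  proof -
    have i: "integrable (lebesgue_on ?V) (\<lambda>y. f y * dir_deriv \<eta> b y)"
        "integrable (lebesgue_on ?V) (\<lambda>y. (?G y \<bullet> b) * \<eta> y)"
        "integrable (lebesgue_on ?V) (\<lambda>y. (\<phi> k y - f y) * dir_deriv \<eta> b y)"
        "integrable (lebesgue_on ?V) (\<lambda>y. ((gradient (\<phi> k) y - ?G y) \<bullet> b) * \<eta> y)"
      using tL has_weak_gradient_L2[OF GV] has_weak_gradient_component[OF GV b]
        has_weak_gradient_L2[OF dV] has_weak_gradient_component[OF dV b]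
      by (auto intro!: L2_mult_integrable)
    have "(LINT y|lebesgue_on ?V. dir_deriv (\<lambda>y. \<phi> k y * \<eta> y) b y) =
      (LINT y|lebesgue_on ?V. (f y * dir_deriv \<eta> b y + (?G y \<bullet> b) * \<eta> y) + ((\<phi> k y - f y) * dir_deriv \<eta> b y
        + ((gradient (\<phi> k) y - ?G y) \<bullet> b) * \<eta> y))"
      by (intro Bochner_Integration.integral_cong refl)
        (simp only: dir_deriv_mult[OF sm test_function_smooth[OF \<eta>]] inner_diff_left gradient_inner[OF b],
          simp add: algebra_simps)
    then show ?thesis
      using i by (simp only: Bochner_Integration.integral_add Bochner_Integration.integrable_add)
  qed
  have "(\<lambda>k. LINT y|lebesgue_on ?V. dir_deriv (\<lambda>y. \<phi> k y * \<eta> y) b y) \<longlonglongrightarrow> ?I + (0 + 0)"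
    unfolding eq by (intro tendsto_add tendsto_const p1 p2)
  moreover have "(LINT y|lebesgue_on ?V. dir_deriv (\<lambda>y. \<phi> k y * \<eta> y) b y) =
      (LINT y|lebesgue_on U. dir_deriv (\<lambda>y. \<phi> k y * \<eta> y) b y)" for k
    using test_function_zero[OF test_function_dir_deriv[OF test_function_mult[OF \<eta> sm] b]]
    by (intro lint_subset sets) auto
  moreover have "?I = (LINT y|lebesgue_on U. f y * dir_deriv \<eta> b y + (?G y \<bullet> b) * \<eta> y)"
    using test_function_zero[OF test_function_dir_deriv[OF \<eta> b]] test_function_zero[OF \<eta>]
    by (intro lint_subset sets) auto
  ultimately show ?thesis by simp
qed

locale two_pieces =
  fixes U W D :: "'a::euclidean_space set"
  assumes U: "open U" and W: "open W" and D: "open D" and UD: "U \<subseteq> D" and WD: "W \<subseteq> D"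
    and disjoint: "U \<inter> W = {}" and null: "D - (U \<union> W) \<in> null_sets lebesgue"
begin

lemma lebesgue_sets [simp]: "U \<in> sets lebesgue" "W \<in> sets lebesgue" "D \<in> sets lebesgue"
  using U W D by (auto intro: open_lebesgue)

lemma AE_split: "AE x in lebesgue. indicator D x * F x = indicator U x * F x + indicator W x * (F x :: real)"
  using AE_not_in[OF null]
proof eventually_elim
  case (elim x)
  then show ?case using UD WD disjoint by (cases "x \<in> U"; cases "x \<in> W") auto
qed

lemma measurable_split:
  fixes F :: "'a \<Rightarrow> real"
  assumes "F \<in> borel_measurable (lebesgue_on U)" "F \<in> borel_measurable (lebesgue_on W)"
  shows "F \<in> borel_measurable (lebesgue_on D)"
proof -
  have m: "(\<lambda>x. indicator U x * F x + indicator W x * F x) \<in> borel_measurable lebesgue"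
    using assms by (simp add: measurable_indicator_iff)
  have "AE x in lebesgue. indicator U x * F x + indicator W x * F x = indicator D x * F x"
    using AE_split[of F] by eventually_elim simp
  then have "(\<lambda>x. indicator D x * F x) \<in> borel_measurable lebesgue" by (rule borel_measurable_AE[OF m])
  then show ?thesis by (simp add: measurable_indicator_iff)
qed

lemma
  fixes F :: "'a \<Rightarrow> real"
  assumes "integrable (lebesgue_on U) F" "integrable (lebesgue_on W) F"
  shows integrable_split: "integrable (lebesgue_on D) F"
    and lint_split: "(LINT x|lebesgue_on D. F x) = (LINT x|lebesgue_on U. F x) + (LINT x|lebesgue_on W. F x)"
proof -
  have i: "integrable lebesgue (\<lambda>x. indicator U x * F x)" "integrable lebesgue (\<lambda>x. indicator W x * F x)"
    using assms by (auto simp: integrable_indicator_iff)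
  have m: "(\<lambda>x. indicator D x * F x) \<in> borel_measurable lebesgue"
    using measurable_split[OF assms[THEN borel_measurable_integrable]] by (simp add: measurable_indicator_iff)
  have m': "(\<lambda>x. indicator U x * F x + indicator W x * F x) \<in> borel_measurable lebesgue" using i by simp
  show "integrable (lebesgue_on D) F"
    using i integrable_cong_AE[OF m m' AE_split] by (simp add: integrable_indicator_iff)
  show "(LINT x|lebesgue_on D. F x) = (LINT x|lebesgue_on U. F x) + (LINT x|lebesgue_on W. F x)"
    using i integral_cong_AE[OF m m' AE_split] by (simp add: lint_indicator)
qed

lemma L2_split: "f \<in> L2 U \<Longrightarrow> f \<in> L2 W \<Longrightarrow> f \<in> L2 D"
  by (simp add: L2_def measurable_split integrable_split)

lemma L2_norm_split:
  assumes "f \<in> L2 U" "f \<in> L2 W"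
  shows "(L2_norm D f)\<^sup>2 = (L2_norm U f)\<^sup>2 + (L2_norm W f)\<^sup>2"
  using assms by (simp add: L2_norm_def lint_split L2_integrable)

lemma H1_norm_split:
  assumes f: "f \<in> H1 D"
  shows "(H1_norm D f)\<^sup>2 = (H1_norm U f)\<^sup>2 + (H1_norm W f)\<^sup>2"
proof -
  let ?G = "weak_gradient D f"
  have G: "has_weak_gradient D f ?G" by (rule H1_has_weak_gradient[OF f])
  have GU: "has_weak_gradient U f ?G" by (rule has_weak_gradient_subset[OF G UD D U])
  have GW: "has_weak_gradient W f ?G" by (rule has_weak_gradient_subset[OF G WD D W])
  show ?thesis
    unfolding H1_norm_square[OF G D] H1_norm_square[OF GU U] H1_norm_square[OF GW W]
    using has_weak_gradient_L2[OF GU] has_weak_gradient_L2[OF GW]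
      has_weak_gradient_component[OF GU] has_weak_gradient_component[OF GW]
    by (simp add: lint_split L2_integrable sum.distrib)
qed

definition glue :: "('a \<Rightarrow> 'b) \<Rightarrow> ('a \<Rightarrow> 'b) \<Rightarrow> 'a \<Rightarrow> 'b" where
  "glue u z = (\<lambda>x. if x \<in> U then u x else z x)"

lemma glue_U: "x \<in> U \<Longrightarrow> glue u z x = u x"
  and glue_W: "x \<in> W \<Longrightarrow> glue u z x = z x"
  using disjoint by (auto simp: glue_def)

lemma glue_L2:
  assumes "u \<in> L2 U" "z \<in> L2 W"
  shows "glue u z \<in> L2 U" "glue u z \<in> L2 W" "glue u z \<in> L2 D"
proof -
  show "glue u z \<in> L2 U" "glue u z \<in> L2 W"
    using assms L2_cong[of U "glue u z" u] L2_cong[of W "glue u z" z] by (auto simp: glue_U glue_W)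
  then show "glue u z \<in> L2 D" by (rule L2_split)
qed

end

section \<open>The local geometry of a Lipschitz domain\<close>

context lipschitz_graph
begin

lemma local_closure:
  assumes rep: "U \<inter> ball x r = subgraph e \<gamma> \<inter> ball x r" and y: "y \<in> ball x r"
  shows "y \<in> closure U \<longleftrightarrow> 0 \<le> height y"
proof
  assume "y \<in> closure U"
  then have "y \<in> closure (ball x r \<inter> U)" using open_Int_closure_subset[OF open_ball, of x r U] y by blast
  also have "closure (ball x r \<inter> U) \<subseteq> {y. 0 \<le> height y}"
  proof (rule closure_minimal)
    show "ball x r \<inter> U \<subseteq> {y. 0 \<le> height y}" using rep by (auto simp: subgraph_eq Int_commute)
    show "closed {y. 0 \<le> height y}" by (intro closed_Collect_le continuous_height continuous_intros)
  qed
  finally show "0 \<le> height y" by simp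
next
  assume h: "0 \<le> height y"
  show "y \<in> closure U"
    unfolding closure_approachable
  proof (intro allI impI)
    fix \<epsilon> :: real assume \<epsilon>: "0 < \<epsilon>"
    define t where "t = min (\<epsilon> / 2) ((r - dist x y) / 2)"
    have t: "0 < t" "t < \<epsilon>" "t < r - dist x y" using \<epsilon> y by (auto simp: t_def min_def)
    let ?z = "y + (- t) *\<^sub>R e"
    have d: "dist y ?z = t" using t unit by (simp add: dist_norm)
    have "?z \<in> ball x r" using dist_triangle[of x ?z y] d t by simp
    moreover have "?z \<in> subgraph e \<gamma>" unfolding subgraph_eq mem_Collect_eq height_add using h t by simp
    ultimately have "?z \<in> U" using rep by blast
    then show "\<exists>z\<in>U. dist z y < \<epsilon>" using d t by (metis dist_commute)
  qed
qed

lemma local_frontier: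
  assumes rep: "U \<inter> ball x r = subgraph e \<gamma> \<inter> ball x r" and "open U" and y: "y \<in> ball x r"
  shows "y \<in> frontier U \<longleftrightarrow> y \<in> graph_over e \<gamma>"
proof -
  have "y \<in> frontier U \<longleftrightarrow> y \<in> closure U \<and> y \<notin> U" using \<open>open U\<close> by (simp add: frontier_def interior_open)
  also have "\<dots> \<longleftrightarrow> 0 \<le> height y \<and> \<not> 0 < height y"
  proof -
    have "y \<in> U \<longleftrightarrow> y \<in> subgraph e \<gamma>" using rep y by blast
    then show ?thesis using local_closure[OF rep y] by (simp add: subgraph_eq)
  qed
  finally show ?thesis by (auto simp: graph_eq)
qed

text \<open>Near a boundary point any two points of the domain are joined by moving down along \<open>e\<close> into a
  ball below the graph.\<close>

lemma local_connected:
  assumes rep: "U \<inter> ball x r = subgraph e \<gamma> \<inter> ball x r" and x: "height x = 0"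
    and \<rho>: "0 < \<rho>" "\<rho> \<le> r"
  obtains s C where "0 < s" "s \<le> \<rho>" "connected C" "U \<inter> ball x s \<subseteq> C" "C \<subseteq> U \<inter> ball x \<rho>"
proof -
  define M where "M = 1 + L"
  have M: "1 \<le> M" using L_nonneg by (simp add: M_def)
  \<comment> \<open>Chosen such that \<open>s + h = \<rho>\<close>, so that nothing leaves the ball of radius \<open>\<rho>\<close>, and \<open>M s < h\<close>, so that the
    ball of radius \<open>s\<close> around \<open>x - h e\<close> lies below the graph.\<close>
  define s where "s = \<rho> / (M + 2)"
  define h where "h = (M + 1) * s"
  have "(M + 2) * s = \<rho>" using M by (simp add: s_def)
  moreover have "s + h = (M + 2) * s" by (simp add: h_def algebra_simps)
  moreover have "0 < s" using \<rho> M by (simp add: s_def)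
  ultimately have s: "0 < s" "s + h = \<rho>" by simp_all
  have h: "0 < h" "M * s < h" using s M by (auto simp: h_def)
  have inU: "q \<in> U \<inter> ball x \<rho>" if "q \<in> ball x \<rho>" "0 < height q" for q
  proof -
    have "q \<in> subgraph e \<gamma> \<inter> ball x r" using that \<rho> by (simp add: subgraph_eq)
    then show ?thesis using rep that(1) by blast
  qed
  let ?B = "ball (x - h *\<^sub>R e) s"
  let ?J = "\<lambda>y. closed_segment y (y - h *\<^sub>R e)"
  have B: "?B \<subseteq> U \<inter> ball x \<rho>"
  proof
    fix q assume q: "q \<in> ?B"
    have "height (x - h *\<^sub>R e) = h" using height_add[of x "- h"] x by simp
    then have "h - height q \<le> M * dist (x - h *\<^sub>R e) q"
      using height_lipschitz[of "x - h *\<^sub>R e" q] by (simp add: M_def)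
    also have "\<dots> \<le> M * s" using q M by (intro mult_left_mono) auto
    finally have "0 < height q" using h by linarith
    moreover have "dist x q \<le> dist x (x - h *\<^sub>R e) + dist (x - h *\<^sub>R e) q" by (rule dist_triangle)
    then have "q \<in> ball x \<rho>" using q unit h s by (simp add: dist_norm)
    ultimately show "q \<in> U \<inter> ball x \<rho>" by (intro inU)
  qed
  have J: "?J y \<subseteq> U \<inter> ball x \<rho>" if y: "y \<in> U \<inter> ball x s" for y
  proof
    fix q assume "q \<in> ?J y"
    then obtain a where a: "0 \<le> a" "a \<le> 1" "q = (1 - a) *\<^sub>R y + a *\<^sub>R (y - h *\<^sub>R e)"
      by (auto simp: closed_segment_def)
    have q: "q = y + (- (a * h)) *\<^sub>R e" using a(3) by (simp add: algebra_simps)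
    have ah: "0 \<le> a * h" "a * h \<le> h" using a h by (auto simp: mult_left_le_one_le)
    have "y \<in> ball x r" using y s h \<rho> by auto
    then have "y \<in> subgraph e \<gamma>" using y rep by blast
    then have "0 < height y" by (simp add: subgraph_eq)
    then have hq: "0 < height q" using ah by (simp only: q height_add)
    have "dist x q \<le> dist x y + dist y q" by (rule dist_triangle)
    also have "dist y q = a * h" using unit ah by (simp add: q dist_norm)
    finally have "q \<in> ball x \<rho>" using y ah s by simp
    then show "q \<in> U \<inter> ball x \<rho>" using hq by (rule inU)
  qed
  define C where "C = (\<Union>y\<in>insert None (Some ` (U \<inter> ball x s)). case y of None \<Rightarrow> ?B | Some y \<Rightarrow> ?B \<union> ?J y)"
  have "connected C"
    unfolding C_def
  proof (rule connected_Union)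
    fix X assume "X \<in> (\<lambda>y. case y of None \<Rightarrow> ?B | Some y \<Rightarrow> ?B \<union> ?J y) ` insert None (Some ` (U \<inter> ball x s))"
    then consider "X = ?B" | y where "y \<in> U \<inter> ball x s" "X = ?B \<union> ?J y" by auto
    then show "connected X"
    proof cases
      case 1
      then show ?thesis by (simp add: convex_connected)
    next
      case (2 y)
      have "y - h *\<^sub>R e \<in> ?B \<inter> ?J y" using 2(1) by (simp add: dist_norm)
      then show ?thesis unfolding 2(2) by (intro connected_Un) (auto simp: convex_connected)
    qed
  next
    have "x - h *\<^sub>R e \<in> \<Inter> ((\<lambda>y. case y of None \<Rightarrow> ?B | Some y \<Rightarrow> ?B \<union> ?J y) ` insert None (Some ` (U \<inter> ball x s)))"
      using s(1) by auto
    then show "\<Inter> ((\<lambda>y. case y of None \<Rightarrow> ?B | Some y \<Rightarrow> ?B \<union> ?J y) ` insert None (Some ` (U \<inter> ball x s))) \<noteq> {}"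
      by blast
  qed
  moreover have "U \<inter> ball x s \<subseteq> C" unfolding C_def by (force)
  moreover have "C \<subseteq> U \<inter> ball x \<rho>"
    unfolding C_def
  proof (rule UN_least)
    fix i assume i: "i \<in> insert None (Some ` (U \<inter> ball x s))"
    show "(case i of None \<Rightarrow> ?B | Some y \<Rightarrow> ?B \<union> ?J y) \<subseteq> U \<inter> ball x \<rho>"
    proof (cases i)
      case (Some y)
      then have "y \<in> U \<inter> ball x s" using i by blast
      from B J[OF this] show ?thesis unfolding Some option.case by (rule Un_least)
    qed (use B in simp)
  qed
  ultimately show thesis using that[of s C] s h by simp
qed

end

lemma bounded_lipschitz_domainD:
  assumes "bounded_lipschitz_domain U" "x \<in> frontier U"
  obtains e \<gamma> L r where "lipschitz_graph e \<gamma> L" "r > 0" "U \<inter> ball x r = subgraph e \<gamma> \<inter> ball x r"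
proof -
  obtain e \<gamma> L r where "norm e = 1 \<and> L-lipschitz_on UNIV \<gamma> \<and> r > 0 \<and> U \<inter> ball x r = subgraph e \<gamma> \<inter> ball x r"
    using assms unfolding bounded_lipschitz_domain_def by blast
  then show thesis using that[of e \<gamma> L r] by (simp add: lipschitz_graph_def)
qed

lemma bounded_lipschitz_domain_open: "bounded_lipschitz_domain U \<Longrightarrow> open U"
  by (simp add: bounded_lipschitz_domain_def)

text \<open>By compactness the boundary is a finite union of pieces of Lipschitz graphs.\<close>

lemma frontier_lipschitz_null:
  assumes "bounded_lipschitz_domain U"
  shows "frontier U \<in> null_sets lebesgue"
proof -
  have Uo: "open U" by (rule bounded_lipschitz_domain_open[OF assms])
  have comp: "compact (frontier U)"
    using assms by (simp add: bounded_lipschitz_domain_def compact_frontier_bounded)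
  have "\<exists>r>0. frontier U \<inter> ball x r \<in> null_sets lebesgue" if "x \<in> frontier U" for x
  proof -
    obtain e \<gamma> L r where g: "lipschitz_graph e \<gamma> L" and r: "r > 0" and rep: "U \<inter> ball x r = subgraph e \<gamma> \<inter> ball x r"
      by (rule bounded_lipschitz_domainD[OF assms \<open>x \<in> frontier U\<close>])
    interpret lipschitz_graph e \<gamma> L by (rule g)
    have "frontier U \<inter> ball x r = graph_over e \<gamma> \<inter> ball x r" using local_frontier[OF rep Uo] by blast
    moreover have "graph_over e \<gamma> \<inter> ball x r \<in> null_sets lebesgue"
      using null_sets_completionI[OF graph_null] by (intro null_set_Int2) auto
    ultimately show ?thesis using r by auto
  qed
  then obtain r where r: "\<And>x. x \<in> frontier U \<Longrightarrow> r x > 0"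
    "\<And>x. x \<in> frontier U \<Longrightarrow> frontier U \<inter> ball x (r x) \<in> null_sets lebesgue" by metis
  have "frontier U \<subseteq> (\<Union>x\<in>frontier U. ball x (r x))" using r(1) by force
  then obtain X where X: "X \<subseteq> frontier U" "finite X" "frontier U \<subseteq> (\<Union>x\<in>X. ball x (r x))"
    by (rule compactE_image[OF comp open_ball])
  have "(\<Union>x\<in>X. frontier U \<inter> ball x (r x)) \<in> null_sets lebesgue"
    using X r(2) by (intro null_sets_UN' countable_finite) auto
  moreover have "(\<Union>x\<in>X. frontier U \<inter> ball x (r x)) = frontier U" using X(3) by blast
  ultimately show ?thesis by simp
qed

section \<open>The glued function has a weak gradient\<close>

locale lipschitz_interface = two_pieces U W D for U W D :: "'a::euclidean_space set" +
  assumes dim: "2 \<le> DIM('a)" and lipschitz: "bounded_lipschitz_domain U" and W_eq: "W = D - closure U"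
begin

text \<open>The pointwise condition in \<^const>\<open>has_trace\<close>.\<close>

definition trace_at :: "'a set \<Rightarrow> ('a \<Rightarrow> real) \<Rightarrow> 'a set \<Rightarrow> ('a \<Rightarrow> real) \<Rightarrow> 'a \<Rightarrow> bool" where
  "trace_at V f S g x \<longleftrightarrow> (\<exists>r>0. \<exists>\<phi>. (\<forall>k::nat. smooth (\<phi> k)) \<and>
           (\<lambda>k. H1_norm (V \<inter> ball x r) (\<lambda>y. \<phi> k y - f y)) \<longlonglongrightarrow> 0 \<and>
           (\<lambda>k. \<integral>\<^sup>+y\<in>S \<inter> ball x r. ennreal ((\<phi> k y - g y)\<^sup>2) \<partial>surface_measure) \<longlonglongrightarrow> 0)"

text \<open>Below the graph \<open>u\<close> is approximated by \<open>\<phi> k\<close>, above it \<open>z\<close> is approximated by \<open>\<psi> k\<close>. Since the integral of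
  \<open>\<partial>\<^sub>b (\<psi> k \<eta>)\<close> over \<open>D\<close> vanishes, the sum of the two contributions is the integral of \<open>\<partial>\<^sub>b ((\<phi> k - \<psi> k) \<eta>)\<close>
  below the graph, and \<open>\<phi> k - \<psi> k\<close> tends to zero on the graph because both tend to \<open>g\<close>.\<close>

lemma weak_deriv_near_interface:
  assumes u: "u \<in> H1 U" and z: "z \<in> H1 W" and b: "b \<in> Basis"
    and x: "x \<in> frontier U" "x \<in> D"
    and g: "g \<in> borel_measurable (restrict_space surface_measure (frontier U \<inter> D))"
    and tu: "trace_at U u (frontier U \<inter> D) g x" and tz: "trace_at W z (frontier U \<inter> D) g x"
  shows "weak_deriv_near D (glue u z) (\<lambda>y. glue (weak_gradient U u) (weak_gradient W z) y \<bullet> b) b x"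
proof -
  let ?S = "frontier U \<inter> D"
  let ?Gu = "weak_gradient U u" let ?Gz = "weak_gradient W z"
  obtain e \<gamma> L r0 where gr: "lipschitz_graph e \<gamma> L" and r0: "r0 > 0" and rep: "U \<inter> ball x r0 = subgraph e \<gamma> \<inter> ball x r0"
    by (rule bounded_lipschitz_domainD[OF lipschitz x(1)])
  interpret lipschitz_graph e \<gamma> L by (rule gr)
  obtain rD where rD: "rD > 0" "ball x rD \<subseteq> D" using D x(2) by (auto simp: open_contains_ball)
  obtain r1 \<phi> where r1: "r1 > 0" and \<phi>: "\<And>k::nat. smooth (\<phi> k)"
    and \<phi>H: "(\<lambda>k. H1_norm (U \<inter> ball x r1) (\<lambda>y. \<phi> k y - u y)) \<longlonglongrightarrow> 0"
    and \<phi>S: "(\<lambda>k. \<integral>\<^sup>+y\<in>?S \<inter> ball x r1. ennreal ((\<phi> k y - g y)\<^sup>2) \<partial>surface_measure) \<longlonglongrightarrow> 0"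
    using tu unfolding trace_at_def by blast
  obtain r2 \<psi> where r2: "r2 > 0" and \<psi>: "\<And>k::nat. smooth (\<psi> k)"
    and \<psi>H: "(\<lambda>k. H1_norm (W \<inter> ball x r2) (\<lambda>y. \<psi> k y - z y)) \<longlonglongrightarrow> 0"
    and \<psi>S: "(\<lambda>k. \<integral>\<^sup>+y\<in>?S \<inter> ball x r2. ennreal ((\<psi> k y - g y)\<^sup>2) \<partial>surface_measure) \<longlonglongrightarrow> 0"
    using tz unfolding trace_at_def by blast
  define r where "r = Min {r0, rD, r1, r2}"
  have r: "0 < r" "r \<le> r0" "r \<le> rD" "r \<le> r1" "r \<le> r2" using r0 rD r1 r2 by (auto simp: r_def)
  have "weak_pairing D (glue u z) (\<lambda>y. glue ?Gu ?Gz y \<bullet> b) b \<eta> = 0" if \<eta>: "test_function (ball x r) \<eta>" for \<eta>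
  proof -
    let ?p = "weak_pairing D (glue u z) (\<lambda>y. glue ?Gu ?Gz y \<bullet> b) b \<eta>"
    have \<eta>1: "test_function (ball x r1) \<eta>" and \<eta>2: "test_function (ball x r2) \<eta>"
      using r by (auto intro: test_function_mono[OF \<eta>])
    obtain M where M: "M > 0" "\<And>y. \<bar>\<eta> y\<bar> \<le> M" using test_function_bounded \<eta> by metis
    let ?a = "\<lambda>k. (LINT y|lebesgue_on U. dir_deriv (\<lambda>y. \<phi> k y * \<eta> y) b y)
        + (LINT y|lebesgue_on W. dir_deriv (\<lambda>y. \<psi> k y * \<eta> y) b y)"
    let ?w = "\<lambda>k y. (\<phi> k y - \<psi> k y) * \<eta> y"
    have lim: "?a \<longlonglongrightarrow> ?p"
    proof -
      have iu: "integrable (lebesgue_on U) (\<lambda>y. u y * dir_deriv \<eta> b y + (?Gu y \<bullet> b) * \<eta> y)"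
        and iz: "integrable (lebesgue_on W) (\<lambda>y. z y * dir_deriv \<eta> b y + (?Gz y \<bullet> b) * \<eta> y)"
        using H1_has_weak_gradient[OF u] H1_has_weak_gradient[OF z] b
          test_function_L2[OF \<eta>] test_function_L2[OF test_function_dir_deriv[OF \<eta> b]]
        by (auto intro!: Bochner_Integration.integrable_add L2_mult_integrable
            intro: has_weak_gradient_L2 has_weak_gradient_component)
      let ?F = "\<lambda>y. glue u z y * dir_deriv \<eta> b y + (glue ?Gu ?Gz y \<bullet> b) * \<eta> y"
      have cu: "integrable (lebesgue_on U) ?F"
          "(LINT y|lebesgue_on U. ?F y) = (LINT y|lebesgue_on U. u y * dir_deriv \<eta> b y + (?Gu y \<bullet> b) * \<eta> y)"
      proof -
        have eq: "?F y = u y * dir_deriv \<eta> b y + (?Gu y \<bullet> b) * \<eta> y" if "y \<in> space (lebesgue_on U)" for y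
          using that by (simp add: glue_U space_restrict_space)
        show "integrable (lebesgue_on U) ?F" by (rule iffD2[OF Bochner_Integration.integrable_cong[OF refl eq] iu])
        show "(LINT y|lebesgue_on U. ?F y) = (LINT y|lebesgue_on U. u y * dir_deriv \<eta> b y + (?Gu y \<bullet> b) * \<eta> y)"
          by (rule Bochner_Integration.integral_cong[OF refl eq])
      qed
      have cz: "integrable (lebesgue_on W) ?F"
          "(LINT y|lebesgue_on W. ?F y) = (LINT y|lebesgue_on W. z y * dir_deriv \<eta> b y + (?Gz y \<bullet> b) * \<eta> y)"
      proof -
        have eq: "?F y = z y * dir_deriv \<eta> b y + (?Gz y \<bullet> b) * \<eta> y" if "y \<in> space (lebesgue_on W)" for y
          using that by (simp add: glue_W space_restrict_space)
        show "integrable (lebesgue_on W) ?F" by (rule iffD2[OF Bochner_Integration.integrable_cong[OF refl eq] iz])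
        show "(LINT y|lebesgue_on W. ?F y) = (LINT y|lebesgue_on W. z y * dir_deriv \<eta> b y + (?Gz y \<bullet> b) * \<eta> y)"
          by (rule Bochner_Integration.integral_cong[OF refl eq])
      qed
      have p: "?p = (LINT y|lebesgue_on U. u y * dir_deriv \<eta> b y + (?Gu y \<bullet> b) * \<eta> y)
          + (LINT y|lebesgue_on W. z y * dir_deriv \<eta> b y + (?Gz y \<bullet> b) * \<eta> y)"
        unfolding weak_pairing_def by (subst lint_split[OF cu(1) cz(1)]) (simp only: cu(2) cz(2))
      show ?thesis
        unfolding p
        by (intro tendsto_add trace_approximation_pairing[OF U u \<phi> \<eta>1 b \<phi>H] trace_approximation_pairing[OF W z \<psi> \<eta>2 b \<psi>H])
    qed
    have tw: "test_function (ball x r) (?w k)" for k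
      by (intro test_function_mult \<eta> smooth_diff \<phi> \<psi>)
    have "ball x r \<subseteq> ball 0 (norm x + r)"
    proof
      fix y assume "y \<in> ball x r"
      then show "y \<in> ball 0 (norm x + r)" using norm_triangle_sub[of y x] by (simp add: dist_norm norm_minus_commute)
    qed
    then have tw0: "test_function (ball 0 (norm x + r)) (?w k)" for k using tw by (rule test_function_mono[rotated])
    have a_eq: "?a k = (LINT y|lborel. indicator (subgraph e \<gamma>) y * dir_deriv (?w k) b y)" for k
    proof -
      let ?P = "dir_deriv (\<lambda>y. \<phi> k y * \<eta> y) b" let ?Q = "dir_deriv (\<lambda>y. \<psi> k y * \<eta> y) b"
      have tP: "test_function (ball x r) ?P" and tQ: "test_function (ball x r) ?Q"
        by (intro test_function_dir_deriv test_function_mult \<eta> \<phi> \<psi> b)+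
      have i: "integrable (lebesgue_on U) ?P" "integrable (lebesgue_on U) ?Q" "integrable (lebesgue_on W) ?Q"
        using test_function_integrable[OF tP] test_function_integrable[OF tQ]
        by (auto simp: integrable_indicator_iff intro: integrable_mult_indicator[where 'b=real, simplified])
      have "(LINT y|lebesgue_on D. ?Q y) = (LINT y|lebesgue. ?Q y)"
      proof -
        have "ball x r \<subseteq> D" using r(3) rD(2) by auto
        then have "test_function D ?Q" by (rule test_function_mono[OF tQ])
        then show ?thesis using test_function_zero by (intro lint_supported) auto
      qed
      also have "\<dots> = 0"
        by (rule integral_dir_deriv_test_function[OF test_function_mult[OF \<eta> \<psi>] b])
      finally have "(LINT y|lebesgue_on U. ?Q y) + (LINT y|lebesgue_on W. ?Q y) = 0"
        using lint_split[OF i(2,3)] by simp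
      then have "?a k = (LINT y|lebesgue_on U. ?P y) - (LINT y|lebesgue_on U. ?Q y)" by simp
      also have "\<dots> = (LINT y|lebesgue_on U. ?P y - ?Q y)" using i by simp
      also have "(\<lambda>y. ?P y - ?Q y) = dir_deriv (?w k) b"
      proof
        fix y
        have "?w k = (\<lambda>y. \<phi> k y * \<eta> y - \<psi> k y * \<eta> y)" by (simp add: left_diff_distrib)
        then show "?P y - ?Q y = dir_deriv (?w k) b y"
          using dir_deriv_diff[OF smooth_mult[OF \<phi> test_function_smooth[OF \<eta>]] smooth_mult[OF \<psi> test_function_smooth[OF \<eta>]]]
          by simp
      qed
      also have "(LINT y|lebesgue_on U. dir_deriv (?w k) b y) = (LINT y|lebesgue. indicator U y * dir_deriv (?w k) b y)"
        by (simp add: lint_indicator)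
      also have "(\<lambda>y. indicator U y * dir_deriv (?w k) b y) = (\<lambda>y. indicator (subgraph e \<gamma>) y * dir_deriv (?w k) b y)"
      proof
        fix y
        show "indicator U y * dir_deriv (?w k) b y = indicator (subgraph e \<gamma>) y * dir_deriv (?w k) b y"
        proof (cases "y \<in> ball x r")
          case True
          then have "y \<in> ball x r0" using r by simp
          then have "y \<in> U \<longleftrightarrow> y \<in> subgraph e \<gamma>" using rep by blast
          then show ?thesis by (simp add: indicator_def)
        qed (simp add: test_function_zero[OF test_function_dir_deriv[OF tw b]])
      qed
      also have "(LINT y|lebesgue. indicator (subgraph e \<gamma>) y * dir_deriv (?w k) b y) =
          (LINT y|lborel. indicator (subgraph e \<gamma>) y * dir_deriv (?w k) b y)"
      proof (rule integral_completion)
        have "dir_deriv (?w k) b \<in> borel_measurable borel"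
          by (intro smooth_measurable smooth_dir_deriv test_function_smooth[OF tw] b)
        then show "(\<lambda>y. indicator (subgraph e \<gamma>) y * dir_deriv (?w k) b y) \<in> borel_measurable lborel"
          using borel_open[OF open_subgraph] by simp
      qed
      finally show ?thesis .
    qed
    let ?A = "\<lambda>k. \<integral>\<^sup>+y\<in>?S \<inter> ball x r1. ennreal ((\<phi> k y - g y)\<^sup>2) \<partial>surface_measure"
    let ?B = "\<lambda>k. \<integral>\<^sup>+y\<in>?S \<inter> ball x r2. ennreal ((\<psi> k y - g y)\<^sup>2) \<partial>surface_measure"
    have nn: "(\<integral>\<^sup>+y\<in>graph_over e \<gamma>. ennreal ((?w k y)\<^sup>2) \<partial>surface_measure) \<le> ennreal (2 * M\<^sup>2) * (?A k + ?B k)" for k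
    proof -
      have Sb: "?S \<in> sets borel" using D by (intro sets.Int borel_closed borel_open frontier_closed)
      then have Sm: "?S \<in> sets surface_measure" by (rule borel_surface_measure)
      have gm: "(\<lambda>y. indicator ?S y * g y) \<in> borel_measurable surface_measure"
        using g Sm by (simp add: borel_measurable_restrict_space_iff)
      have meas: "(\<lambda>y. ennreal ((f y - g y)\<^sup>2) * indicator (?S \<inter> ball x \<rho>) y) \<in> borel_measurable surface_measure"
        if "smooth f" for f \<rho>
      proof -
        have [measurable]: "f \<in> borel_measurable surface_measure"
          using that by (intro measurable_surface_measure smooth_measurable)
        have [measurable]: "?S \<inter> ball x \<rho> \<in> sets surface_measure"
          by (rule borel_surface_measure[OF sets.Int[OF Sb borel_open[OF open_ball]]])
        have "(\<lambda>y. ennreal ((f y - indicator ?S y * g y)\<^sup>2) * indicator (?S \<inter> ball x \<rho>) y) \<in> borel_measurable surface_measure"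
          using gm by measurable
        also have "(\<lambda>y. ennreal ((f y - indicator ?S y * g y)\<^sup>2) * indicator (?S \<inter> ball x \<rho>) y) =
            (\<lambda>y. ennreal ((f y - g y)\<^sup>2) * indicator (?S \<inter> ball x \<rho>) y)"
          by (intro ext) (auto simp: indicator_def)
        finally show ?thesis .
      qed
      have "(\<integral>\<^sup>+y\<in>graph_over e \<gamma>. ennreal ((?w k y)\<^sup>2) \<partial>surface_measure) \<le>
          (\<integral>\<^sup>+y. ennreal (2 * M\<^sup>2) * (ennreal ((\<phi> k y - g y)\<^sup>2) * indicator (?S \<inter> ball x r1) y
            + ennreal ((\<psi> k y - g y)\<^sup>2) * indicator (?S \<inter> ball x r2) y) \<partial>surface_measure)"
      proof (rule nn_integral_mono)
        fix y
        show "ennreal ((?w k y)\<^sup>2) * indicator (graph_over e \<gamma>) y \<le>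
            ennreal (2 * M\<^sup>2) * (ennreal ((\<phi> k y - g y)\<^sup>2) * indicator (?S \<inter> ball x r1) y
            + ennreal ((\<psi> k y - g y)\<^sup>2) * indicator (?S \<inter> ball x r2) y)"
        proof (cases "y \<in> ball x r \<and> y \<in> graph_over e \<gamma>")
          case True
          then have "y \<in> ball x r0" "y \<in> ball x rD" "y \<in> ball x r1" "y \<in> ball x r2" using r by auto
          then have y: "y \<in> ?S \<inter> ball x r1" "y \<in> ?S \<inter> ball x r2"
            using local_frontier[OF rep U] True rD(2) by auto
          have "(\<phi> k y - \<psi> k y)\<^sup>2 \<le> 2 * ((\<phi> k y - g y)\<^sup>2 + (\<psi> k y - g y)\<^sup>2)"
            using zero_le_power2[of "(\<phi> k y - g y) + (\<psi> k y - g y)"] by (simp add: power2_eq_square algebra_simps)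
          moreover have "(\<eta> y)\<^sup>2 \<le> M\<^sup>2" using power_mono[OF M(2)[of y], of 2] by simp
          ultimately have "(?w k y)\<^sup>2 \<le> (2 * ((\<phi> k y - g y)\<^sup>2 + (\<psi> k y - g y)\<^sup>2)) * M\<^sup>2"
            unfolding power_mult_distrib by (intro mult_mono) auto
          then have "ennreal ((?w k y)\<^sup>2) \<le> ennreal ((2 * M\<^sup>2) * ((\<phi> k y - g y)\<^sup>2 + (\<psi> k y - g y)\<^sup>2))"
            by (intro ennreal_leI) (simp only: mult_ac)
          also have "\<dots> = ennreal (2 * M\<^sup>2) * (ennreal ((\<phi> k y - g y)\<^sup>2) + ennreal ((\<psi> k y - g y)\<^sup>2))"
            by (subst ennreal_mult) (auto simp: ennreal_plus)
          finally show ?thesis using y True by simp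
        next
          case False
          then have "ennreal ((?w k y)\<^sup>2) * indicator (graph_over e \<gamma>) y = 0"
            using test_function_zero[OF tw] by (auto simp: indicator_def)
          then show ?thesis by (rule ord_eq_le_trans) (rule zero_le)
        qed
      qed
      also have "\<dots> = ennreal (2 * M\<^sup>2) * (?A k + ?B k)"
        using meas[OF \<phi>] meas[OF \<psi>] by (simp add: nn_integral_cmult nn_integral_add)
      finally show ?thesis .
    qed
    have "(\<lambda>k. ennreal (2 * M\<^sup>2) * (?A k + ?B k)) \<longlonglongrightarrow> ennreal (2 * M\<^sup>2) * (0 + 0)"
      by (intro ennreal_tendsto_cmult tendsto_add \<phi>S \<psi>S) simp
    then have small: "\<forall>\<^sub>F k in sequentially. ennreal (2 * M\<^sup>2) * (?A k + ?B k) < ennreal \<epsilon>" if "0 < \<epsilon>" for \<epsilon>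
      using that by (intro order_tendstoD(2)[where y="ennreal (2 * M\<^sup>2) * (0 + 0)"]) auto
    define V where "V = measure lborel (ball (0::'a) (norm x + r + 2 * (1 + L) + 1))"
    have bound: "\<bar>?p\<bar> \<le> \<tau> * V + layer_const (1 + L) * \<epsilon> / \<tau>" if \<tau>: "0 < \<tau>" and \<epsilon>: "0 < \<epsilon>" for \<tau> \<epsilon>
    proof (rule tendsto_upperbound[OF tendsto_rabs[OF lim]])
      show "\<forall>\<^sub>F k in sequentially. \<bar>?a k\<bar> \<le> \<tau> * V + layer_const (1 + L) * \<epsilon> / \<tau>"
        using small[OF \<epsilon>]
      proof eventually_elim
        case (elim k)
        then have "(\<integral>\<^sup>+y\<in>graph_over e \<gamma>. ennreal ((?w k y)\<^sup>2) \<partial>surface_measure) \<le> ennreal \<epsilon>"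
          using nn[of k] by (meson less_imp_le order_trans)
        then show ?case
          unfolding a_eq V_def using \<epsilon> by (intro subgraph_dir_deriv_bound[OF dim tw0 b \<tau>]) auto
      qed
    qed simp
    have le: "\<bar>?p\<bar> \<le> \<tau> * V + layer_const (1 + L) * \<tau>" if "0 < \<tau>" for \<tau>
      using bound[OF that, of "\<tau> * \<tau>"] that by simp
    have "((\<lambda>\<tau>. \<tau> * V + layer_const (1 + L) * \<tau>) \<longlongrightarrow> 0 * V + layer_const (1 + L) * 0) (at_right 0)"
      by (intro tendsto_intros)
    moreover have "\<forall>\<^sub>F \<tau> in at_right 0. \<bar>?p\<bar> \<le> \<tau> * V + layer_const (1 + L) * \<tau>"
      using le by (auto simp: eventually_at_right_field intro: exI[of _ 1])
    ultimately have "\<bar>?p\<bar> \<le> 0 * V + layer_const (1 + L) * 0"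
      by (rule tendsto_lowerbound) simp
    then show ?thesis by simp
  qed
  then show ?thesis unfolding weak_deriv_near_def using r(1) by blast
qed

lemma has_trace_trace_at:
  assumes "has_trace V f S g"
  shows "f \<in> H1 V" "g \<in> borel_measurable (restrict_space surface_measure S)"
    "AE x in surface_measure. x \<in> S \<longrightarrow> trace_at V f S g x"
  using assms by (simp_all add: has_trace_def trace_at_def)

text \<open>The weak derivative is the expected one near every point of \<open>U\<close> and \<open>W\<close> and near almost every point of
  the interface, which leaves a set of surface measure zero.\<close>

lemma glue_has_weak_gradient:
  assumes tu: "has_trace U u (frontier U \<inter> D) g" and tz: "has_trace W z (frontier U \<inter> D) g"
  shows "has_weak_gradient D (glue u z) (glue (weak_gradient U u) (weak_gradient W z))"
proof -
  let ?Gu = "weak_gradient U u" let ?Gz = "weak_gradient W z" let ?G = "glue ?Gu ?Gz"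
  have u: "u \<in> H1 U" and z: "z \<in> H1 W"
    using has_trace_trace_at(1)[OF tu] has_trace_trace_at(1)[OF tz] by auto
  note Gu = H1_has_weak_gradient[OF u] and Gz = H1_has_weak_gradient[OF z]
  have f: "glue u z \<in> L2 D" using H1_L2[OF u] H1_L2[OF z] by (rule glue_L2)
  have Gb: "(\<lambda>y. ?G y \<bullet> b) \<in> L2 D" if b: "b \<in> Basis" for b
  proof -
    have "glue (\<lambda>y. ?Gu y \<bullet> b) (\<lambda>y. ?Gz y \<bullet> b) \<in> L2 D"
      using has_weak_gradient_component[OF Gu b] has_weak_gradient_component[OF Gz b] by (rule glue_L2)
    also have "glue (\<lambda>y. ?Gu y \<bullet> b) (\<lambda>y. ?Gz y \<bullet> b) = (\<lambda>y. ?G y \<bullet> b)"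
      by (auto simp: glue_def)
    finally show ?thesis .
  qed
  have pair: "weak_pairing D (glue u z) (\<lambda>y. ?G y \<bullet> b) b \<eta> = 0"
    if \<eta>: "test_function D \<eta>" and b: "b \<in> Basis" for \<eta> b
  proof (rule weak_pairing_zero_if_near_surface_ae[OF D f Gb[OF b] b dim \<eta>])
    let ?near = "weak_deriv_near D (glue u z) (\<lambda>y. ?G y \<bullet> b) b"
    have piece: "?near x" if "x \<in> V" "open V" "V \<subseteq> D" "has_weak_gradient V f F"
        and eqs: "\<And>y. y \<in> V \<Longrightarrow> glue u z y = f y" "\<And>y. y \<in> V \<Longrightarrow> ?G y = F y" for x V f F
    proof -
      obtain r where r: "r > 0" "ball x r \<subseteq> V" using \<open>open V\<close> \<open>x \<in> V\<close> by (auto simp: open_contains_ball)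
      have "weak_pairing D (glue u z) (\<lambda>y. ?G y \<bullet> b) b \<theta> = 0" if \<theta>: "test_function (ball x r) \<theta>" for \<theta>
      proof -
        have tV: "test_function V \<theta>" by (rule test_function_mono[OF \<theta> r(2)])
        have V: "V \<in> sets lebesgue" using \<open>open V\<close> by (rule open_lebesgue)
        have "weak_pairing D (glue u z) (\<lambda>y. ?G y \<bullet> b) b \<theta> =
            (LINT y|lebesgue_on V. glue u z y * dir_deriv \<theta> b y + (?G y \<bullet> b) * \<theta> y)"
          unfolding weak_pairing_def
          using test_function_zero[OF tV] test_function_zero[OF test_function_dir_deriv[OF tV b]]
          by (intro lint_subset[symmetric] V \<open>V \<subseteq> D\<close>) auto
        also have "\<dots> = (LINT y|lebesgue_on V. f y * dir_deriv \<theta> b y + (F y \<bullet> b) * \<theta> y)"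
          using eqs by (intro Bochner_Integration.integral_cong) (auto simp: space_restrict_space)
        also have "\<dots> = (LINT y|lebesgue_on V. f y * dir_deriv \<theta> b y) + (LINT y|lebesgue_on V. (F y \<bullet> b) * \<theta> y)"
          using \<open>has_weak_gradient V f F\<close> b test_function_L2[OF tV V] test_function_L2[OF test_function_dir_deriv[OF tV b] V]
          by (intro Bochner_Integration.integral_add L2_mult_integrable)
            (auto intro: has_weak_gradient_L2 has_weak_gradient_component)
        also have "\<dots> = 0" using has_weak_gradient_eq[OF \<open>has_weak_gradient V f F\<close> tV b] by simp
        finally show ?thesis .
      qed
      then show ?thesis unfolding weak_deriv_near_def using r(1) by blast
    qed
    have nearU: "?near x" if "x \<in> U" for x
      using that U UD Gu by (rule piece) (auto simp: glue_U)
    have nearW: "?near x" if "x \<in> W" for x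
      using that W WD Gz by (rule piece) (auto simp: glue_W)
    have "AE x in surface_measure. x \<in> frontier U \<inter> D \<longrightarrow> ?near x"
      using has_trace_trace_at(3)[OF tu] has_trace_trace_at(3)[OF tz]
    proof eventually_elim
      case (elim x)
      then show ?case
        using weak_deriv_near_interface[OF u z b _ _ has_trace_trace_at(2)[OF tu]] by blast
    qed
    then obtain N where N: "N \<in> null_sets surface_measure" "{x. \<not> (x \<in> frontier U \<inter> D \<longrightarrow> ?near x)} \<subseteq> N"
      by (auto elim!: AE_E simp: null_sets_def)
    have "D - {x. ?near x} \<subseteq> N"
    proof
      fix x assume x: "x \<in> D - {x. ?near x}"
      then have "x \<notin> U" "x \<notin> W" using nearU nearW by auto
      then have "x \<in> frontier U" using x W_eq U by (auto simp: frontier_def interior_open)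
      then show "x \<in> N" using x N(2) by blast
    qed
    then have "hausdorff_outer (real DIM('a) - 1) (D - {x. ?near x}) \<le> hausdorff_outer (real DIM('a) - 1) N"
      by (rule hausdorff_outer_mono)
    also have "\<dots> = 0" using N(1) emeasure_surface_measure[of N] by (auto simp: null_sets_def)
    finally show "hausdorff_outer (real DIM('a) - 1) (D - {x. ?near x}) = 0" by simp
  qed
  show ?thesis
    unfolding has_weak_gradient_def
  proof (intro conjI ballI allI impI f Gb)
    fix \<eta> :: "'a \<Rightarrow> real" and b :: 'a
    assume \<eta>: "test_function D \<eta>" and b: "b \<in> Basis"
    have "integrable (lebesgue_on D) (\<lambda>y. glue u z y * dir_deriv \<eta> b y)"
        "integrable (lebesgue_on D) (\<lambda>y. (?G y \<bullet> b) * \<eta> y)"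
      using f Gb[OF b] test_function_L2[OF \<eta>] test_function_L2[OF test_function_dir_deriv[OF \<eta> b]]
      by (auto intro!: L2_mult_integrable)
    then show "(LINT y|lebesgue_on D. glue u z y * dir_deriv \<eta> b y) = - (LINT y|lebesgue_on D. (?G y \<bullet> b) * \<eta> y)"
      using pair[OF \<eta> b] by (simp add: weak_pairing_def)
  qed
qed

section \<open>Traces of the glued function on the outer boundary\<close>

text \<open>At a boundary point where \<open>D\<close> coincides locally with one of the two pieces, the trace is
  inherited from that piece.\<close>

lemma trace_at_transfer:
  assumes f: "f \<in> H1 V" and V: "open V" and t: "trace_at V f S' g x" and s: "0 < s"
    and DV: "D \<inter> ball x s = V \<inter> ball x s" and SS: "S \<inter> ball x s = S' \<inter> ball x s"
    and v: "\<And>y. y \<in> V \<Longrightarrow> v y = f y"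
  shows "trace_at D v S g x"
proof -
  obtain r \<phi> where r: "r > 0" and \<phi>: "\<And>k::nat. smooth (\<phi> k)"
    and H: "(\<lambda>k. H1_norm (V \<inter> ball x r) (\<lambda>y. \<phi> k y - f y)) \<longlonglongrightarrow> 0"
    and N: "(\<lambda>k. \<integral>\<^sup>+y\<in>S' \<inter> ball x r. ennreal ((\<phi> k y - g y)\<^sup>2) \<partial>surface_measure) \<longlonglongrightarrow> 0"
    using t unfolding trace_at_def by blast
  let ?q = "min r s"
  have D': "D \<inter> ball x ?q = V \<inter> ball x ?q" and S': "S \<inter> ball x ?q \<subseteq> S' \<inter> ball x r"
    using DV SS by (auto simp: set_eq_iff)
  have op: "open (V \<inter> ball x r)" "open (V \<inter> ball x ?q)" using V by auto
  have le: "H1_norm (D \<inter> ball x ?q) (\<lambda>y. \<phi> k y - v y) \<le> H1_norm (V \<inter> ball x r) (\<lambda>y. \<phi> k y - f y)" for k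
  proof -
    have "H1_norm (D \<inter> ball x ?q) (\<lambda>y. \<phi> k y - v y) = H1_norm (V \<inter> ball x ?q) (\<lambda>y. \<phi> k y - f y)"
      unfolding D' by (rule H1_norm_cong) (simp add: v)
    also have "\<dots> \<le> H1_norm (V \<inter> ball x r) (\<lambda>y. \<phi> k y - f y)"
    proof (rule H1_norm_mono[OF _ _ op])
      show "(\<lambda>y. \<phi> k y - f y) \<in> H1 (V \<inter> ball x r)"
        using has_weak_gradient_H1[OF smooth_has_weak_gradient[OF \<phi> op(1)]] H1_subset[OF f Int_lower1 V op(1)] op(1)
        by (intro H1_diff) (auto simp: bounded_Int)
    qed auto
    finally show ?thesis .
  qed
  have "(\<lambda>k. H1_norm (D \<inter> ball x ?q) (\<lambda>y. \<phi> k y - v y)) \<longlonglongrightarrow> 0"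
    by (rule tendsto_sandwich[OF _ _ tendsto_const H]) (auto intro!: always_eventually le H1_norm_nonneg)
  moreover have "(\<integral>\<^sup>+y\<in>S \<inter> ball x ?q. ennreal ((\<phi> k y - g y)\<^sup>2) \<partial>surface_measure) \<le>
      (\<integral>\<^sup>+y\<in>S' \<inter> ball x r. ennreal ((\<phi> k y - g y)\<^sup>2) \<partial>surface_measure)" for k
    using S' by (intro nn_integral_mono mult_left_mono) (auto simp: indicator_def)
  then have "(\<lambda>k. \<integral>\<^sup>+y\<in>S \<inter> ball x ?q. ennreal ((\<phi> k y - g y)\<^sup>2) \<partial>surface_measure) \<longlonglongrightarrow> 0"
    by (intro tendsto_sandwich[OF _ _ tendsto_const N]) (auto intro!: always_eventually)
  ultimately show ?thesis
    unfolding trace_at_def using r s \<phi> by (intro exI[of _ ?q] conjI exI[of _ \<phi>]) auto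
qed

lemma local_outer_piece:
  assumes "x \<notin> closure U"
  obtains s where "0 < s" "D \<inter> ball x s = W \<inter> ball x s" "ball x s \<inter> closure U = {}"
proof -
  have "open (- closure U)" by auto
  then obtain s where s: "0 < s" "ball x s \<subseteq> - closure U"
    using assms by (metis ComplI open_contains_ball)
  then show thesis using that[of s] by (auto simp: W_eq)
qed

text \<open>Near \<open>x\<close> the set \<open>D\<close> is connected and does not meet the interface, so that it lies in one of the two
  disjoint open pieces; it meets \<open>U\<close> because \<open>x\<close> is a boundary point of \<open>U\<close>.\<close>

lemma local_inner_piece:
  assumes DL: "bounded_lipschitz_domain D" and x: "x \<in> frontier D" "x \<in> frontier U"
    and away: "x \<notin> closure (frontier U \<inter> D)"
  obtains s where "0 < s" "D \<inter> ball x s = U \<inter> ball x s" "frontier D \<inter> ball x s \<subseteq> frontier U"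
proof -
  obtain e \<gamma> L r where gr: "lipschitz_graph e \<gamma> L" and r: "r > 0" and rep: "D \<inter> ball x r = subgraph e \<gamma> \<inter> ball x r"
    by (rule bounded_lipschitz_domainD[OF DL x(1)])
  interpret lipschitz_graph e \<gamma> L by (rule gr)
  have hx: "height x = 0" using local_frontier[OF rep D, of x] x(1) r by (simp add: graph_eq)
  have "open (- closure (frontier U \<inter> D))" by auto
  then obtain r' where r': "0 < r'" "ball x r' \<subseteq> - closure (frontier U \<inter> D)"
    using away by (metis ComplI open_contains_ball)
  have \<rho>: "0 < min r r'" "min r r' \<le> r" using r r' by auto
  obtain s C where s: "0 < s" "s \<le> min r r'" and C: "connected C" "D \<inter> ball x s \<subseteq> C" "C \<subseteq> D \<inter> ball x (min r r')"
    by (rule local_connected[OF rep hx \<rho>])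
  have CUW: "C \<subseteq> U \<union> W"
  proof
    fix y assume "y \<in> C"
    then have y: "y \<in> D" "y \<in> ball x r'" using C(3) by auto
    then have "y \<notin> frontier U" using r'(2) closure_subset[of "frontier U \<inter> D"] by blast
    then show "y \<in> U \<union> W" using y(1) by (auto simp: W_eq frontier_def interior_open[OF U])
  qed
  have "x \<in> closure U" using x(2) by (simp add: frontier_def)
  then obtain y where y: "y \<in> U" "dist y x < s" using s(1) by (auto simp: closure_approachable)
  then have yC: "y \<in> U \<inter> C" using UD C(2) by (auto simp: dist_commute)
  have "C \<inter> W = {}"
  proof (rule ccontr)
    assume "C \<inter> W \<noteq> {}"
    then show False
      using connectedD[OF C(1) U W _ CUW] disjoint yC by blast
  qed
  then have eq: "D \<inter> ball x s = U \<inter> ball x s" using C(2) CUW UD by blast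
  have "frontier D \<inter> ball x s \<subseteq> frontier U"
  proof
    fix y assume y: "y \<in> frontier D \<inter> ball x s"
    then have "y \<in> ball x s \<inter> closure D" by (simp add: frontier_def)
    then have "y \<in> closure (ball x s \<inter> D)" using open_Int_closure_subset[OF open_ball] by blast
    also have "\<dots> \<subseteq> closure U" using eq by (intro closure_mono) auto
    finally have "y \<in> closure U" .
    moreover have "y \<notin> U" using y UD by (auto simp: frontier_def interior_open[OF D])
    ultimately show "y \<in> frontier U" by (simp add: frontier_def interior_open[OF U])
  qed
  then show thesis using that[of s] s(1) eq by blast
qed

end

section \<open>Functions of time with values in the glued space\<close>

text \<open>Lebesgue measure is complete: if one side is not measurable, neither is the other, and both
  integrals are zero.\<close>

lemma
  fixes f g :: "'a::euclidean_space \<Rightarrow> real"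
  assumes "AE x in lebesgue. f x = g x"
  shows lebesgue_integrable_cong_AE: "integrable lebesgue f \<longleftrightarrow> integrable lebesgue g"
    and lebesgue_integral_cong_AE: "(LINT x|lebesgue. f x) = (LINT x|lebesgue. g x)"
proof -
  have sym: "AE x in lebesgue. g x = f x" using assms by eventually_elim simp
  show *: "integrable lebesgue f \<longleftrightarrow> integrable lebesgue g"
    using borel_measurable_AE[OF _ assms] borel_measurable_AE[OF _ sym] integrable_cong_AE[OF _ _ assms]
    by (meson borel_measurable_integrable)
  show "(LINT x|lebesgue. f x) = (LINT x|lebesgue. g x)"
  proof (cases "integrable lebesgue f")
    case True
    then show ?thesis using * assms by (intro integral_cong_AE) auto
  next
    case False
    then show ?thesis using * by (simp add: not_integrable_integral_eq)
  qed
qed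

lemma lint_on_cong_AE:
  fixes f g :: "'a::euclidean_space \<Rightarrow> real"
  assumes U: "U \<in> sets lebesgue" and "AE x in lebesgue_on U. f x = g x"
  shows "(LINT x|lebesgue_on U. f x) = (LINT x|lebesgue_on U. g x)"
  unfolding lint_indicator[OF U]
  using assms(2) unfolding AE_lebesgue_on_iff[OF U]
  by (intro lebesgue_integral_cong_AE) (auto simp: indicator_def elim!: eventually_mono)

lemma set_integrable_cong_AE_positive:
  fixes f g :: "real \<Rightarrow> real"
  assumes "AE t in lebesgue_on {0<..}. f t = g t" "0 < a" "set_integrable lebesgue {a..b} f"
  shows "set_integrable lebesgue {a..b} g"
proof -
  have "AE t in lebesgue. indicator {a..b} t *\<^sub>R f t = indicator {a..b} t *\<^sub>R g t"
  proof -
    have "{0::real<..} \<in> sets lebesgue" by simp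
    from assms(1)[unfolded AE_lebesgue_on_iff[OF this]] show ?thesis
      by eventually_elim (use assms(2) in \<open>auto simp: indicator_def\<close>)
  qed
  from lebesgue_integrable_cong_AE[OF this[unfolded real_scaleR_def]] show ?thesis
    using assms(3) unfolding set_integrable_def real_scaleR_def by (rule iffD1)
qed

lemma distributional_deriv_cong:
  assumes d: "distributional_deriv A B" and A: "\<And>t. 0 < t \<Longrightarrow> A t = A' t"
    and B: "AE t in lebesgue_on {0<..}. B t = B' t"
  shows "distributional_deriv A' B'"
  unfolding distributional_deriv_def
proof (intro conjI allI impI)
  fix a b :: real assume ab: "0 < a" "a \<le> b"
  have i: "set_integrable lebesgue {a..b} A" "set_integrable lebesgue {a..b} B"
    using d ab unfolding distributional_deriv_def by blast+
  have "AE t in lebesgue_on {0<..}. A t = A' t"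
    using A by (intro AE_I2) (simp add: space_restrict_space)
  then show "set_integrable lebesgue {a..b} A'"
    by (rule set_integrable_cong_AE_positive[OF _ ab(1) i(1)])
  show "set_integrable lebesgue {a..b} B'"
    by (rule set_integrable_cong_AE_positive[OF B ab(1) i(2)])
next
  fix \<eta> :: "real \<Rightarrow> real" assume \<eta>: "test_function {0<..} \<eta>"
  have "(LINT t|lebesgue_on {0<..}. A' t * deriv \<eta> t) = (LINT t|lebesgue_on {0<..}. A t * deriv \<eta> t)"
    using A by (intro Bochner_Integration.integral_cong) (auto simp: space_restrict_space)
  also have "\<dots> = - (LINT t|lebesgue_on {0<..}. B t * \<eta> t)"
    using d \<eta> unfolding distributional_deriv_def by blast
  also have "(LINT t|lebesgue_on {0<..}. B t * \<eta> t) = (LINT t|lebesgue_on {0<..}. B' t * \<eta> t)"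
    using B by (intro lint_on_cong_AE) (auto elim!: eventually_mono)
  finally show "(LINT t|lebesgue_on {0<..}. A' t * deriv \<eta> t) = - (LINT t|lebesgue_on {0<..}. B' t * \<eta> t)" .
qed

lemma L2_norm_nonneg: "0 \<le> L2_norm U f"
  by (simp add: L2_norm_def)

lemma L2_norm_cong:
  assumes "\<And>x. x \<in> U \<Longrightarrow> f x = g x"
  shows "L2_norm U f = L2_norm U g"
proof -
  have "(LINT x|lebesgue_on U. (f x)\<^sup>2) = (LINT x|lebesgue_on U. (g x)\<^sup>2)"
    using assms by (intro Bochner_Integration.integral_cong) (auto simp: space_restrict_space)
  then show ?thesis by (simp add: L2_norm_def)
qed

lemma L2_norm_cong_AE:
  assumes "U \<in> sets lebesgue" "AE x in lebesgue_on U. f x = g x"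
  shows "L2_norm U f = L2_norm U g"
proof -
  have "AE x in lebesgue_on U. (f x)\<^sup>2 = (g x)\<^sup>2" using assms(2) by eventually_elim simp
  then show ?thesis using lint_on_cong_AE[OF assms(1)] by (simp add: L2_norm_def)
qed

lemma H1_norm_minus_commute:
  assumes "f \<in> H1 U" "g \<in> H1 U" "open U"
  shows "H1_norm U (\<lambda>x. f x - g x) = H1_norm U (\<lambda>x. g x - f x)"
proof -
  note F = H1_has_weak_gradient[OF assms(1)] and G = H1_has_weak_gradient[OF assms(2)]
  have "(H1_norm U (\<lambda>x. f x - g x))\<^sup>2 = (H1_norm U (\<lambda>x. g x - f x))\<^sup>2"
    unfolding H1_norm_square[OF has_weak_gradient_diff[OF F G assms(3)] assms(3)]
      H1_norm_square[OF has_weak_gradient_diff[OF G F assms(3)] assms(3)]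
    by (simp add: power2_commute inner_diff_left)
  then show ?thesis by (rule power2_eq_imp_eq) (auto simp: H1_norm_nonneg)
qed

lemma zero_H1: "(\<lambda>x. 0) \<in> H1 U"
  by (rule has_weak_gradient_H1[of _ _ "\<lambda>x. 0"]) (simp add: has_weak_gradient_def L2_def)

lemma le_add_if_square_sum:
  fixes a b c :: real
  assumes "c\<^sup>2 = a\<^sup>2 + b\<^sup>2" "0 \<le> a" "0 \<le> b"
  shows "c \<le> a + b"
proof (rule power2_le_imp_le)
  show "c\<^sup>2 \<le> (a + b)\<^sup>2" using mult_nonneg_nonneg[OF assms(2,3)] assms(1) unfolding power2_sum by linarith
qed (use assms(2,3) in simp)

context two_pieces
begin

lemma AE_pieces:
  assumes "AE x in lebesgue_on U. Q x" "AE x in lebesgue_on W. Q x"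
  shows "AE x in lebesgue_on D. Q x"
  using assms AE_not_in[OF null] by (auto simp: AE_lebesgue_on_iff)

lemma continuous_L2_glue:
  assumes u: "continuous_L2 U u" and z: "continuous_L2 W z"
  shows "continuous_L2 D (\<lambda>t. glue (u t) (z t))"
  unfolding continuous_L2_def
proof (intro allI impI conjI)
  fix t :: real assume t: "0 \<le> t"
  have L: "u s \<in> L2 U" "z s \<in> L2 W" if "0 \<le> s" for s
    using u z that by (auto simp: continuous_L2_def)
  show "glue (u t) (z t) \<in> L2 D" using L[OF t] by (rule glue_L2)
  have lim: "((\<lambda>s. L2_norm U (\<lambda>x. u s x - u t x) + L2_norm W (\<lambda>x. z s x - z t x)) \<longlongrightarrow> 0 + 0) (at t within {0..})"
    using u z t by (intro tendsto_add) (auto simp: continuous_L2_def)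
  have le: "L2_norm D (\<lambda>x. glue (u s) (z s) x - glue (u t) (z t) x) \<le>
      L2_norm U (\<lambda>x. u s x - u t x) + L2_norm W (\<lambda>x. z s x - z t x)" if s: "0 \<le> s" for s
  proof -
    let ?d = "\<lambda>x. glue (u s) (z s) x - glue (u t) (z t) x"
    have "?d \<in> L2 U" "?d \<in> L2 W"
      using L[OF s] L[OF t] by (auto intro!: L2_diff glue_L2)
    then have "(L2_norm D ?d)\<^sup>2 = (L2_norm U ?d)\<^sup>2 + (L2_norm W ?d)\<^sup>2" by (rule L2_norm_split)
    moreover have "L2_norm U ?d = L2_norm U (\<lambda>x. u s x - u t x)" by (rule L2_norm_cong) (simp add: glue_U)
    moreover have "L2_norm W ?d = L2_norm W (\<lambda>x. z s x - z t x)" by (rule L2_norm_cong) (simp add: glue_W)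
    ultimately show ?thesis by (intro le_add_if_square_sum) (auto simp: L2_norm_nonneg)
  qed
  show "((\<lambda>s. L2_norm D (\<lambda>x. glue (u s) (z s) x - glue (u t) (z t) x)) \<longlongrightarrow> 0) (at t within {0..})"
  proof (rule tendsto_sandwich[OF _ _ tendsto_const])
    show "((\<lambda>s. L2_norm U (\<lambda>x. u s x - u t x) + L2_norm W (\<lambda>x. z s x - z t x)) \<longlongrightarrow> 0) (at t within {0..})"
      using lim by simp
    show "\<forall>\<^sub>F s in at t within {0..}. L2_norm D (\<lambda>x. glue (u s) (z s) x - glue (u t) (z t) x) \<le>
        L2_norm U (\<lambda>x. u s x - u t x) + L2_norm W (\<lambda>x. z s x - z t x)"
      using le by (simp add: eventually_at_filter)
  qed (simp add: L2_norm_nonneg)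
qed

text \<open>Strong measurability into \<open>H\<^sup>1(D)\<close>, a closed subspace of \<open>H\<^sup>1(U) \<times> H\<^sup>1(W)\<close>: the simple
  approximants of the pair need not lie in the subspace, but composing the \<open>k\<close>-th one with a map to
  a \<open>1 / (k + 1)\<close>-nearest point of the subspace gives simple approximants that do.\<close>

lemma L2_loc_H1_glue:
  assumes u: "L2_loc_H1 U u" and z: "L2_loc_H1 W z"
    and ae: "AE t in lebesgue_on {0<..}. glue (u t) (z t) \<in> H1 D"
  shows "L2_loc_H1 D (\<lambda>t. glue (u t) (z t))"
proof -
  let ?v = "\<lambda>t. glue (u t) (z t)"
  have aeu: "AE t in lebesgue_on {0<..}. u t \<in> H1 U" and aez: "AE t in lebesgue_on {0<..}. z t \<in> H1 W"
    using u z by (auto simp: L2_loc_H1_def)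
  obtain su where su: "\<And>k::nat. simple_function (lebesgue_on {0<..}) (su k)" "\<And>k t. t > 0 \<Longrightarrow> su k t \<in> H1 U"
    "AE t in lebesgue_on {0<..}. (\<lambda>k. H1_norm U (\<lambda>x. su k t x - u t x)) \<longlonglongrightarrow> 0"
    using u unfolding L2_loc_H1_def by blast
  obtain sz where sz: "\<And>k::nat. simple_function (lebesgue_on {0<..}) (sz k)" "\<And>k t. t > 0 \<Longrightarrow> sz k t \<in> H1 W"
    "AE t in lebesgue_on {0<..}. (\<lambda>k. H1_norm W (\<lambda>x. sz k t x - z t x)) \<longlonglongrightarrow> 0"
    using z unfolding L2_loc_H1_def by blast
  define d where "d w q = H1_norm U (\<lambda>x. q x - w x) + H1_norm W (\<lambda>x. q x - w x)" for w q :: "'a \<Rightarrow> real"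
  have d0: "0 \<le> d w q" for w q by (simp add: d_def H1_norm_nonneg)
  define p where "p k w = (SOME q. q \<in> H1 D \<and> d w q < Inf (d w ` H1 D) + inverse (real (Suc k)))" for k w
  have p: "p k w \<in> H1 D \<and> d w (p k w) < Inf (d w ` H1 D) + inverse (real (Suc k))" for k w
  proof -
    have "\<exists>y\<in>d w ` H1 D. y < Inf (d w ` H1 D) + inverse (real (Suc k))"
      using zero_H1[of D] by (intro cInf_lessD) auto
    then have "\<exists>q. q \<in> H1 D \<and> d w q < Inf (d w ` H1 D) + inverse (real (Suc k))" by blast
    then show ?thesis unfolding p_def by (rule someI_ex)
  qed
  have p_le: "d w (p k w) \<le> d w q + inverse (real (Suc k))" if "q \<in> H1 D" for k w q
  proof -
    have "Inf (d w ` H1 D) \<le> d w q"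
      using that d0 by (intro cInf_lower) (auto intro: bdd_belowI[of _ 0])
    then show ?thesis using p[of k w] by linarith
  qed
  let ?w = "\<lambda>k t. glue (su k t) (sz k t)"
  let ?s = "\<lambda>k t. p k (?w k t)"
  have simple: "simple_function (lebesgue_on {0<..}) (?s k)" for k
    by (rule simple_function_compose2[OF su(1) sz(1), where h="\<lambda>a b. p k (glue a b)"])
  have pos: "AE t in lebesgue_on {0<..}. 0 < (t::real)"
    by (intro AE_I2) (simp add: space_restrict_space)
  have conv: "AE t in lebesgue_on {0<..}. (\<lambda>k. H1_norm D (\<lambda>x. ?s k t x - ?v t x)) \<longlonglongrightarrow> 0"
    using ae aeu aez su(3) sz(3) pos
  proof eventually_elim
    case (elim t)
    have v: "?v t \<in> H1 D" "?v t \<in> H1 U" "?v t \<in> H1 W"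
      using elim(1) H1_subset[OF elim(1) UD D U] H1_subset[OF elim(1) WD D W] by auto
    have w: "?w k t \<in> H1 U" "?w k t \<in> H1 W" for k
    proof -
      show "?w k t \<in> H1 U" using su(2)[OF elim(6), of k] H1_cong[of U "?w k t" "su k t"] by (simp add: glue_U)
      show "?w k t \<in> H1 W" using sz(2)[OF elim(6), of k] H1_cong[of W "?w k t" "sz k t"] by (simp add: glue_W)
    qed
    have s: "?s k t \<in> H1 D" "?s k t \<in> H1 U" "?s k t \<in> H1 W" for k
    proof -
      show "?s k t \<in> H1 D" using p by blast
      then show "?s k t \<in> H1 U" "?s k t \<in> H1 W" using UD WD U W D by (auto intro: H1_subset)
    qed
    define e where "e k = H1_norm U (\<lambda>x. su k t x - u t x) + H1_norm W (\<lambda>x. sz k t x - z t x)" for k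
    have eU: "H1_norm U (\<lambda>x. ?w k t x - ?v t x) = H1_norm U (\<lambda>x. su k t x - u t x)" for k
      by (rule H1_norm_cong) (simp add: glue_U)
    have eW: "H1_norm W (\<lambda>x. ?w k t x - ?v t x) = H1_norm W (\<lambda>x. sz k t x - z t x)" for k
      by (rule H1_norm_cong) (simp add: glue_W)
    have dv: "d (?w k t) (?v t) = e k" for k
      unfolding d_def e_def eU[symmetric] eW[symmetric]
      using H1_norm_minus_commute[OF v(2) w(1) U] H1_norm_minus_commute[OF v(3) w(2) W] by simp
    have le: "H1_norm D (\<lambda>x. ?s k t x - ?v t x) \<le> 2 * (e k + inverse (real (Suc k))) + 2 * e k" for k
    proof -
      have "H1_norm D (\<lambda>x. ?s k t x - ?v t x) \<le>
          H1_norm U (\<lambda>x. ?s k t x - ?v t x) + H1_norm W (\<lambda>x. ?s k t x - ?v t x)"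
        using H1_norm_split[OF H1_diff[OF s(1) v(1) D]]
        by (rule le_add_if_square_sum) (auto simp: H1_norm_nonneg)
      also have "\<dots> \<le> 2 * (H1_norm U (\<lambda>x. ?s k t x - ?w k t x) + H1_norm U (\<lambda>x. ?w k t x - ?v t x))
          + 2 * (H1_norm W (\<lambda>x. ?s k t x - ?w k t x) + H1_norm W (\<lambda>x. ?w k t x - ?v t x))"
        by (intro add_mono H1_norm_quasi_triangle s v w U W)
      also have "\<dots> = 2 * d (?w k t) (?s k t) + 2 * e k"
        unfolding eU eW d_def e_def by simp
      also have "\<dots> \<le> 2 * (e k + inverse (real (Suc k))) + 2 * e k"
        using p_le[OF v(1), of "?w k t" k] unfolding dv by simp
      finally show ?thesis .
    qed
    have e0: "e \<longlonglongrightarrow> 0"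
      using tendsto_add[OF elim(4,5)] unfolding e_def add_0_left .
    have "(\<lambda>k. 2 * (e k + inverse (real (Suc k))) + 2 * e k) \<longlonglongrightarrow> 2 * (0 + 0) + 2 * 0"
      by (intro tendsto_add tendsto_mult_left e0 LIMSEQ_inverse_real_of_nat)
    then have lim: "(\<lambda>k. 2 * (e k + inverse (real (Suc k))) + 2 * e k) \<longlonglongrightarrow> 0" by simp
    show ?case
    proof (rule tendsto_sandwich[OF _ _ tendsto_const lim])
      show "\<forall>\<^sub>F k in sequentially. 0 \<le> H1_norm D (\<lambda>x. ?s k t x - ?v t x)"
        by (intro always_eventually allI H1_norm_nonneg)
      show "\<forall>\<^sub>F k in sequentially. H1_norm D (\<lambda>x. ?s k t x - ?v t x) \<le> 2 * (e k + inverse (real (Suc k))) + 2 * e k"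
        by (intro always_eventually allI le)
    qed
  qed
  have norm_eq: "AE t in lebesgue_on {0<..}. (H1_norm U (u t))\<^sup>2 + (H1_norm W (z t))\<^sup>2 = (H1_norm D (?v t))\<^sup>2"
    using ae
  proof eventually_elim
    case (elim t)
    have "H1_norm U (?v t) = H1_norm U (u t)" "H1_norm W (?v t) = H1_norm W (z t)"
      by (rule H1_norm_cong, simp add: glue_U, rule H1_norm_cong, simp add: glue_W)
    then show ?case using H1_norm_split[OF elim] by simp
  qed
  have si: "set_integrable lebesgue {a..b} (\<lambda>t. (H1_norm D (?v t))\<^sup>2)" if "0 < a" "a \<le> b" for a b
  proof (rule set_integrable_cong_AE_positive[OF norm_eq that(1)])
    show "set_integrable lebesgue {a..b} (\<lambda>t. (H1_norm U (u t))\<^sup>2 + (H1_norm W (z t))\<^sup>2)"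
      using u z that unfolding L2_loc_H1_def by (intro set_integral_add) blast+
  qed
  show ?thesis
    unfolding L2_loc_H1_def
  proof (intro conjI exI[of _ ?s] allI impI)
    show "?s k t \<in> H1 D" for k and t :: real using p by blast
  qed (fact ae simple conv | rule si, assumption+)+
qed

lemma weak_gradient_glue_inner:
  assumes v: "glue u z \<in> H1 D" and \<phi>: "\<phi> \<in> H1 D"
  shows "(LINT x|lebesgue_on D. weak_gradient D (glue u z) x \<bullet> weak_gradient D \<phi> x) =
    (LINT x|lebesgue_on U. weak_gradient U u x \<bullet> weak_gradient D \<phi> x) +
    (LINT x|lebesgue_on W. weak_gradient W z x \<bullet> weak_gradient D \<phi> x)"
proof -
  let ?G = "weak_gradient D (glue u z)" let ?H = "weak_gradient D \<phi>"
  have G: "has_weak_gradient D (glue u z) ?G" and H: "has_weak_gradient D \<phi> ?H"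
    using v \<phi> by (auto intro: H1_has_weak_gradient)
  have piece: "integrable (lebesgue_on V) (\<lambda>x. ?G x \<bullet> ?H x) \<and>
      (LINT x|lebesgue_on V. ?G x \<bullet> ?H x) = (LINT x|lebesgue_on V. weak_gradient V f x \<bullet> ?H x)"
    if V: "open V" "V \<subseteq> D" and f: "\<And>x. x \<in> V \<Longrightarrow> glue u z x = f x" for V f
  proof
    have GV: "has_weak_gradient V (glue u z) ?G" and HV: "has_weak_gradient V \<phi> ?H"
      using G H V D by (auto intro: has_weak_gradient_subset)
    have "integrable (lebesgue_on V) (\<lambda>x. \<Sum>b\<in>Basis. (?G x \<bullet> b) * (?H x \<bullet> b))"
      by (intro Bochner_Integration.integrable_sum L2_mult_integrable has_weak_gradient_component[OF GV] has_weak_gradient_component[OF HV])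
    then show "integrable (lebesgue_on V) (\<lambda>x. ?G x \<bullet> ?H x)"
      by (simp only: euclidean_inner[symmetric])
    have fG: "has_weak_gradient V f ?G" using GV has_weak_gradient_cong[of V "glue u z" f, OF f] by simp
    have "AE x in lebesgue_on V. ?G x = weak_gradient V f x"
      by (rule has_weak_gradient_unique[OF fG H1_has_weak_gradient[OF has_weak_gradient_H1[OF fG]] V(1)])
    then have "AE x in lebesgue_on V. ?G x \<bullet> ?H x = weak_gradient V f x \<bullet> ?H x" by eventually_elim simp
    then show "(LINT x|lebesgue_on V. ?G x \<bullet> ?H x) = (LINT x|lebesgue_on V. weak_gradient V f x \<bullet> ?H x)"
      by (rule lint_on_cong_AE[OF open_lebesgue[OF V(1)]])
  qed
  show ?thesis
    using piece[OF U UD glue_U] piece[OF W WD glue_W] by (simp add: lint_split)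
qed

lemma lint_glue_mult:
  assumes "u \<in> L2 U" "z \<in> L2 W" "\<phi> \<in> L2 D"
  shows "(LINT x|lebesgue_on D. glue u z x * \<phi> x) =
    (LINT x|lebesgue_on U. u x * \<phi> x) + (LINT x|lebesgue_on W. z x * \<phi> x)"
proof -
  have \<phi>: "\<phi> \<in> L2 U" "\<phi> \<in> L2 W" using assms(3) UD WD by (auto intro: L2_subset)
  have "integrable (lebesgue_on U) (\<lambda>x. glue u z x * \<phi> x)" "integrable (lebesgue_on W) (\<lambda>x. glue u z x * \<phi> x)"
    using glue_L2[OF assms(1,2)] \<phi> by (auto intro: L2_mult_integrable)
  then have "(LINT x|lebesgue_on D. glue u z x * \<phi> x) =
      (LINT x|lebesgue_on U. glue u z x * \<phi> x) + (LINT x|lebesgue_on W. glue u z x * \<phi> x)"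
    by (rule lint_split)
  also have "(LINT x|lebesgue_on U. glue u z x * \<phi> x) = (LINT x|lebesgue_on U. u x * \<phi> x)"
    by (intro Bochner_Integration.integral_cong) (auto simp: space_restrict_space glue_U)
  also have "(LINT x|lebesgue_on W. glue u z x * \<phi> x) = (LINT x|lebesgue_on W. z x * \<phi> x)"
    by (intro Bochner_Integration.integral_cong) (auto simp: space_restrict_space glue_W)
  finally show ?thesis .
qed

end

section \<open>The coupled system is the target closed loop\<close>

lemma compatible_lipschitz_interface:
  fixes P :: "'a::euclidean_space plant"
  assumes "2 \<le> DIM('a)" "plant_config P" "target_config T" "compatible P T"
  shows "lipschitz_interface (\<Omega> P) (\<Omega>e P T) (D T)"
proof -
  have \<Omega>: "bounded_lipschitz_domain (\<Omega> P)" "bounded_lipschitz_domain (D T)" "\<Omega> P \<subseteq> D T"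
    using assms by (auto simp: plant_config_def target_config_def compatible_def)
  have op: "open (\<Omega> P)" "open (D T)" using \<Omega> by (auto intro: bounded_lipschitz_domain_open)
  have "D T - (\<Omega> P \<union> \<Omega>e P T) \<subseteq> frontier (\<Omega> P)"
    using op by (auto simp: \<Omega>e_def frontier_def interior_open)
  then have "D T - (\<Omega> P \<union> \<Omega>e P T) \<in> null_sets lebesgue"
    using frontier_lipschitz_null[OF \<Omega>(1)] by (rule completion.complete2)
  moreover have "\<Omega> P \<inter> \<Omega>e P T = {}" using closure_subset[of "\<Omega> P"] by (auto simp: \<Omega>e_def)
  moreover have "open (\<Omega>e P T)" unfolding \<Omega>e_def using op by (intro open_Diff closed_closure)
  ultimately show ?thesis
    using assms(1) \<Omega> op by unfold_locales (auto simp: \<Omega>e_def)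
qed

text \<open>The feedback term and the controlled boundary condition carry over literally, because the law of the
  coupled system is evaluated at the concatenated state. On the controlled and the purely virtual part of
  \<open>\<partial>D\<close> the trace comes from \<open>z\<close>, on \<open>\<Gamma>\<^sub>u\<close> from \<open>u\<close>; the boundary points in the closure of the
  interface, near which both pieces may be present, have surface measure zero by compatibility.\<close>

lemma coupled_solution_imp_target_solution:
  fixes P :: "'a::euclidean_space plant"
  assumes dim: "2 \<le> DIM('a)" and plant: "plant_config P" and target: "target_config T" and compat: "compatible P T"
    and sol: "coupled_solution \<epsilon> lam P T u0 z0 u z"
  shows "target_solution \<epsilon> lam T (concat_state P u0 z0) (\<lambda>t. concat_state P (u t) (z t))"
proof -
  interpret lipschitz_interface "\<Omega> P" "\<Omega>e P T" "D T"
    by (rule compatible_lipschitz_interface[OF dim plant target compat])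
  have cs: "concat_state P a b = glue a b" for a b :: "'a \<Rightarrow> real"
    by (simp add: concat_state_def glue_def)
  let ?v = "\<lambda>t. glue (u t) (z t)"
  have S: "frontier (D T) = \<Sigma>u T \<union> \<Sigma>c T" "\<Sigma>u T \<inter> \<Sigma>c T = {}" "\<Sigma>u_dir T \<subseteq> \<Sigma>u T"
    "bounded_lipschitz_domain (D T)"
    using target by (auto simp: target_config_def)
  have C: "closure (interface P T) \<inter> frontier (D T) \<in> null_sets surface_measure"
    "\<Gamma>u P = frontier (\<Omega> P) \<inter> frontier (D T)" "\<Gamma>u P \<subseteq> \<Sigma>u T" "\<Gamma>u_dir P = \<Gamma>u P \<inter> \<Sigma>u_dir T"
    using compat by (auto simp: compatible_def)
  have sol': "continuous_L2 (\<Omega> P) u" "L2_loc_H1 (\<Omega> P) u" "continuous_L2 (\<Omega>e P T) z" "L2_loc_H1 (\<Omega>e P T) z"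
    "AE x in lebesgue_on (\<Omega> P). u 0 x = u0 x" "AE x in lebesgue_on (\<Omega>e P T). z 0 x = z0 x"
    using sol by (auto simp: coupled_solution_def)
  have traces: "AE t in lebesgue_on {0<..}.
        (\<exists>g. has_trace (\<Omega> P) (u t) (interface P T) g \<and> has_trace (\<Omega>e P T) (z t) (interface P T) g) \<and>
        has_trace (\<Omega> P) (u t) (\<Gamma>u_dir P) (\<lambda>_. 0) \<and>
        has_trace (\<Omega>e P T) (z t) (\<Sigma>u_dir T - \<Gamma>u P) (\<lambda>_. 0) \<and>
        (\<forall>F. law T = Dirichlet_law F \<longrightarrow> has_trace (\<Omega>e P T) (z t) (\<Sigma>c T) (F (?v t)))"
    using sol unfolding coupled_solution_def cs by blast
  have H1: "glue a b \<in> H1 (D T)"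
    if "has_trace (\<Omega> P) a (interface P T) g" "has_trace (\<Omega>e P T) b (interface P T) g" for a b g
    using that unfolding interface_def by (intro has_weak_gradient_H1[OF glue_has_weak_gradient])
  have ae_H1: "AE t in lebesgue_on {0<..}. ?v t \<in> H1 (D T)"
    using traces by eventually_elim (use H1 in blast)
  have outer: "trace_at (D T) (glue a b) S g x"
    if x: "x \<in> frontier (D T)" "x \<notin> \<Gamma>u P" and b: "b \<in> H1 (\<Omega>e P T)" and t: "trace_at (\<Omega>e P T) b S' g x"
      and SS: "S - \<Gamma>u P = S' - \<Gamma>u P" for a b S S' g x
  proof -
    have "x \<notin> D T" using x(1) D by (simp add: frontier_def interior_open)
    then have "x \<notin> closure (\<Omega> P)" using x C(2) UD U by (auto simp: frontier_def interior_open)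
    then obtain s where s: "0 < s" "D T \<inter> ball x s = \<Omega>e P T \<inter> ball x s" "ball x s \<inter> closure (\<Omega> P) = {}"
      by (rule local_outer_piece)
    have "S \<inter> ball x s = S' \<inter> ball x s"
      using SS s(3) C(2) by (auto simp: frontier_def)
    then show ?thesis
      by (rule trace_at_transfer[where v="glue a b", OF b W t s(1,2)]) (rule glue_W)
  qed
  have tu: "has_trace (D T) (glue a b) (\<Sigma>u_dir T) (\<lambda>_. 0)"
    if v: "glue a b \<in> H1 (D T)" and a: "has_trace (\<Omega> P) a (\<Gamma>u_dir P) (\<lambda>_. 0)"
      and b: "has_trace (\<Omega>e P T) b (\<Sigma>u_dir T - \<Gamma>u P) (\<lambda>_. 0)" for a b
  proof -
    have "AE x in surface_measure. x \<in> \<Sigma>u_dir T \<longrightarrow> trace_at (D T) (glue a b) (\<Sigma>u_dir T) (\<lambda>_. 0) x"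
      using has_trace_trace_at(3)[OF a] has_trace_trace_at(3)[OF b] AE_not_in[OF C(1)]
    proof eventually_elim
      case (elim x)
      show ?case
      proof
        assume x: "x \<in> \<Sigma>u_dir T"
        then have xD: "x \<in> frontier (D T)" using S by blast
        show "trace_at (D T) (glue a b) (\<Sigma>u_dir T) (\<lambda>_. 0) x"
        proof (cases "x \<in> \<Gamma>u P")
          case True
          have "x \<in> frontier (\<Omega> P)" "x \<notin> closure (frontier (\<Omega> P) \<inter> D T)"
            using True C(2) elim(3) xD by (auto simp: interface_def)
          then obtain s where s: "0 < s" "D T \<inter> ball x s = \<Omega> P \<inter> ball x s" "frontier (D T) \<inter> ball x s \<subseteq> frontier (\<Omega> P)"
            using local_inner_piece[OF S(4) xD] by metis
          have "\<Sigma>u_dir T \<inter> ball x s = \<Gamma>u_dir P \<inter> ball x s"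
            using s(3) S(1,3) C(2,4) by blast
          moreover have "trace_at (\<Omega> P) a (\<Gamma>u_dir P) (\<lambda>_. 0) x" using elim(1) True x C(4) by blast
          ultimately show ?thesis
            using trace_at_transfer[where v="glue a b", OF has_trace_trace_at(1)[OF a] U _ s(1,2)] glue_U by blast
        next
          case False
          then have "trace_at (\<Omega>e P T) b (\<Sigma>u_dir T - \<Gamma>u P) (\<lambda>_. 0) x" using elim(2) x by blast
          then show ?thesis
            using outer[OF xD False has_trace_trace_at(1)[OF b], of "\<Sigma>u_dir T - \<Gamma>u P"] by blast
        qed
      qed
    qed
    then show ?thesis using v by (simp add: has_trace_def trace_at_def)
  qed
  have tc: "has_trace (D T) (glue a b) (\<Sigma>c T) g"
    if v: "glue a b \<in> H1 (D T)" and b: "has_trace (\<Omega>e P T) b (\<Sigma>c T) g" for a b g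
  proof -
    have "AE x in surface_measure. x \<in> \<Sigma>c T \<longrightarrow> trace_at (D T) (glue a b) (\<Sigma>c T) g x"
      using has_trace_trace_at(3)[OF b]
    proof eventually_elim
      case (elim x)
      then show ?case
        using outer[OF _ _ has_trace_trace_at(1)[OF b], of x "\<Sigma>c T" g] S(1,2) C(3) by blast
    qed
    then show ?thesis using v has_trace_trace_at(2)[OF b] by (simp add: has_trace_def trace_at_def)
  qed
  have "AE x in lebesgue_on (D T). ?v 0 x = glue u0 z0 x"
  proof (rule AE_pieces)
    show "AE x in lebesgue_on (\<Omega> P). ?v 0 x = glue u0 z0 x"
      using sol'(5) by (auto simp: AE_lebesgue_on_iff glue_U elim!: eventually_mono)
    show "AE x in lebesgue_on (\<Omega>e P T). ?v 0 x = glue u0 z0 x"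
      using sol'(6) by (auto simp: AE_lebesgue_on_iff glue_W elim!: eventually_mono)
  qed
  moreover have "AE t in lebesgue_on {0<..}.
        has_trace (D T) (?v t) (\<Sigma>u_dir T) (\<lambda>_. 0) \<and>
        (\<forall>F. law T = Dirichlet_law F \<longrightarrow> has_trace (D T) (?v t) (\<Sigma>c T) (F (?v t)))"
    using traces by eventually_elim (use H1 tu tc in blast)
  moreover have "distributional_deriv
        (\<lambda>t. LINT x|lebesgue_on (D T). ?v t x * \<phi> x)
        (\<lambda>t. - \<epsilon> * (LINT x|lebesgue_on (D T). weak_gradient (D T) (?v t) x \<bullet> weak_gradient (D T) \<phi> x)
             + lam * (LINT x|lebesgue_on (D T). ?v t x * \<phi> x)
             + \<epsilon> * neumann_term T (?v t) \<phi>)" if \<phi>: "\<phi> \<in> VD T" for \<phi>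
  proof -
    have \<phi>H: "\<phi> \<in> H1 (D T)" using \<phi> by (simp add: VD_def)
    have mult: "(LINT x|lebesgue_on (\<Omega> P). u t x * \<phi> x) + (LINT x|lebesgue_on (\<Omega>e P T). z t x * \<phi> x) =
        (LINT x|lebesgue_on (D T). ?v t x * \<phi> x)" if "0 < t" for t
      using lint_glue_mult[OF _ _ H1_L2[OF \<phi>H], of "u t" "z t"] sol'(1,3) that by (simp add: continuous_L2_def)
    have pos: "AE t in lebesgue_on {0<..}. 0 < (t::real)"
      by (intro AE_I2) (simp add: space_restrict_space)
    show ?thesis
    proof (rule distributional_deriv_cong[OF _ mult])
      show "distributional_deriv
        (\<lambda>t. (LINT x|lebesgue_on (\<Omega> P). u t x * \<phi> x) + (LINT x|lebesgue_on (\<Omega>e P T). z t x * \<phi> x))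
        (\<lambda>t. - \<epsilon> * ((LINT x|lebesgue_on (\<Omega> P).
                        weak_gradient (\<Omega> P) (u t) x \<bullet> weak_gradient (D T) \<phi> x)
                   + (LINT x|lebesgue_on (\<Omega>e P T).
                        weak_gradient (\<Omega>e P T) (z t) x \<bullet> weak_gradient (D T) \<phi> x))
             + lam * ((LINT x|lebesgue_on (\<Omega> P). u t x * \<phi> x)
                    + (LINT x|lebesgue_on (\<Omega>e P T). z t x * \<phi> x))
             + \<epsilon> * neumann_term T (?v t) \<phi>)"
        using sol \<phi> unfolding coupled_solution_def cs by blast
      show "AE t in lebesgue_on {0<..}. - \<epsilon> * ((LINT x|lebesgue_on (\<Omega> P).
                        weak_gradient (\<Omega> P) (u t) x \<bullet> weak_gradient (D T) \<phi> x)
                   + (LINT x|lebesgue_on (\<Omega>e P T).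
                        weak_gradient (\<Omega>e P T) (z t) x \<bullet> weak_gradient (D T) \<phi> x))
             + lam * ((LINT x|lebesgue_on (\<Omega> P). u t x * \<phi> x)
                    + (LINT x|lebesgue_on (\<Omega>e P T). z t x * \<phi> x))
             + \<epsilon> * neumann_term T (?v t) \<phi> =
             - \<epsilon> * (LINT x|lebesgue_on (D T). weak_gradient (D T) (?v t) x \<bullet> weak_gradient (D T) \<phi> x)
             + lam * (LINT x|lebesgue_on (D T). ?v t x * \<phi> x)
             + \<epsilon> * neumann_term T (?v t) \<phi>"
        using ae_H1 pos
      proof eventually_elim
        case (elim t)
        show ?case unfolding weak_gradient_glue_inner[OF elim(1) \<phi>H] mult[OF elim(2)] by (rule refl)
      qed
    qed
  qed
  ultimately show ?thesis
    unfolding target_solution_def cs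
    using continuous_L2_glue[OF sol'(1,3)] L2_loc_H1_glue[OF sol'(2,4) ae_H1] by blast
qed

theorem theorem9:
  fixes P :: "(real ^ 'n) plant" and T :: "(real ^ 'n) target"
    and \<epsilon> lam C_D c :: real
  assumes "CARD('n) \<ge> 2" and "\<epsilon> > 0" and "lam > 0"
    and "plant_config P" and "target_config T"
    and "target_well_posed \<epsilon> lam T"
    and "C_D \<ge> 1" and "c > 0" and "target_decay \<epsilon> lam T C_D c"
    and "compatible P T"
  shows "(\<forall>u0\<in>L2 (\<Omega> P). \<forall>z0\<in>L2 (\<Omega>e P T). \<forall>u z. coupled_solution \<epsilon> lam P T u0 z0 u z \<longrightarrow>
            (\<forall>t\<ge>0. L2_norm (\<Omega> P) (u t) \<le>
               C_D * exp (- c * t) * sqrt ((L2_norm (\<Omega> P) u0)\<^sup>2 + (L2_norm (\<Omega>e P T) z0)\<^sup>2))) \<and>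
         (\<forall>u0\<in>L2 (\<Omega> P). \<forall>u z. coupled_solution \<epsilon> lam P T u0 (\<lambda>_. 0) u z \<longrightarrow>
            (\<forall>t\<ge>0. L2_norm (\<Omega> P) (u t) \<le> C_D * exp (- c * t) * L2_norm (\<Omega> P) u0))"
proof -
  have dim: "2 \<le> DIM(real ^ 'n)" using assms(1) by simp
  interpret lipschitz_interface "\<Omega> P" "\<Omega>e P T" "D T"
    by (rule compatible_lipschitz_interface[OF dim assms(4,5,10)])
  have cs: "concat_state P a b = glue a b" for a b :: "real ^ 'n \<Rightarrow> real"
    by (simp add: concat_state_def glue_def)
  have main: "L2_norm (\<Omega> P) (u t) \<le>
      C_D * exp (- c * t) * sqrt ((L2_norm (\<Omega> P) u0)\<^sup>2 + (L2_norm (\<Omega>e P T) z0)\<^sup>2)"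
    if u0: "u0 \<in> L2 (\<Omega> P)" and z0: "z0 \<in> L2 (\<Omega>e P T)" and sol: "coupled_solution \<epsilon> lam P T u0 z0 u z" and t: "0 \<le> t"
    for u0 z0 u z t
  proof -
    let ?v = "\<lambda>t. glue (u t) (z t)"
    have ts: "target_solution \<epsilon> lam T (glue u0 z0) ?v"
      using coupled_solution_imp_target_solution[OF dim assms(4,5,10) sol] by (simp only: cs)
    have L: "u s \<in> L2 (\<Omega> P)" "z s \<in> L2 (\<Omega>e P T)" if "0 \<le> s" for s
    proof -
      have "continuous_L2 (\<Omega> P) u" "continuous_L2 (\<Omega>e P T) z"
        using sol unfolding coupled_solution_def by blast+
      then show "u s \<in> L2 (\<Omega> P)" "z s \<in> L2 (\<Omega>e P T)"
        using that unfolding continuous_L2_def by blast+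
    qed
    have init: "AE x in lebesgue_on (\<Omega> P). u 0 x = u0 x" "AE x in lebesgue_on (\<Omega>e P T). z 0 x = z0 x"
      using sol unfolding coupled_solution_def by blast+
    have split: "(L2_norm (D T) (glue a b))\<^sup>2 = (L2_norm (\<Omega> P) a)\<^sup>2 + (L2_norm (\<Omega>e P T) b)\<^sup>2"
      if "a \<in> L2 (\<Omega> P)" "b \<in> L2 (\<Omega>e P T)" for a b
    proof -
      have "L2_norm (\<Omega> P) (glue a b) = L2_norm (\<Omega> P) a" by (rule L2_norm_cong) (simp add: glue_U)
      moreover have "L2_norm (\<Omega>e P T) (glue a b) = L2_norm (\<Omega>e P T) b" by (rule L2_norm_cong) (simp add: glue_W)
      ultimately show ?thesis using L2_norm_split[OF glue_L2(1,2)[OF that]] by simp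
    qed
    have "(L2_norm (\<Omega> P) (u t))\<^sup>2 \<le> (L2_norm (D T) (?v t))\<^sup>2" using split[OF L[OF t]] by simp
    then have "L2_norm (\<Omega> P) (u t) \<le> L2_norm (D T) (?v t)" by (rule power2_le_imp_le) (rule L2_norm_nonneg)
    also have "\<dots> \<le> C_D * exp (- c * t) * L2_norm (D T) (?v 0)"
      using assms(9) glue_L2(3)[OF u0 z0] ts t unfolding target_decay_def by blast
    also have "L2_norm (D T) (?v 0) = sqrt ((L2_norm (\<Omega> P) (u 0))\<^sup>2 + (L2_norm (\<Omega>e P T) (z 0))\<^sup>2)"
      using split[OF L[of 0]] L2_norm_nonneg[of "D T" "?v 0"] by (simp add: real_sqrt_unique)
    also have "L2_norm (\<Omega> P) (u 0) = L2_norm (\<Omega> P) u0"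
      by (rule L2_norm_cong_AE[OF lebesgue_sets(1) init(1)])
    also have "L2_norm (\<Omega>e P T) (z 0) = L2_norm (\<Omega>e P T) z0"
      by (rule L2_norm_cong_AE[OF lebesgue_sets(2) init(2)])
    finally show ?thesis .
  qed
  have zero: "(\<lambda>_. 0) \<in> L2 (\<Omega>e P T)" "L2_norm (\<Omega>e P T) (\<lambda>_. 0) = 0"
    by (simp_all add: L2_def L2_norm_def)
  have "L2_norm (\<Omega> P) (u t) \<le> C_D * exp (- c * t) * L2_norm (\<Omega> P) u0"
    if "u0 \<in> L2 (\<Omega> P)" "coupled_solution \<epsilon> lam P T u0 (\<lambda>_. 0) u z" "0 \<le> t" for u0 u z t
    using main[OF that(1) zero(1) that(2,3)] L2_norm_nonneg[of "\<Omega> P" u0] by (simp add: zero(2))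
  then show ?thesis using main by blast
qed

end
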